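(* Let $G$ be a finite subset of $\mathcal{B}^\star_1 \cup \mathcal{B}^\star_3 \cup \mathcal{B}^\star_{4,\mathrm{good}}$ and let $T>0$. The map $$C^\infty_c((0,T);\mathbb{R}) \to \mathbb{R}^G, \qquad u \mapsto \left(\xi_b(T,u)\right)_{b\in G}$$ is onto. Moreover it admits a right inverse $R_G : \mathbb{R}^G \to C^\infty_c((0,T);\mathbb{R})$ with $R_G(0)=0$ which, for every $k\in\mathbb{N}$, is continuous with values in $W^{k,\infty}_0(0,T)$.
   Context: Brackets. Let $X=\{X_0,X_1\}$ be two non-commutative indeterminates and $\mathrm{Br}(X)$ the free magma over $X$ (formal iterated brackets $(a,b)$). For $b\in \mathrm{Br}(X)$ and $\nu\in\mathbb{N}$, $b0^\nu$ denotes $((\cdots(b,X_0),\ldots),X_0)$ with $\nu$ occurrences of $X_0$ added. For $j,k,l\in\mathbb{N}^*$, $\nu\in\mathbb{N}$ define successively $M_\nu:=X_10^\nu$, $W_{j,\nu}:=(M_{j-1},M_j)0^\nu$, $P_{j,k,\nu}:=(M_{k-1},W_{j,0})0^\nu$, $Q_{j,k,l,\nu}:=(M_{l-1},P_{j,k,0})0^\nu$. Set $\mathcal{B}^\star_1=\{M_\nu:\nu\in\mathbb{N}\}$, $\mathcal{B}^\star_3=\{P_{j,k,\nu}: 1\le j\le k,\ \nu\in\mathbb{N}\}$, $\mathcal{B}^\star_{4,\mathrm{good}}=\{Q_{j,k,l,\nu}: 1\le j\le k<l,\ \nu\in\mathbb{N}\}$. Coordinates of the second kind. For $u\in L^1(0,T)$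 let $u_0:=u$, $u_{j+1}(t):=\int_0^t u_j$. For these brackets the coordinates of the second kind are $$\xi_{M_\nu}(t,u)=u_{\nu+1}(t),\qquad \xi_{P_{j,k,\nu}}(t,u)=\alpha_{j,k}\int_0^t\frac{(t-s)^\nu}{\nu!}u_k(s)u_j(s)^2\,ds,$$ $$\xi_{Q_{j,k,l,\nu}}(t,u)=\alpha_{j,k}\int_0^t\frac{(t-s)^\nu}{\nu!}u_l(s)u_k(s)u_j(s)^2\,ds\quad (k<l),$$ with $\alpha_{j,k}=\tfrac12$ if $j<k$ and $\alpha_{j,j}=\tfrac16$. $W^{k,\infty}_0(0,T)$ is the subspace of $W^{k,\infty}(0,T)$ of functions vanishing at $0$ and $T$ together with their derivatives up to order $k-1$, with norm $\|u\|_{L^\infty}+\dots+\|u^{(k)}\|_{L^\infty}$. *)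

theory Defs
  imports "HOL-Analysis.Analysis" "HOL-Probability.Essential_Supremum"
begin

section \<open>Brackets\<close>

(* The free magma over the two indeterminates X0 and X1. *)
datatype bracket = X0 | X1 | Br bracket bracket

primrec app0 :: "bracket \<Rightarrow> nat \<Rightarrow> bracket" where
  "app0 b 0 = b"
| "app0 b (Suc \<nu>) = Br (app0 b \<nu>) X0"

definition M_br :: "nat \<Rightarrow> bracket" where
  "M_br \<nu> = app0 X1 \<nu>"

(* In the next three definitions j, k, l are positive, so that the natural number subtractions
   do not truncate; every use below is guarded accordingly. *)
definition W_br :: "nat \<Rightarrow> nat \<Rightarrow> bracket" where
  "W_br j \<nu> = app0 (Br (M_br (j - 1)) (M_br j)) \<nu>"

definition P_br :: "nat \<Rightarrow> nat \<Rightarrow> nat \<Rightarrow> bracket" where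
  "P_br j k \<nu> = app0 (Br (M_br (k - 1)) (W_br j 0)) \<nu>"

definition Q_br :: "nat \<Rightarrow> nat \<Rightarrow> nat \<Rightarrow> nat \<Rightarrow> bracket" where
  "Q_br j k l \<nu> = app0 (Br (M_br (l - 1)) (P_br j k 0)) \<nu>"

definition B1_star :: "bracket set" where
  "B1_star = {M_br \<nu> | \<nu>. True}"

definition B3_star :: "bracket set" where
  "B3_star = {P_br j k \<nu> | j k \<nu>. 1 \<le> j \<and> j \<le> k}"

definition B4_good_star :: "bracket set" where
  "B4_good_star = {Q_br j k l \<nu> | j k l \<nu>. 1 \<le> j \<and> j \<le> k \<and> k < l}"


section \<open>Coordinates of the second kind\<close>

primrec iter_prim :: "nat \<Rightarrow> (real \<Rightarrow> real) \<Rightarrow> real \<Rightarrow> real" where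
  "iter_prim 0 u = u"
| "iter_prim (Suc j) u = (\<lambda>t. integral {0..t} (iter_prim j u))"

(* Only used for j \<le> k. *)
definition alpha :: "nat \<Rightarrow> nat \<Rightarrow> real" where
  "alpha j k = (if j < k then 1 / 2 else 1 / 6)"

definition xi_M :: "nat \<Rightarrow> real \<Rightarrow> (real \<Rightarrow> real) \<Rightarrow> real" where
  "xi_M \<nu> t u = iter_prim (\<nu> + 1) u t"

definition xi_P :: "nat \<Rightarrow> nat \<Rightarrow> nat \<Rightarrow> real \<Rightarrow> (real \<Rightarrow> real) \<Rightarrow> real" where
  "xi_P j k \<nu> t u = alpha j k *
     integral {0..t} (\<lambda>s. (t - s) ^ \<nu> / fact \<nu> * iter_prim k u s * (iter_prim j u s)\<^sup>2)"

definition xi_Q :: "nat \<Rightarrow> nat \<Rightarrow> nat \<Rightarrow> nat \<Rightarrow> real \<Rightarrow> (real \<Rightarrow> real) \<Rightarrow> real" where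
  "xi_Q j k l \<nu> t u = alpha j k *
     integral {0..t} (\<lambda>s. (t - s) ^ \<nu> / fact \<nu> *
       iter_prim l u s * iter_prim k u s * (iter_prim j u s)\<^sup>2)"

(* The coordinate is attached to the bracket itself, not to its indices. The lemmas xi_M_br, xi_P_br
   and xi_Q_br below show that the description is unambiguous, since a bracket of one of the three
   families determines its family and its indices. On all other brackets xi is unspecified. *)
definition xi :: "bracket \<Rightarrow> real \<Rightarrow> (real \<Rightarrow> real) \<Rightarrow> real" where
  "xi b t u = (THE x.
      (\<exists>\<nu>. b = M_br \<nu> \<and> x = xi_M \<nu> t u) \<or>
      (\<exists>j k \<nu>. 1 \<le> j \<and> j \<le> k \<and> b = P_br j k \<nu> \<and> x = xi_P j k \<nu> t u) \<or>
      (\<exists>j k l \<nu>. 1 \<le> j \<and> j \<le> k \<and> k < l \<and> b = Q_br j k l \<nu> \<and> x = xi_Q j k l \<nu> t u))"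

lemma app0_inject:
  assumes "\<nexists>c. a = Br c X0" "\<nexists>c. b = Br c X0"
  shows "app0 a m = app0 b n \<longleftrightarrow> a = b \<and> m = n"
proof
  assume "app0 a m = app0 b n"
  then show "a = b \<and> m = n"
  proof (induction m arbitrary: n)
    case 0
    then show ?case using assms by (cases n) auto
  next
    case (Suc m)
    then show ?case using assms by (cases n) auto
  qed
qed auto

lemma M_br_neq_X0 [simp]: "M_br n \<noteq> X0"
  by (cases n) (auto simp: M_br_def)

lemma M_br_inject [simp]: "M_br m = M_br n \<longleftrightarrow> m = n"
  by (simp add: M_br_def app0_inject)

lemma W_br_neq_X0 [simp]: "W_br j 0 \<noteq> X0"
  by (simp add: W_br_def)

lemma P_br_neq_X0 [simp]: "P_br j k 0 \<noteq> X0"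
  by (simp add: P_br_def)

lemma W_br_inject: "W_br j 0 = W_br j' 0 \<longleftrightarrow> j = j'"
  by (auto simp: W_br_def)

lemma P_br_inject:
  assumes "1 \<le> k" "1 \<le> k'"
  shows "P_br j k \<nu> = P_br j' k' \<nu>' \<longleftrightarrow> j = j' \<and> k = k' \<and> \<nu> = \<nu>'"
  using assms by (auto simp: P_br_def app0_inject W_br_inject)

lemma Q_br_inject:
  assumes "1 \<le> k" "1 \<le> k'" "1 \<le> l" "1 \<le> l'"
  shows "Q_br j k l \<nu> = Q_br j' k' l' \<nu>' \<longleftrightarrow> j = j' \<and> k = k' \<and> l = l' \<and> \<nu> = \<nu>'"
  using assms by (auto simp: Q_br_def app0_inject P_br_inject)

lemma M_br_neq_Br: "M_br n = Br a b \<Longrightarrow> b = X0"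
  by (cases n) (auto simp: M_br_def)

lemma M_br_neq_P_br: "M_br \<nu> \<noteq> P_br j k \<nu>'"
  by (auto simp: M_br_def P_br_def app0_inject)

lemma M_br_neq_Q_br: "M_br \<nu> \<noteq> Q_br j k l \<nu>'"
  by (auto simp: M_br_def Q_br_def app0_inject)

lemma P_br_neq_Q_br: "P_br j k \<nu> \<noteq> Q_br j' k' l' \<nu>'"
proof -
  have "W_br j 0 \<noteq> P_br j' k' 0"
    by (auto simp: W_br_def P_br_def dest: M_br_neq_Br)
  then show ?thesis
    by (auto simp: P_br_def[of j k \<nu>] Q_br_def app0_inject)
qed

lemma xi_M_br: "xi (M_br \<nu>) t u = xi_M \<nu> t u"
  unfolding xi_def by (rule the_equality) (auto simp: M_br_neq_P_br M_br_neq_Q_br)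

lemma xi_P_br:
  assumes "1 \<le> j" "j \<le> k"
  shows "xi (P_br j k \<nu>) t u = xi_P j k \<nu> t u"
  unfolding xi_def
  by (rule the_equality)
    (use assms in \<open>auto simp: M_br_neq_P_br[symmetric] P_br_neq_Q_br P_br_inject\<close>)

lemma xi_Q_br:
  assumes "1 \<le> j" "j \<le> k" "k < l"
  shows "xi (Q_br j k l \<nu>) t u = xi_Q j k l \<nu> t u"
  unfolding xi_def
  by (rule the_equality)
    (use assms in \<open>auto simp: M_br_neq_Q_br[symmetric] P_br_neq_Q_br[symmetric] Q_br_inject\<close>)


section \<open>Function spaces on the interval\<close>

(* Smooth functions with compact support in the open interval, identified with their extension
   by zero to the real line. *)
definition Cc_smooth :: "real \<Rightarrow> (real \<Rightarrow> real) set" where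
  "Cc_smooth T = {u. (\<forall>n x. (deriv ^^ n) u differentiable (at x)) \<and>
     compact (closure {x. u x \<noteq> 0}) \<and> closure {x. u x \<noteq> 0} \<subseteq> {0<..<T}}"

definition Linf_norm :: "real \<Rightarrow> (real \<Rightarrow> real) \<Rightarrow> ereal" where
  "Linf_norm T f = esssup (lebesgue_on {0<..<T}) (\<lambda>t. ereal \<bar>f t\<bar>)"

(* g is (a representative of) the i-th weak derivative of f on the open interval. Bounded measurable
   functions on the interval are integrable, so restricting to integrable functions loses nothing
   for the spaces below. *)
definition weak_deriv :: "real \<Rightarrow> nat \<Rightarrow> (real \<Rightarrow> real) \<Rightarrow> (real \<Rightarrow> real) \<Rightarrow> bool" where
  "weak_deriv T i f g \<longleftrightarrow>
     f absolutely_integrable_on {0<..<T} \<and> g absolutely_integrable_on {0<..<T} \<and>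
     (\<forall>\<phi>\<in>Cc_smooth T. integral {0<..<T} (\<lambda>t. f t * (deriv ^^ i) \<phi> t) =
        (- 1) ^ i * integral {0<..<T} (\<lambda>t. g t * \<phi> t))"

(* The sum of the sup norms of the weak derivatives of order at most k. Weak derivatives are unique
   up to null sets, so the infimum ranges over a single value when they exist, and it is
   infinite otherwise. *)
definition Wk_inf_norm :: "real \<Rightarrow> nat \<Rightarrow> (real \<Rightarrow> real) \<Rightarrow> ereal" where
  "Wk_inf_norm T k f =
     (INF g \<in> {g. \<forall>i\<le>k. weak_deriv T i f (g i)}. \<Sum>i\<le>k. Linf_norm T (g i))"

(* Boundary values are those of the continuous representatives of the derivatives of order
   less than k. *)
definition Wk_inf_0 :: "real \<Rightarrow> nat \<Rightarrow> (real \<Rightarrow> real) set" where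
  "Wk_inf_0 T k = {f. Wk_inf_norm T k f < \<infinity> \<and>
     (\<forall>i<k. \<exists>g. weak_deriv T i f g \<and> continuous_on {0..T} g \<and> g 0 = 0 \<and> g T = 0)}"

(* The norm topology. Elements are functions rather than classes modulo equality almost everywhere,
   so this is the pullback of the topology of the quotient. *)
definition Wk_inf_0_topology :: "real \<Rightarrow> nat \<Rightarrow> (real \<Rightarrow> real) topology" where
  "Wk_inf_0_topology T k = topology_generated_by
     {{g \<in> Wk_inf_0 T k. Wk_inf_norm T k (\<lambda>t. g t - f t) < ereal \<epsilon>} | f \<epsilon>.
        f \<in> Wk_inf_0 T k \<and> 0 < \<epsilon>}"

lemma topspace_Wk_inf_0_topology: "topspace (Wk_inf_0_topology T k) = Wk_inf_0 T k"
proof -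
  have "Linf_norm T (\<lambda>_. 0) \<le> 0"
    unfolding Linf_norm_def by (rule esssup_I) auto
  then have "(\<Sum>i\<le>k. Linf_norm T ((\<lambda>_ _. 0) i)) \<le> 0"
    by (intro sum_nonpos) auto
  moreover have "weak_deriv T i (\<lambda>_. 0) (\<lambda>_. 0)" for i
    by (simp add: weak_deriv_def)
  ultimately have "Wk_inf_norm T k (\<lambda>_. 0) \<le> 0"
    unfolding Wk_inf_norm_def by (intro INF_lower2[where i = "\<lambda>_ _. 0"]) auto
  then have self: "Wk_inf_norm T k (\<lambda>t. f t - f t) < ereal 1" for f :: "real \<Rightarrow> real"
    by (auto simp: less_le_trans intro: le_less_trans)
  show ?thesis
    unfolding Wk_inf_0_topology_def topology_generated_by_topspace
  proof (intro equalityI subsetI)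
    fix f assume f: "f \<in> Wk_inf_0 T k"
    then show "f \<in> \<Union> {{g \<in> Wk_inf_0 T k. Wk_inf_norm T k (\<lambda>t. g t - f t) < ereal \<epsilon>} | f \<epsilon>.
        f \<in> Wk_inf_0 T k \<and> 0 < \<epsilon>}"
      by (intro UnionI[where X = "{g \<in> Wk_inf_0 T k. Wk_inf_norm T k (\<lambda>t. g t - f t) < ereal 1}"])
        (use f self in \<open>auto intro!: exI[where x = f] exI[where x = "1::real"]\<close>)
  qed auto
qed

end

theory Submission
  imports Defs
begin

text \<open>
  With \<open>u = \<psi>\<^bsup>(N)\<^esup>\<close> for \<open>\<psi>\<close> smooth and compactly supported, the primitives of \<open>u\<close> are derivatives of \<open>\<psi>\<close>,
  so the coordinates of cubic and quartic brackets are integrals of \<open>(T - s)\<^sup>\<nu>\<close> against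
  \<open>(\<Prod>i\<in>A. \<psi>\<^bsup>(i)\<^esup>) (\<psi>\<^bsup>(c)\<^esup>)\<^sup>2\<close> with \<open>A\<close> a set of one or two distinct orders at most \<open>c\<close>. They add up over pieces with
  disjoint supports and are homogeneous in each piece.

  Adding to a slow function \<open>\<theta>\<close> a narrow bump whose \<open>c\<close>-th derivative is large while its lower derivatives are
  small makes the integral proportional to \<open>\<Prod>i\<in>A. \<theta>\<^bsup>(i)\<^esup>\<close> at one point. The jet of \<open>\<theta>\<close> there is free and
  the orders in \<open>A\<close> are distinct, so one set \<open>A\<close> can be singled out with either sign; orders below \<open>c\<close> become
  negligible, and placing the piece close to \<open>T\<close> makes larger \<open>\<nu>\<close> negligible. Such triangular
  dominance yields finitely many pieces whose vectors of coordinates span positively.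

  Quartic pieces are replaced by signed copies annihilating all cubic coordinates, so the system is triangular: a
  last piece near \<open>T\<close> realizes the linear coordinates, then cubic pieces correct the cubic ones, then quartic
  pieces the quartic ones, with amplitudes that are cube and fourth roots of Lipschitz functions.
\<close>

section \<open>Smooth functions\<close>

text \<open>Signs are the obstacle. A quartic coordinate is the same for \<open>u\<close> and
  \<open>-u\<close>, so rescaling a piece only multiplies it by a fourth power, and an ordinary
  linear basis would not do. For \<open>k = l\<close> the integrand would be nonnegative and no
  choice of pieces could help; \<open>k < l\<close> leaves two different derivatives whose signs at
  a point are independent.

  Differentiating \<open>N\<close> times, with \<open>N\<close> bounding all indices, confines every
  relevant primitive to the support of its piece: nothing is carried over to later times. The price
  is that the linear coordinates vanish on such pieces. The piece that realizes them is therefore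
  not of this form, its primitives need not vanish at \<open>T\<close>, and it has to come last.

  Give the bump width \<mu>^p and \<open>c\<close>-th derivative of size \<mu>^(-q). Its lower
  derivatives tend to 0 if q < p, and the square integral of the \<open>c\<close>-th one grows if p
  < 2q; p = 4 and q = 3 satisfy both. If \<open>c\<close> lies in \<open>A\<close>, the cube of the
  \<open>c\<close>-th derivative would swamp the useful square, and parity has to remove it.\<close>

definition smooth :: "(real \<Rightarrow> real) \<Rightarrow> bool" where
  "smooth f \<longleftrightarrow> (\<forall>n x. (deriv ^^ n) f differentiable (at x))"

lemma smooth_has_deriv:
  "smooth f \<Longrightarrow> ((deriv ^^ n) f has_real_derivative (deriv ^^ Suc n) f x) (at x)"
  by (simp add: smooth_def DERIV_deriv_iff_real_differentiable)

lemma smooth_deriv_funpow: "smooth f \<Longrightarrow> smooth ((deriv ^^ k) f)"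
  by (simp add: smooth_def flip: funpow_add[unfolded comp_def, THEN fun_cong])

lemma smooth_continuous_on: "smooth f \<Longrightarrow> continuous_on S ((deriv ^^ n) f)"
  by (meson smooth_has_deriv DERIV_isCont continuous_at_imp_continuous_on)

lemma smooth_continuous_on0: "smooth f \<Longrightarrow> continuous_on S f"
  using smooth_continuous_on[of f S 0] by simp

lemma smooth_lipschitz:
  assumes "smooth f"
  obtains L where "\<And>x y. x \<in> {a..b} \<Longrightarrow> y \<in> {a..b} \<Longrightarrow> \<bar>f x - f y\<bar> \<le> L * \<bar>x - y\<bar>"
proof -
  have "compact ((deriv f) ` {a..b})"
    using smooth_continuous_on[OF assms, of "{a..b}" 1] by (intro compact_continuous_image) auto
  then obtain L where L: "\<And>x. x \<in> {a..b} \<Longrightarrow> \<bar>deriv f x\<bar> \<le> L"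
    by (metis bounded_iff compact_imp_bounded image_eqI real_norm_def)
  show thesis
  proof (rule that)
    fix x y assume "x \<in> {a..b}" "y \<in> {a..b}"
    then show "\<bar>f x - f y\<bar> \<le> L * \<bar>x - y\<bar>"
      using field_differentiable_bound[of "{a..b}" f "deriv f" L x y] L
        smooth_has_deriv[OF assms, of 0]
      by (auto intro: has_field_derivative_at_within)
  qed
qed

text \<open>Exhibiting a sequence of functions, each the derivative of its predecessor, yields
  smoothness and a closed form of all derivatives at once; most smoothness claims below are obtained
  in this way.\<close>

lemma smooth_family:
  assumes "\<And>n x. (D n has_real_derivative D (Suc n) x) (at x)"
  shows "smooth (D 0)" "(deriv ^^ n) (D 0) = D n"
proof -
  show *: "(deriv ^^ n) (D 0) = D n" for n
  proof (induction n)
    case (Suc n)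
    then show ?case using assms by (auto intro: DERIV_imp_deriv)
  qed auto
  show "smooth (D 0)"
    unfolding smooth_def * using assms real_differentiable_def by blast
qed

lemma smooth_const [simp]: "smooth (\<lambda>_. c)"
  using smooth_family(1)[of "\<lambda>n x. if n = 0 then c else 0"] by simp

lemma smooth_affine:
  assumes "smooth f"
  shows "smooth (\<lambda>x. f (a * x + b))"
    "(deriv ^^ n) (\<lambda>x. f (a * x + b)) = (\<lambda>x. a ^ n * (deriv ^^ n) f (a * x + b))"
  by (use smooth_family[of "\<lambda>n x. a ^ n * (deriv ^^ n) f (a * x + b)"]
      in \<open>force intro!: derivative_eq_intros DERIV_chain2[OF smooth_has_deriv[OF assms]] simp: algebra_simps\<close>)+

lemma smooth_shift:
  assumes "smooth f"
  shows "smooth (\<lambda>x. f (x - b))" "(deriv ^^ n) (\<lambda>x. f (x - b)) = (\<lambda>x. (deriv ^^ n) f (x - b))"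
  using smooth_affine[OF assms, where a = 1 and b = "-b"] by simp_all

lemma smooth_sum:
  assumes "\<And>i. i \<in> I \<Longrightarrow> smooth (f i)"
  shows "smooth (\<lambda>x. \<Sum>i\<in>I. c i * f i x)"
    "(deriv ^^ n) (\<lambda>x. \<Sum>i\<in>I. c i * f i x) = (\<lambda>x. \<Sum>i\<in>I. c i * (deriv ^^ n) (f i) x)"
proof -
  have *: "((\<lambda>x. \<Sum>i\<in>I. c i * (deriv ^^ n) (f i) x) has_real_derivative
      (\<Sum>i\<in>I. c i * (deriv ^^ Suc n) (f i) x)) (at x)" for n x
    by (rule DERIV_sum) (intro DERIV_cmult smooth_has_deriv assms)
  show "smooth (\<lambda>x. \<Sum>i\<in>I. c i * f i x)"
    "(deriv ^^ n) (\<lambda>x. \<Sum>i\<in>I. c i * f i x) = (\<lambda>x. \<Sum>i\<in>I. c i * (deriv ^^ n) (f i) x)"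
    using smooth_family[of "\<lambda>n x. \<Sum>i\<in>I. c i * (deriv ^^ n) (f i) x", OF *] by simp_all
qed

lemma smooth_add:
  assumes "smooth f" "smooth g"
  shows "smooth (\<lambda>x. f x + g x)"
    "(deriv ^^ n) (\<lambda>x. f x + g x) = (\<lambda>x. (deriv ^^ n) f x + (deriv ^^ n) g x)"
proof -
  have "((\<lambda>x. (deriv ^^ n) f x + (deriv ^^ n) g x) has_real_derivative
      ((deriv ^^ Suc n) f x + (deriv ^^ Suc n) g x)) (at x)" for n x
    by (intro DERIV_add smooth_has_deriv assms)
  from smooth_family[of "\<lambda>n x. (deriv ^^ n) f x + (deriv ^^ n) g x", OF this]
  show "smooth (\<lambda>x. f x + g x)"
    "(deriv ^^ n) (\<lambda>x. f x + g x) = (\<lambda>x. (deriv ^^ n) f x + (deriv ^^ n) g x)" by simp_all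
qed

lemma smooth_cmult:
  assumes "smooth f"
  shows "smooth (\<lambda>x. c * f x)" "(deriv ^^ n) (\<lambda>x. c * f x) = (\<lambda>x. c * (deriv ^^ n) f x)"
  using smooth_sum[where I = "{()}" and f = "\<lambda>_. f" and c = "\<lambda>_. c"] assms by simp_all

lemma smooth_mult:
  assumes "smooth f" "smooth g"
  shows "smooth (\<lambda>x. f x * g x)"
proof -
  let ?f = "\<lambda>i. (deriv ^^ i) f" and ?g = "\<lambda>i. (deriv ^^ i) g"
  define D where "D n x = (\<Sum>i\<le>n. real (n choose i) * ?f i x * ?g (n - i) x)" for n x
  have "(D n has_real_derivative D (Suc n) x) (at x)" for n x
  proof -
    have "(D n has_real_derivative
      (\<Sum>i\<le>n. real (n choose i) * (?f (Suc i) x * ?g (n - i) x + ?f i x * ?g (Suc n - i) x))) (at x)"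
      unfolding D_def
    proof (rule DERIV_sum)
      fix i assume i: "i \<in> {..n}"
      note [derivative_intros] = smooth_has_deriv[OF assms(1)] smooth_has_deriv[OF assms(2)]
      show "((\<lambda>x. real (n choose i) * ?f i x * ?g (n - i) x) has_real_derivative
        real (n choose i) * (?f (Suc i) x * ?g (n - i) x + ?f i x * ?g (Suc n - i) x)) (at x)"
        using i by (auto intro!: derivative_eq_intros simp: Suc_diff_le algebra_simps)
    qed
    \<comment> \<open>The second sum may run up to \<open>Suc n\<close> because
      \<open>n choose Suc n\<close> is 0. Splitting off its term at 0 then lets Pascal's rule merge
      the two sums.\<close>
    also have "(\<Sum>i\<le>n. real (n choose i) * (?f (Suc i) x * ?g (n - i) x + ?f i x * ?g (Suc n - i) x)) =
      (\<Sum>i\<le>n. real (n choose i) * ?f (Suc i) x * ?g (n - i) x) +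
      (\<Sum>i\<le>Suc n. real (n choose i) * ?f i x * ?g (Suc n - i) x)"
      by (simp add: algebra_simps flip: sum.distrib)
    also have "\<dots> = D (Suc n) x"
      unfolding D_def sum.atMost_Suc_shift by (simp add: algebra_simps flip: sum.distrib)
    finally show ?thesis .
  qed
  from smooth_family(1)[of D, OF this] show ?thesis
    by (simp add: D_def[abs_def])
qed

lemma smooth_mono_deriv:
  "smooth (\<lambda>x. (x - s) ^ j / fact j)"
  "(deriv ^^ i) (\<lambda>x. (x - s) ^ j / fact j) s = (if i = j then 1 else 0)"
proof -
  define D where "D i x = (if i \<le> j then (x - s) ^ (j - i) / fact (j - i) else 0)" for i and x :: real
  have "(D i has_real_derivative D (Suc i) x) (at x)" for i x
  proof (cases "i < j")
    case True
    define m where "m = j - Suc i"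
    have m: "j - i = Suc m" "j - Suc i = m" "i \<le> j" "Suc i \<le> j" using True by (auto simp: m_def)
    have "((\<lambda>x. (x - s) ^ Suc m / fact (Suc m)) has_real_derivative (x - s) ^ m / fact m) (at x)"
      by (rule derivative_eq_intros refl | simp)+
    then show ?thesis unfolding D_def[abs_def] using m by simp
  qed (cases "i = j"; simp add: D_def[abs_def])
  from smooth_family[of D, OF this] show "smooth (\<lambda>x. (x - s) ^ j / fact j)"
    "(deriv ^^ i) (\<lambda>x. (x - s) ^ j / fact j) s = (if i = j then 1 else 0)"
    by (auto simp: D_def[abs_def])
qed

lemma smooth_power_diff: "smooth (\<lambda>s. (T - s) ^ \<nu>)"
proof -
  have "smooth (\<lambda>x. fact \<nu> * ((- 1 * x + T - 0) ^ \<nu> / fact \<nu>))"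
    by (intro smooth_cmult smooth_affine(1)[of "\<lambda>x. (x - 0) ^ \<nu> / fact \<nu>"] smooth_mono_deriv)
  then show ?thesis by simp
qed

section \<open>Positively spanning families\<close>

text \<open>\<open>t + g t\<close> increases at least half as fast as \<open>t\<close>, hence is
  injective and unbounded in both directions.\<close>

lemma strongly_monotone_root:
  fixes g :: "real \<Rightarrow> real"
  assumes lip: "\<And>s t. \<bar>g s - g t\<bar> \<le> \<bar>s - t\<bar> / 2"
  shows "\<exists>!t. t + g t = y"
proof -
  have cont: "continuous_on UNIV g"
  proof (rule continuous_onI)
    fix x e :: real assume "0 < e"
    then show "\<exists>d>0. \<forall>x'\<in>UNIV. dist x' x < d \<longrightarrow> dist (g x') (g x) \<le> e"
      by (intro exI[of _ e]) (smt (verit) lip dist_real_def field_sum_of_halves)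
  qed
  \<comment> \<open>At distance \<open>B\<close> from 0, \<open>g\<close> is at most
    \<open>\<bar>g 0\<bar> + B / 2\<close> in absolute value, so \<open>B / 2\<close> must make up
    for \<open>\<bar>y\<bar> + \<bar>g 0\<bar>\<close>.\<close>
  define B where "B = 2 * (\<bar>y\<bar> + \<bar>g 0\<bar>)"
  have "B + g B \<ge> y" "- B + g (- B) \<le> y"
    using lip[of B 0] lip[of "- B" 0] B_def by (smt (verit) field_sum_of_halves)+
  then have "\<exists>t. - B \<le> t \<and> t \<le> B \<and> t + g t = y"
    by (intro IVT') (auto intro!: continuous_intros continuous_on_subset[OF cont] simp: B_def)
  moreover have "s = t" if "s + g s = y" "t + g t = y" for s t
    using lip[of s t] that by (smt (verit) field_sum_of_halves)
  ultimately show ?thesis by blast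
qed

text \<open>Elimination with nonnegative coefficients. Each index receives one positive and one
  negative piece, whose effect on the indices treated before is small; nothing is assumed about the
  effect of the earlier pieces on the new index. The amount assigned to the new pieces solves a
  scalar equation with a 1/2-Lipschitz perturbation, and this also keeps the coefficients Lipschitz.
  The numbers \<open>n\<close> are time slots, and \<open>m\<close> is the first one
  allowed.\<close>

lemma positively_spanning_family:
  fixes V :: "'x \<Rightarrow> 'i \<Rightarrow> real" and rk :: "'i \<Rightarrow> nat" and X :: "nat \<Rightarrow> 'x set"
  assumes "finite I"
    and key: "\<And>i \<sigma> \<eta> m. i \<in> I \<Longrightarrow> \<sigma> \<in> {1, -1} \<Longrightarrow> 0 < \<eta> \<Longrightarrow>
      \<exists>n\<ge>m. \<exists>x\<in>X n. \<sigma> * V x i > 0 \<and>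
        (\<forall>i'\<in>I. i' \<noteq> i \<and> rk i' \<le> rk i \<longrightarrow> \<bar>V x i'\<bar> \<le> \<eta> * \<bar>V x i\<bar>)"
  shows "\<exists>D x d L. finite D \<and> D \<subseteq> {m..} \<and> (\<forall>n\<in>D. x n \<in> X n) \<and> (\<forall>n y. (d n y :: real) \<ge> 0) \<and>
    (\<forall>n. d n (\<lambda>_. 0) = 0) \<and> (\<forall>y. \<forall>i\<in>I. (\<Sum>n\<in>D. d n y * V (x n) i) = y i) \<and>
    (\<forall>n y y'. \<bar>d n y - d n y'\<bar> \<le> L * (\<Sum>i\<in>I. \<bar>y i - y' i\<bar>))"
proof -
  define Q where "Q S D x d L \<longleftrightarrow> finite D \<and> D \<subseteq> {m..} \<and> (\<forall>n\<in>D. x n \<in> X n) \<and> (\<forall>n y. (d n y :: real) \<ge> 0) \<and>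
    (\<forall>n. d n (\<lambda>_. 0) = 0) \<and> (\<forall>y. \<forall>i\<in>S. (\<Sum>n\<in>D. d n y * V (x n) i) = y i) \<and> 0 \<le> L \<and>
    (\<forall>n y y'. \<bar>d n y - d n y'\<bar> \<le> L * (\<Sum>i\<in>S. \<bar>y i - y' i\<bar>))" for S D x d L
  define P where "P S \<longleftrightarrow> (\<exists>D x d L. Q S D x d L)" for S
  have "S \<subseteq> I \<longrightarrow> P S" if "finite S" for S
    using that
  \<comment> \<open>The ranking induction inserts an index of maximal rank, so a piece dominant at
    \<open>i0\<close> is small on all of \<open>S\<close>.\<close>
  proof (induction S rule: finite_ranking_induct[where f = rk])
    case empty
    have "P {}"
      unfolding P_def Q_def by (rule exI[of _ "{}"], rule exI, rule exI[of _ "\<lambda>_ _. 0"], rule exI[of _ 0]) auto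
    then show ?case by simp
  next
    case (insert i0 S)
    show ?case
    proof (cases "i0 \<in> S")
      case True
      then show ?thesis using insert by (auto simp: insert_absorb)
    next
      case i0: False
      show ?thesis
      proof
      assume sub: "insert i0 S \<subseteq> I"
      then have "P S" using insert by auto
      then obtain D x d L where Q: "Q S D x d L"
        unfolding P_def by blast
      have D: "finite D" "D \<subseteq> {m..}" "\<forall>n\<in>D. x n \<in> X n"
        and d0: "\<And>n y. d n y \<ge> 0" "\<And>n. d n (\<lambda>_. 0) = 0"
        and ds: "\<And>y i. i \<in> S \<Longrightarrow> (\<Sum>n\<in>D. d n y * V (x n) i) = y i"
        and L: "0 \<le> L" "\<And>n y y'. \<bar>d n y - d n y'\<bar> \<le> L * (\<Sum>i\<in>S. \<bar>y i - y' i\<bar>)"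
        using Q unfolding Q_def by simp_all
      define B where "B = (\<Sum>n\<in>D. \<bar>V (x n) i0\<bar>)"
      have B: "0 \<le> B" by (simp add: B_def sum_nonneg)
      \<comment> \<open>Small enough for \<open>B * L * card S * \<eta> \<le> 1 / 2\<close>, the
        Lipschitz constant required of \<open>g y\<close> below; the summand 1 keeps the denominator
        positive.\<close>
      define \<eta> where "\<eta> = 1 / (2 * (B * L * card S + 1))"
      have BL: "0 \<le> B * L * card S" using B L by simp
      then have \<eta>: "0 < \<eta>" by (simp add: \<eta>_def)
      have S: "i0 \<in> I" "i' \<in> I \<and> i' \<noteq> i0 \<and> rk i' \<le> rk i0" if "i' \<in> S" for i'
        using that sub i0 insert.hyps by auto
      have i0I: "i0 \<in> I" using sub by simp
      \<comment> \<open>A number above \<open>\<Sum>D\<close> exceeds every element of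
        \<open>D\<close>, so the two new pieces occupy fresh slots.\<close>
      obtain n1 x1 where n1: "n1 \<ge> m + Suc (\<Sum>D)" "x1 \<in> X n1" "1 * V x1 i0 > 0"
        and n1': "\<forall>i'\<in>I. i' \<noteq> i0 \<and> rk i' \<le> rk i0 \<longrightarrow> \<bar>V x1 i'\<bar> \<le> \<eta> * \<bar>V x1 i0\<bar>"
        using key[OF i0I _ \<eta>, of 1 "m + Suc (\<Sum>D)"] by blast
      obtain n2 x2 where n2: "n2 \<ge> Suc n1" "x2 \<in> X n2" "- 1 * V x2 i0 > 0"
        and n2': "\<forall>i'\<in>I. i' \<noteq> i0 \<and> rk i' \<le> rk i0 \<longrightarrow> \<bar>V x2 i'\<bar> \<le> \<eta> * \<bar>V x2 i0\<bar>"
        using key[OF i0I _ \<eta>, of "- 1" "Suc n1"] by blast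
      have n12': "\<bar>V x1 i'\<bar> \<le> \<eta> * \<bar>V x1 i0\<bar>" "\<bar>V x2 i'\<bar> \<le> \<eta> * \<bar>V x2 i0\<bar>" if "i' \<in> S" for i'
        using n1' n2' S(2)[OF that] by blast+
      have D_le: "n \<le> \<Sum>D" if "n \<in> D" for n
        using member_le_sum[of n D "\<lambda>n. n"] that D by auto
      have n12: "n1 \<notin> D" "n2 \<notin> D" "n1 \<noteq> n2" using D_le n1(1) n2(1) by fastforce+
      define c1 where "c1 t = max t 0 / \<bar>V x1 i0\<bar>" for t :: real
      define c2 where "c2 t = max (- t) 0 / \<bar>V x2 i0\<bar>" for t :: real
      have c0: "c1 0 = 0" "c2 0 = 0" "c1 t \<ge> 0" "c2 t \<ge> 0" for t by (auto simp: c1_def c2_def)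
      have ci0: "c1 t * V x1 i0 + c2 t * V x2 i0 = t" for t
        using n1(3) n2(3) by (auto simp: c1_def c2_def max_def)
      \<comment> \<open>Together the new pieces produce exactly \<open>t\<close> at
        \<open>i0\<close>; \<open>r y t\<close> is what the old pieces then have to supply on
        \<open>S\<close>.\<close>
      define r where "r y t i = y i - (c1 t * V x1 i + c2 t * V x2 i)" for y t i
      have r_lip: "\<bar>r y s i - r y t i\<bar> \<le> \<eta> * \<bar>s - t\<bar>" if "i \<in> S" for y s t i
      proof -
        define p where "p = V x1 i / \<bar>V x1 i0\<bar>"
        define q where "q = V x2 i / \<bar>V x2 i0\<bar>"
        have pq: "\<bar>p\<bar> \<le> \<eta>" "\<bar>q\<bar> \<le> \<eta>"
          using n1(3) n2(3) n12'[OF that] by (auto simp: p_def q_def divide_simps)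
        have "r y s i - r y t i = - ((max s 0 - max t 0) * p + (max (-s) 0 - max (-t) 0) * q)"
          by (simp add: r_def c1_def c2_def p_def q_def algebra_simps diff_divide_distrib)
        then have "\<bar>r y s i - r y t i\<bar> = \<bar>(max s 0 - max t 0) * p + (max (-s) 0 - max (-t) 0) * q\<bar>"
          by (simp only: abs_minus_cancel)
        also have "\<dots> \<le> \<bar>max s 0 - max t 0\<bar> * \<bar>p\<bar> + \<bar>max (-s) 0 - max (-t) 0\<bar> * \<bar>q\<bar>"
          by (metis abs_mult abs_triangle_ineq)
        also have "\<dots> \<le> \<bar>max s 0 - max t 0\<bar> * \<eta> + \<bar>max (-s) 0 - max (-t) 0\<bar> * \<eta>"
          by (intro add_mono mult_left_mono pq) auto
        also have "\<dots> = (\<bar>max s 0 - max t 0\<bar> + \<bar>max (-s) 0 - max (-t) 0\<bar>) * \<eta>"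
          by (simp add: algebra_simps)
        \<comment> \<open>Positive and negative parts together vary by exactly
          \<open>\<bar>s - t\<bar>\<close>, so the two pieces share a single constant
          \<eta>.\<close>
        also have "\<bar>max s 0 - max t 0\<bar> + \<bar>max (-s) 0 - max (-t) 0\<bar> = \<bar>s - t\<bar>" by (auto simp: max_def)
        finally show ?thesis by (simp add: mult.commute)
      qed
      \<comment> \<open>The unwanted contribution of the old pieces at \<open>i0\<close> once they
        produce the residual. The correct share of the new pieces is the \<open>t\<close> with
        \<open>t + g y t = y i0\<close>.\<close>
      define g where "g y t = (\<Sum>n\<in>D. d n (r y t) * V (x n) i0)" for y t
      have g_lip: "\<bar>g y s - g y' t\<bar> \<le> B * L * (\<Sum>i\<in>S. \<bar>r y s i - r y' t i\<bar>)" for y y' s t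
      proof -
        define Z where "Z = (\<Sum>i\<in>S. \<bar>r y s i - r y' t i\<bar>)"
        have "g y s - g y' t = (\<Sum>n\<in>D. (d n (r y s) - d n (r y' t)) * V (x n) i0)"
          unfolding g_def by (simp add: left_diff_distrib sum_subtractf)
        also have "\<bar>\<dots>\<bar> \<le> (\<Sum>n\<in>D. \<bar>(d n (r y s) - d n (r y' t)) * V (x n) i0\<bar>)"
          by (rule sum_abs)
        also have "\<dots> \<le> (\<Sum>n\<in>D. L * Z * \<bar>V (x n) i0\<bar>)"
          unfolding abs_mult Z_def by (intro sum_mono mult_right_mono L) auto
        also have "\<dots> = B * L * Z"
          by (simp add: B_def flip: sum_distrib_left)
        finally show ?thesis by (simp add: Z_def)
      qed
      have g_lip_t: "\<bar>g y s - g y t\<bar> \<le> \<bar>s - t\<bar> / 2" for y s t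
      proof -
        have "\<bar>g y s - g y t\<bar> \<le> B * L * (\<Sum>i\<in>S. \<eta> * \<bar>s - t\<bar>)"
          by (rule order_trans[OF g_lip]) (intro mult_left_mono sum_mono r_lip, use B L in auto)
        also have "\<dots> = (B * L * card S) * \<eta> * \<bar>s - t\<bar>" by simp
        also have "\<dots> \<le> 1 / 2 * \<bar>s - t\<bar>"
          using BL by (intro mult_right_mono) (auto simp: \<eta>_def divide_simps)
        finally show ?thesis by simp
      qed
      have root: "\<exists>!t. t + g y t = y i0" for y
        by (rule strongly_monotone_root) (rule g_lip_t)
      define \<tau> where "\<tau> y = (THE t. t + g y t = y i0)" for y
      have \<tau>: "\<tau> y + g y (\<tau> y) = y i0" for y
        unfolding \<tau>_def by (rule theI'[OF root])
      have r0: "r (\<lambda>_. 0) 0 = (\<lambda>_. 0)" by (simp add: r_def c0 fun_eq_iff)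
      have \<tau>0: "\<tau> (\<lambda>_. 0) = 0"
        unfolding \<tau>_def by (rule the1_equality[OF root]) (simp add: g_def r0 d0)
      let ?N = "\<lambda>y y' :: 'i \<Rightarrow> real. \<Sum>i\<in>insert i0 S. \<bar>y i - y' i\<bar>"
      have N: "(\<Sum>i\<in>S. \<bar>y i - y' i\<bar>) \<le> ?N y y'" "\<bar>y i0 - y' i0\<bar> \<le> ?N y y'"
        "?N y y' = \<bar>y i0 - y' i0\<bar> + (\<Sum>i\<in>S. \<bar>y i - y' i\<bar>)" "0 \<le> ?N y y'" for y y'
      proof -
        have "0 \<le> (\<Sum>i\<in>S. \<bar>y i - y' i\<bar>)" by (rule sum_nonneg) simp
        then show "(\<Sum>i\<in>S. \<bar>y i - y' i\<bar>) \<le> ?N y y'" "\<bar>y i0 - y' i0\<bar> \<le> ?N y y'"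
          "?N y y' = \<bar>y i0 - y' i0\<bar> + (\<Sum>i\<in>S. \<bar>y i - y' i\<bar>)" "0 \<le> ?N y y'"
          using i0 insert.hyps(1) by simp_all
      qed
      have \<tau>_lip: "\<bar>\<tau> y - \<tau> y'\<bar> \<le> (2 + 2 * B * L) * ?N y y'" for y y'
      proof -
        have "\<bar>g y (\<tau> y') - g y' (\<tau> y')\<bar> \<le> B * L * (\<Sum>i\<in>S. \<bar>y i - y' i\<bar>)"
          using g_lip[of y "\<tau> y'" y' "\<tau> y'"] by (simp add: r_def)
        also have "\<dots> \<le> B * L * ?N y y'" using B L N by (intro mult_left_mono) auto
        finally have *: "\<bar>g y (\<tau> y') - g y' (\<tau> y')\<bar> \<le> B * L * ?N y y'" .
        have "\<bar>s - t\<bar> \<le> 2 * W + 2 * W'"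
          if "\<bar>h' - h''\<bar> \<le> W'" "\<bar>h - h'\<bar> \<le> \<bar>s - t\<bar> / 2" "s + h = u" "t + h'' = v" "\<bar>u - v\<bar> \<le> W"
          for s t u v h h' h'' W W' :: real
          using that by (smt (verit) field_sum_of_halves)
        from this[OF * g_lip_t[of y "\<tau> y" "\<tau> y'"] \<tau>[of y] \<tau>[of y'] N(2)[of y y']]
        have "\<bar>\<tau> y - \<tau> y'\<bar> \<le> 2 * ?N y y' + 2 * (B * L * ?N y y')" .
        then show ?thesis by (simp only: distrib_right mult.assoc)
      qed
      define d' where "d' n y = (if n = n1 then c1 (\<tau> y) else if n = n2 then c2 (\<tau> y) else d n (r y (\<tau> y)))" for n y
      define x' where "x' = x(n1 := x1, n2 := x2)"
      define L1 where "L1 = (2 + 2 * B * L)"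
      define L' where "L' = L1 / \<bar>V x1 i0\<bar> + L1 / \<bar>V x2 i0\<bar> + L * (1 + card S * \<eta> * L1)"
      have L1: "0 \<le> L1" using B L by (simp add: L1_def)
      have lips: "\<bar>c1 (\<tau> y) - c1 (\<tau> y')\<bar> \<le> L1 / \<bar>V x1 i0\<bar> * ?N y y'"
        "\<bar>c2 (\<tau> y) - c2 (\<tau> y')\<bar> \<le> L1 / \<bar>V x2 i0\<bar> * ?N y y'"
        "\<bar>d n (r y (\<tau> y)) - d n (r y' (\<tau> y'))\<bar> \<le> L * (1 + card S * \<eta> * L1) * ?N y y'" for y y' n
      proof -
        have max_lip: "\<bar>max s 0 - max t 0\<bar> \<le> \<bar>s - t\<bar>" "\<bar>max (- s) 0 - max (- t) 0\<bar> \<le> \<bar>s - t\<bar>"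
          for s t :: real by (auto simp: max_def)
        note * = order_trans[OF max_lip(1) \<tau>_lip[of y y', folded L1_def]]
          order_trans[OF max_lip(2) \<tau>_lip[of y y', folded L1_def]]
        show "\<bar>c1 (\<tau> y) - c1 (\<tau> y')\<bar> \<le> L1 / \<bar>V x1 i0\<bar> * ?N y y'"
          using divide_right_mono[OF *(1), of "\<bar>V x1 i0\<bar>"]
          by (simp only: c1_def diff_divide_distrib[symmetric] abs_divide abs_abs times_divide_eq_left) 
        show "\<bar>c2 (\<tau> y) - c2 (\<tau> y')\<bar> \<le> L1 / \<bar>V x2 i0\<bar> * ?N y y'"
          using divide_right_mono[OF *(2), of "\<bar>V x2 i0\<bar>"]
          by (simp only: c2_def diff_divide_distrib[symmetric] abs_divide abs_abs times_divide_eq_left)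
        have "\<bar>r y (\<tau> y) i - r y' (\<tau> y') i\<bar> \<le> \<bar>y i - y' i\<bar> + \<eta> * L1 * ?N y y'" if "i \<in> S" for i
        proof -
          have "\<bar>r y (\<tau> y) i - r y' (\<tau> y') i\<bar> \<le> \<bar>r y (\<tau> y) i - r y' (\<tau> y) i\<bar> + \<bar>r y' (\<tau> y) i - r y' (\<tau> y') i\<bar>"
            by simp
          also have "\<dots> \<le> \<bar>y i - y' i\<bar> + \<eta> * \<bar>\<tau> y - \<tau> y'\<bar>"
            using r_lip[OF that, of y' "\<tau> y" "\<tau> y'"] by (simp add: r_def)
          also have "\<dots> \<le> \<bar>y i - y' i\<bar> + \<eta> * (L1 * ?N y y')"
            using \<tau>_lip[of y y'] \<eta> unfolding L1_def by (intro add_left_mono mult_left_mono) auto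
          finally show ?thesis by (simp only: mult.assoc)
        qed
        then have "(\<Sum>i\<in>S. \<bar>r y (\<tau> y) i - r y' (\<tau> y') i\<bar>) \<le> (\<Sum>i\<in>S. \<bar>y i - y' i\<bar> + \<eta> * L1 * ?N y y')"
          by (rule sum_mono)
        also have "\<dots> \<le> ?N y y' + card S * \<eta> * L1 * ?N y y'"
          using N(1)[of y y'] by (simp only: sum.distrib sum_constant mult.assoc) 
        finally have "L * (\<Sum>i\<in>S. \<bar>r y (\<tau> y) i - r y' (\<tau> y') i\<bar>) \<le> L * (?N y y' + card S * \<eta> * L1 * ?N y y')"
          using L by (intro mult_left_mono)
        then show "\<bar>d n (r y (\<tau> y)) - d n (r y' (\<tau> y'))\<bar> \<le> L * (1 + card S * \<eta> * L1) * ?N y y'"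
          using L(2)[of n "r y (\<tau> y)" "r y' (\<tau> y')"] by (simp only: distrib_left distrib_right mult.assoc mult_1_left)
      qed
      have "\<bar>d' n y - d' n y'\<bar> \<le> L' * ?N y y'" for n y y'
      proof -
        have nn: "0 \<le> L1 / \<bar>V x1 i0\<bar> * ?N y y'" "0 \<le> L1 / \<bar>V x2 i0\<bar> * ?N y y'"
          "0 \<le> L * (1 + card S * \<eta> * L1) * ?N y y'"
          using L1 N(4)[of y y'] L \<eta> by (intro mult_nonneg_nonneg add_nonneg_nonneg; simp)+
        have "L' * ?N y y' = L1 / \<bar>V x1 i0\<bar> * ?N y y' + L1 / \<bar>V x2 i0\<bar> * ?N y y' + L * (1 + card S * \<eta> * L1) * ?N y y'"
          unfolding L'_def by (simp only: distrib_right)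
        moreover have "\<bar>u\<bar> \<le> a + b + c" if "\<bar>u\<bar> \<le> a \<or> \<bar>u\<bar> \<le> b \<or> \<bar>u\<bar> \<le> c" "0 \<le> a" "0 \<le> b" "0 \<le> c" for u a b c :: real
          using that by linarith
        ultimately show ?thesis
          using lips(1)[where y = y and y' = y'] lips(2)[where y = y and y' = y'] lips(3)[where y = y and y' = y' and n = n] nn
          by (cases "n = n1"; cases "n = n2") (simp_all only: d'_def if_True if_False simp_thms)
      qed
      moreover have "(\<Sum>n\<in>D \<union> {n1, n2}. d' n y * V (x' n) i) = y i" if "i \<in> insert i0 S" for y i
      proof -
        have "(\<Sum>n\<in>D \<union> {n1, n2}. d' n y * V (x' n) i) = (\<Sum>n\<in>D. d n (r y (\<tau> y)) * V (x n) i) +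
          (c1 (\<tau> y) * V x1 i + c2 (\<tau> y) * V x2 i)"
        proof -
          have "(\<Sum>n\<in>D. d' n y * V (x' n) i) = (\<Sum>n\<in>D. d n (r y (\<tau> y)) * V (x n) i)"
            using n12 by (intro sum.cong) (auto simp: d'_def x'_def)
          then show ?thesis using n12 D by (simp add: d'_def x'_def)
        qed
        also have "\<dots> = y i"
          using that ds[of i "r y (\<tau> y)"] \<tau>[of y] ci0[of "\<tau> y"] i0
          by (cases "i = i0") (auto simp: g_def r_def)
        finally show ?thesis .
      qed
      moreover have "0 \<le> L'" unfolding L'_def using L1 L \<eta> by simp
      moreover have "d' n (\<lambda>_. 0) = 0" "d' n y \<ge> 0" for n y
        by (auto simp: d'_def \<tau>0 r0 c0 d0)
      moreover have "x' n \<in> X n" if "n \<in> D \<union> {n1, n2}" for n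
        using that n12 D n1 n2 by (auto simp: x'_def)
      moreover have "D \<union> {n1, n2} \<subseteq> {m..}" "finite (D \<union> {n1, n2})" using D n1 n2 by auto
      ultimately have "Q (insert i0 S) (D \<union> {n1, n2}) x' d' L'"
        unfolding Q_def by simp
      then show "P (insert i0 S)"
        unfolding P_def by blast
      qed
    qed
  qed
  with assms(1) obtain D x d L where "Q I D x d L"
    unfolding P_def by blast
  then show ?thesis unfolding Q_def by (intro exI[of _ D] exI[of _ x] exI[of _ d] exI[of _ L]) simp
qed

section \<open>Bump functions\<close>

text \<open>The space of smooth functions with compact support in an arbitrary open interval, with
  an explicit closed interval around the support; in this form it is easily carried through sums,
  scalings and shifts.\<close>

definition Cc :: "real \<Rightarrow> real \<Rightarrow> (real \<Rightarrow> real) set" where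
  "Cc p q = {f. smooth f \<and> (\<exists>a b. p < a \<and> a \<le> b \<and> b < q \<and> (\<forall>x. x \<notin> {a..b} \<longrightarrow> f x = 0))}"

lemma CcI: "smooth f \<Longrightarrow> p < a \<Longrightarrow> a \<le> b \<Longrightarrow> b < q \<Longrightarrow> (\<And>x. x \<notin> {a..b} \<Longrightarrow> f x = 0) \<Longrightarrow> f \<in> Cc p q"
  unfolding Cc_def by blast

lemma CcE:
  assumes "f \<in> Cc p q"
  obtains a b where "smooth f" "p < a" "a \<le> b" "b < q" "\<And>x. x \<notin> {a..b} \<Longrightarrow> f x = 0"
  using assms unfolding Cc_def by blast

lemma Cc_smooth_fun: "f \<in> Cc p q \<Longrightarrow> smooth f"
  by (auto simp: Cc_def)

lemma deriv_zero_outside: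
  fixes f :: "real \<Rightarrow> real"
  assumes "\<And>x. x \<notin> {a..b} \<Longrightarrow> f x = 0" "x \<notin> {a..b}"
  shows "(deriv ^^ n) f x = 0"
  using assms(2)
proof (induction n arbitrary: x)
  case (Suc n)
  have "open (- {a..b})" by auto
  have "((deriv ^^ n) f has_real_derivative 0) (at x)"
  proof (rule has_field_derivative_transform_within_open[rotated, where f = "\<lambda>_. 0"])
    show "open (- {a..b})" by fact
    show "0 = (deriv ^^ n) f y" if "y \<in> - {a..b}" for y
      using Suc.IH that by simp
  qed (use Suc.prems in auto)
  then show ?case by (simp add: DERIV_imp_deriv)
qed (use assms in auto)

lemma Cc_deriv: "f \<in> Cc p q \<Longrightarrow> (deriv ^^ n) f \<in> Cc p q"
  by (elim CcE) (rule CcI, rule smooth_deriv_funpow, assumption+, rule deriv_zero_outside)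

lemma Cc_zero: "f \<in> Cc p q \<Longrightarrow> x \<le> p \<or> q \<le> x \<Longrightarrow> (deriv ^^ n) f x = 0"
  by (elim CcE) (erule deriv_zero_outside, auto)

lemma Cc_zero0: "f \<in> Cc p q \<Longrightarrow> x \<le> p \<or> q \<le> x \<Longrightarrow> f x = 0"
  using Cc_zero[of f p q x 0] by simp

lemma Cc_mono: "f \<in> Cc p q \<Longrightarrow> p' \<le> p \<Longrightarrow> q \<le> q' \<Longrightarrow> f \<in> Cc p' q'"
  by (elim CcE) (rule CcI, assumption, erule order.strict_trans1, assumption+, erule order.strict_trans2, auto)

lemma Cc_const_0: "p < q \<Longrightarrow> (\<lambda>_. 0) \<in> Cc p q"
  by (rule CcI[of _ _ "(p+q)/2" "(p+q)/2"]) auto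

lemma Cc_add: 
  assumes "f \<in> Cc p q" "g \<in> Cc p q"
  shows "(\<lambda>x. f x + g x) \<in> Cc p q"
proof -
  obtain a b where f: "p < a" "a \<le> b" "b < q" "\<And>x. x \<notin> {a..b} \<Longrightarrow> f x = 0" by (rule CcE[OF assms(1)]) (rule that; assumption)
  obtain a' b' where g: "p < a'" "a' \<le> b'" "b' < q" "\<And>x. x \<notin> {a'..b'} \<Longrightarrow> g x = 0" by (rule CcE[OF assms(2)]) (rule that; assumption)
  show ?thesis
  proof (rule CcI[of _ _ "min a a'" "max b b'"])
    fix x assume "x \<notin> {min a a'..max b b'}"
    then have "x \<notin> {a..b}" "x \<notin> {a'..b'}" by auto
    then show "f x + g x = 0" by (simp add: f g)
  qed (use f g assms in \<open>auto intro: smooth_add Cc_smooth_fun\<close>)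
qed

lemma Cc_cmult: "f \<in> Cc p q \<Longrightarrow> (\<lambda>x. c * f x) \<in> Cc p q"
  by (elim CcE) (rule CcI, auto intro: smooth_cmult)

lemma Cc_sum:
  assumes "finite I" "p < q" "\<And>i. i \<in> I \<Longrightarrow> f i \<in> Cc p q"
  shows "(\<lambda>x. \<Sum>i\<in>I. c i * f i x) \<in> Cc p q"
  using assms(1,3)
proof induction
  case (insert i F)
  then show ?case by (simp add: Cc_add Cc_cmult)
qed (simp add: Cc_const_0 assms(2))

lemma Cc_mult:
  assumes "smooth f" "g \<in> Cc p q"
  shows "(\<lambda>x. f x * g x) \<in> Cc p q"
  using assms(2) by (elim CcE) (rule CcI, auto intro: smooth_mult assms(1))

lemma Cc_scale:
  assumes "f \<in> Cc a b" "0 < e"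
  shows "(\<lambda>x. f ((x - s) / e)) \<in> Cc (s + e * a) (s + e * b)"
proof -
  obtain a' b' where f: "smooth f" "a < a'" "a' \<le> b'" "b' < b" "\<And>x. x \<notin> {a'..b'} \<Longrightarrow> f x = 0"
    by (rule CcE[OF assms(1)]) (rule that; assumption)
  have "smooth (\<lambda>x. f (1 / e * x + - (s / e)))" by (rule smooth_affine) fact
  moreover have "(\<lambda>x. f (1 / e * x + - (s / e))) = (\<lambda>x. f ((x - s) / e))" by (simp add: diff_divide_distrib)
  ultimately show ?thesis
    by (intro CcI[of _ _ "s + e * a'" "s + e * b'"]) (use f assms(2) in \<open>auto simp: field_simps\<close>)
qed

lemma deriv_scale:
  assumes "smooth f" "0 < e"
  shows "(deriv ^^ n) (\<lambda>x. f ((x - s) / e)) = (\<lambda>x. (deriv ^^ n) f ((x - s) / e) / e ^ n)"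
  using smooth_affine(2)[OF assms(1), of n "1 / e" "- (s / e)"]
  by (simp add: diff_divide_distrib power_divide)

lemma Cc_shift: "f \<in> Cc p q \<Longrightarrow> (\<lambda>x. f (x - d)) \<in> Cc (p + d) (q + d)"
  using Cc_scale[of f p q 1 d] by (simp add: add.commute)

lemma Cc_smooth_eq:
  assumes "0 < T"
  shows "Cc_smooth T = Cc 0 T"
proof (intro equalityI subsetI)
  fix f assume "f \<in> Cc_smooth T"
  then have f: "smooth f" "compact (closure {x. f x \<noteq> 0})" "closure {x. f x \<noteq> 0} \<subseteq> {0<..<T}"
    by (auto simp: Cc_smooth_def smooth_def)
  show "f \<in> Cc 0 T"
  proof (cases "{x. f x \<noteq> 0} = {}")
    case True
    then have "f = (\<lambda>_. 0)" by auto
    then show ?thesis using Cc_const_0 assms by simp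
  next
    case False
    let ?K = "closure {x. f x \<noteq> 0}"
    have K: "?K \<noteq> {}" using False by simp
    obtain a where a: "a \<in> ?K" "\<forall>x\<in>?K. a \<le> x" using compact_attains_inf[OF f(2) K] by blast
    obtain b where b: "b \<in> ?K" "\<forall>x\<in>?K. x \<le> b" using compact_attains_sup[OF f(2) K] by blast
    have "f x = 0" if "x \<notin> {a..b}" for x
    proof (rule ccontr)
      assume "f x \<noteq> 0"
      then have "x \<in> ?K" by (intro subsetD[OF closure_subset]) simp
      then show False using a b that by auto
    qed
    moreover have "0 < a" "b < T" using subsetD[OF f(3) a(1)] subsetD[OF f(3) b(1)] by simp_all
    moreover have "a \<le> b" using a(2) b(1) by (rule bspec)
    ultimately show ?thesis by (intro CcI[OF f(1)])
  qed
next
  fix f assume "f \<in> Cc 0 T"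
  then obtain a b where f: "smooth f" "0 < a" "a \<le> b" "b < T" "\<And>x. x \<notin> {a..b} \<Longrightarrow> f x = 0"
    by (rule CcE) (rule that; assumption)
  have "closure {x. f x \<noteq> 0} \<subseteq> {a..b}"
  proof (rule closure_minimal)
    show "{x. f x \<noteq> 0} \<subseteq> {a..b}" using f(5) by blast
  qed auto
  moreover then have "compact (closure {x. f x \<noteq> 0})"
    by (meson bounded_closed_interval bounded_subset closed_closure compact_eq_bounded_closed)
  ultimately show "f \<in> Cc_smooth T"
    using f by (auto simp: Cc_smooth_def smooth_def)
qed

lemma poly_exp_tendsto_0: "((\<lambda>y. poly p y * exp (- y)) \<longlongrightarrow> 0) (at_top :: real filter)"
proof -
  have "((\<lambda>y. \<Sum>i\<le>degree p. coeff p i * (y ^ i / exp y)) \<longlongrightarrow> (\<Sum>i\<le>degree p. coeff p i * 0)) (at_top :: real filter)"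
    by (intro tendsto_sum tendsto_mult tendsto_const tendsto_power_div_exp_0)
  then show ?thesis
    by (simp add: poly_altdef sum_distrib_right exp_minus divide_inverse mult.assoc)
qed

lemma smooth_flat: "smooth (\<lambda>x. if 0 < x then exp (- (1 / x)) else 0)"
proof -
  \<comment> \<open>Differentiating p(1/x) exp(-1/x) gives (1/x)^2 (p - p')(1/x) exp(-1/x), which is
    the recursion.\<close>
  define P :: "nat \<Rightarrow> real poly" where "P = rec_nat 1 (\<lambda>_ p. [:0, 0, 1:] * (p - pderiv p))"
  have P: "P 0 = 1" "P (Suc n) = [:0, 0, 1:] * (P n - pderiv (P n))" for n
    by (simp_all add: P_def)
  define D where "D n x = (if 0 < x then poly (P n) (1 / x) * exp (- (1 / x)) else 0)" for n x
  have "(D n has_real_derivative D (Suc n) x) (at x)" for n x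
  proof -
    consider "x < 0" | "x = 0" | "0 < x" by linarith
    then show ?thesis
    proof cases
      case 1
      then have "((\<lambda>_. 0) has_real_derivative D (Suc n) x) (at x)"
        by (simp add: D_def)
      then show ?thesis
        by (rule has_field_derivative_transform_within_open[of _ _ _ "{..<0}"]) (use 1 in \<open>auto simp: D_def\<close>)
    next
      case 3
      have "((\<lambda>x. poly (P n) (1 / x) * exp (- (1 / x))) has_real_derivative D (Suc n) x) (at x)"
        using 3 by (auto intro!: derivative_eq_intros DERIV_chain2[OF poly_DERIV]
            simp: D_def P power2_eq_square field_simps)
      then show ?thesis
        by (rule has_field_derivative_transform_within_open[of _ _ _ "{0<..}"]) (use 3 in \<open>auto simp: D_def\<close>)
    next
      case 2
      \<comment> \<open>The extra factor \<open>[:0, 1:]\<close> is the 1/h of the difference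
        quotient at 0.\<close>
      have "((\<lambda>y. poly ([:0, 1:] * P n) y * exp (- y)) \<longlongrightarrow> 0) at_top"
        by (rule poly_exp_tendsto_0)
      then have "((\<lambda>h. poly ([:0, 1:] * P n) (inverse h) * exp (- inverse h)) \<longlongrightarrow> 0) (at_right 0)"
        by (rule filterlim_compose) (rule filterlim_inverse_at_top_right)
      moreover have "\<forall>\<^sub>F h in at_right 0. poly ([:0, 1:] * P n) (inverse h) * exp (- inverse h) = (D n (0 + h) - D n 0) / h"
        unfolding eventually_at_right_field by (intro exI[of _ 1]) (auto simp: D_def divide_simps)
      ultimately have "((\<lambda>h. (D n (0 + h) - D n 0) / h) \<longlongrightarrow> 0) (at_right 0)"
        by (rule Lim_transform_eventually)
      moreover have "\<forall>\<^sub>F h in at_left 0. 0 = (D n (0 + h) - D n 0) / h"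
        unfolding eventually_at_left_field by (auto simp: D_def intro: exI[of _ "-1"])
      then have "((\<lambda>h. (D n (0 + h) - D n 0) / h) \<longlongrightarrow> 0) (at_left 0)"
        by (rule Lim_transform_eventually[OF tendsto_const])
      ultimately have "((\<lambda>h. (D n (0 + h) - D n 0) / h) \<longlongrightarrow> 0) (at 0)"
        by (simp add: filterlim_at_split)
      then show ?thesis
        using 2 by (simp add: DERIV_def D_def)
    qed
  qed
  from smooth_family(1)[of D, OF this] show ?thesis
    by (simp add: D_def[abs_def] P if_distrib cong: if_cong)
qed

definition bump :: "real \<Rightarrow> real" where
  "bump x = (if \<bar>x\<bar> < 1 then exp (- (1 / (1 - x))) * exp (- (1 / (1 + x))) else 0)"

lemma bump_pos: "\<bar>x\<bar> < 1 \<Longrightarrow> 0 < bump x" and bump_nonneg: "0 \<le> bump x"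
  by (auto simp: bump_def)

lemma bump_even: "bump (- x) = bump x"
  by (simp add: bump_def)

lemma smooth_bump: "smooth bump"
proof -
  let ?f = "\<lambda>x::real. if 0 < x then exp (- (1 / x)) else 0"
  have "smooth (\<lambda>x. ?f (-1 * x + 1) * ?f (1 * x + 1))"
    by (intro smooth_mult smooth_affine[OF smooth_flat])
  also have "(\<lambda>x. ?f (-1 * x + 1) * ?f (1 * x + 1)) = bump"
    by (auto simp: bump_def fun_eq_iff add.commute)
  finally show ?thesis .
qed

lemma bump_Cc: "bump \<in> Cc (- 2) 2"
  by (rule CcI[of _ _ "-1" 1]) (auto simp: smooth_bump bump_def)

lemma bump_deriv_even: "(deriv ^^ n) bump (- x) = (- 1) ^ n * (deriv ^^ n) bump x"
proof -
  have "(\<lambda>x. bump (- 1 * x + 0)) = bump" by (simp add: bump_even)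
  then have "(deriv ^^ n) bump = (\<lambda>x. (- 1) ^ n * (deriv ^^ n) bump (- 1 * x + 0))"
    using smooth_affine(2)[OF smooth_bump, of n "-1" 0] by simp
  from fun_cong[OF this, of "- x"] show ?thesis by simp
qed

lemma bump_deriv_nonzero: "\<exists>x. (deriv ^^ n) bump x \<noteq> 0"
proof (induction n)
  case 0
  then show ?case using bump_pos[of 0] by (intro exI[of _ 0]) auto
next
  case (Suc n)
  show ?case
  proof (rule ccontr)
    assume "\<nexists>x. (deriv ^^ Suc n) bump x \<noteq> 0"
    then have "((deriv ^^ n) bump has_real_derivative 0) (at x)" for x
      using smooth_has_deriv[OF smooth_bump, of n x] by simp
    then have "(deriv ^^ n) bump x = (deriv ^^ n) bump 2" for x
      using DERIV_isconst_all by blast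
    moreover have "(deriv ^^ n) bump 2 = 0" by (rule Cc_zero[OF bump_Cc]) auto
    ultimately show False using Suc by simp
  qed
qed

lemma bump_deriv_square_pos: "0 < integral {-2..2} (\<lambda>y. ((deriv ^^ n) bump y)\<^sup>2)"
proof -
  obtain x where x: "(deriv ^^ n) bump x \<noteq> 0" using bump_deriv_nonzero by blast
  have "x \<in> {-2..2}"
    using x Cc_zero[OF bump_Cc, of x n] by (meson atLeastAtMost_iff linear)
  moreover have cont: "continuous_on {-2..2} (\<lambda>y. ((deriv ^^ n) bump y)\<^sup>2)"
    by (intro continuous_intros smooth_continuous_on smooth_bump)
  ultimately have "integral {-2..2} (\<lambda>y. ((deriv ^^ n) bump y)\<^sup>2) \<noteq> 0"
    using x integral_eq_0_iff[OF cont] by auto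
  moreover have "0 \<le> integral {-2..2} (\<lambda>y. ((deriv ^^ n) bump y)\<^sup>2)"
    by (intro integral_nonneg integrable_continuous_real cont) auto
  ultimately show ?thesis by simp
qed

text \<open>The primitive of \<open>bump\<close> is a smooth step, constant outside [-1, 1]. On (-1,
  1) the step translated to the left is complete and the one translated to the right has not begun,
  so their normalized difference is 1 there.\<close>

lemma ex_plateau: "\<exists>\<zeta>\<in>Cc (-4) 4. \<forall>x. \<bar>x\<bar> < 1 \<longrightarrow> \<zeta> x = 1"
proof -
  define S where "S x = integral {-2..x} bump" for x
  have S0: "S x = 0" if "x \<le> - 1" for x
  proof -
    have "S x = integral {-2..x} (\<lambda>_. 0)"
      unfolding S_def using that by (intro integral_cong) (auto simp: bump_def)
    then show ?thesis by simp
  qed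
  have S: "(S has_real_derivative bump x) (at x)" for x
  proof (cases "x < -1")
    case True
    then have "((\<lambda>_. 0) has_real_derivative bump x) (at x)" by (simp add: bump_def)
    then show ?thesis
      by (rule has_field_derivative_transform_within_open[of _ _ _ "{..< -1}"]) (use True S0 in auto)
  next
    case False
    have "(S has_real_derivative bump x) (at x within {-2..x+1})"
      unfolding S_def
      by (rule integral_has_real_derivative) (use False smooth_continuous_on0[OF smooth_bump] in auto)
    then show ?thesis
      using False at_within_Icc_at[of "-2" x "x + 1"] by simp
  qed
  have smooth_S: "smooth S"
  proof -
    define D where "D n = (if n = 0 then S else (deriv ^^ (n - 1)) bump)" for n
    have "(D n has_real_derivative D (Suc n) x) (at x)" for n x
      using S smooth_has_deriv[OF smooth_bump, of "n - 1" x] by (cases n) (auto simp: D_def)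
    from smooth_family(1)[of D, OF this] show ?thesis by (simp add: D_def)
  qed
  have S1: "S x = S 1" if "1 \<le> x" for x
  proof -
    have "S x = S 1 + integral {1..x} bump"
      unfolding S_def using that smooth_continuous_on0[OF smooth_bump]
      by (intro Henstock_Kurzweil_Integration.integral_combine[symmetric] integrable_continuous_real) auto
    also have "integral {1..x} bump = integral {1..x} (\<lambda>_. 0)"
      using that by (intro integral_cong) (auto simp: bump_def)
    finally show ?thesis by simp
  qed
  have "S 1 \<noteq> 0"
    using integral_eq_0_iff[OF smooth_continuous_on0[OF smooth_bump], of "-2" 1] bump_pos[of 0] bump_nonneg
    by (force simp: S_def)
  define \<zeta> where "\<zeta> x = 1 / S 1 * (S (x + 2) + - 1 * S (x - 2))" for x
  have "smooth \<zeta>"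
    unfolding \<zeta>_def using smooth_affine(1)[OF smooth_S, of 1 2] smooth_affine(1)[OF smooth_S, of 1 "-2"]
    by (intro smooth_cmult smooth_add) auto
  then have "\<zeta> \<in> Cc (-4) 4"
  proof (rule CcI[of _ _ "-3" 3])
    fix x :: real assume "x \<notin> {-3..3}"
    then consider "x < -3" | "3 < x" by fastforce
    then show "\<zeta> x = 0"
      by cases (simp_all add: \<zeta>_def S0 S1[of "x + 2"] S1[of "x - 2"])
  qed auto
  moreover have "\<zeta> x = 1" if "\<bar>x\<bar> < 1" for x
    using that S0[of "x - 2"] S1[of "x + 2"] \<open>S 1 \<noteq> 0\<close> by (simp add: \<zeta>_def)
  ultimately show ?thesis by blast
qed

text \<open>A Taylor polynomial has the prescribed derivatives at \<open>s\<close>. A cutoff equal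
  to 1 near \<open>s\<close> makes its support compact without changing them.\<close>

lemma ex_jet:
  assumes "p < s" "s < q"
  shows "\<exists>\<theta>\<in>Cc p q. \<forall>i\<le>c. (deriv ^^ i) \<theta> s = x i"
proof -
  obtain \<zeta> where \<zeta>: "\<zeta> \<in> Cc (-4) 4" "\<And>x. \<bar>x\<bar> < 1 \<Longrightarrow> \<zeta> x = 1" using ex_plateau by blast
  define e where "e = min (s - p) (q - s) / 4"
  have e: "0 < e" "p \<le> s + e * (-4)" "s + e * 4 \<le> q" using assms by (auto simp: e_def)
  define P where "P y = (\<Sum>j\<le>c. x j * ((y - s) ^ j / fact j))" for y
  have P: "smooth P" "(deriv ^^ i) P s = x i" if "i \<le> c" for i
  proof -
    show "smooth P" unfolding P_def by (rule smooth_sum) (rule smooth_mono_deriv)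
    have "(deriv ^^ i) P s = (\<Sum>j\<le>c. x j * (if i = j then 1 else 0))"
      unfolding P_def by (subst smooth_sum(2)) (auto simp: smooth_mono_deriv)
    also have "\<dots> = x i" using that by (simp add: if_distrib sum.delta cong: if_cong)
    finally show "(deriv ^^ i) P s = x i" .
  qed
  let ?t = "\<lambda>y. P y * \<zeta> ((y - s) / e)"
  have "?t \<in> Cc p q"
    by (rule Cc_mult[OF P(1)[of 0]]) (auto intro: Cc_mono[OF Cc_scale[OF \<zeta>(1) e(1)]] e)
  moreover have "(deriv ^^ i) ?t s = x i" if "i \<le> c" for i
  proof -
    have "\<forall>\<^sub>F y in nhds s. y \<in> {s - e<..<s + e}" by (rule eventually_nhds_in_open) (use e in auto)
    then have "\<forall>\<^sub>F y in nhds s. ?t y = P y"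
      by eventually_elim (use e in \<open>auto simp: \<zeta>(2) abs_less_iff field_simps\<close>)
    then have "(deriv ^^ i) ?t s = (deriv ^^ i) P s" by (rule higher_deriv_cong_ev) simp
    then show ?thesis using P that by simp
  qed
  ultimately show ?thesis by blast
qed

section \<open>High-frequency perturbations\<close>

text \<open>A set of orders rather than a list: each order in \<open>A\<close> occurs once as a
  factor, so changing the sign of one derivative changes the sign of the product. One and two
  elements give the cubic and the quartic integrands.\<close>

definition mon :: "nat set \<Rightarrow> nat \<Rightarrow> (real \<Rightarrow> real) \<Rightarrow> real \<Rightarrow> real" where
  "mon A c f s = (\<Prod>i\<in>A. (deriv ^^ i) f s) * ((deriv ^^ c) f s)\<^sup>2"

definition mon_int :: "(real \<Rightarrow> real) \<Rightarrow> nat set \<Rightarrow> nat \<Rightarrow> (real \<Rightarrow> real) \<Rightarrow> real" where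
  "mon_int w A c f = integral UNIV (\<lambda>s. w s * mon A c f s)"

lemma continuous_on_mon: "smooth f \<Longrightarrow> continuous_on S (mon A c f)"
  unfolding mon_def by (intro continuous_intros smooth_continuous_on)

lemma continuous_on_weighted_mon: "smooth w \<Longrightarrow> smooth f \<Longrightarrow> continuous_on S (\<lambda>s. w s * mon A c f s)"
  by (intro continuous_intros continuous_on_mon smooth_continuous_on0)

lemma mon_zero: "f \<in> Cc p q \<Longrightarrow> x \<le> p \<or> q \<le> x \<Longrightarrow> mon A c f x = 0"
  by (simp add: mon_def Cc_zero)

lemma integral_UNIV_Icc:
  fixes f :: "real \<Rightarrow> real"
  assumes "continuous_on {a..b} f" "\<And>x. x \<notin> {a..b} \<Longrightarrow> f x = 0"
  shows "(f has_integral integral {a..b} f) UNIV" "integral UNIV f = integral {a..b} f"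
proof -
  have "(f has_integral integral {a..b} f) {a..b}"
    by (intro integrable_integral integrable_continuous_real assms)
  then show "(f has_integral integral {a..b} f) UNIV"
    by (rule has_integral_on_superset) (use assms in auto)
  then show "integral UNIV f = integral {a..b} f" by (rule integral_unique)
qed

lemma mon_int_Icc:
  assumes "smooth w" "f \<in> Cc p q" "a \<le> p" "q \<le> b"
  shows "mon_int w A c f = integral {a..b} (\<lambda>s. w s * mon A c f s)"
  unfolding mon_int_def
  by (rule integral_UNIV_Icc(2))
    (use assms in \<open>auto intro!: continuous_on_weighted_mon Cc_smooth_fun mon_zero\<close>)

text \<open>Convergence as \<mu> tends to 0, at linear rate and uniformly over the rescaled window
  of the bump. Boundedness of the limit is included so that products stay in the class.\<close>

definition appr :: "(real \<Rightarrow> real \<Rightarrow> real) \<Rightarrow> (real \<Rightarrow> real) \<Rightarrow> bool" where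
  "appr f l \<longleftrightarrow> (\<exists>K\<ge>0. \<forall>\<mu>\<in>{0<..1}. \<forall>y\<in>{-2..2}. \<bar>f \<mu> y - l y\<bar> \<le> K * \<mu>) \<and> (\<exists>M\<ge>0. \<forall>y\<in>{-2..2}. \<bar>l y\<bar> \<le> M)"

lemma apprI:
  assumes "0 \<le> K" "0 \<le> M" "\<And>\<mu> y. 0 < \<mu> \<Longrightarrow> \<mu> \<le> 1 \<Longrightarrow> -2 \<le> y \<Longrightarrow> y \<le> 2 \<Longrightarrow> \<bar>f \<mu> y - l y\<bar> \<le> K * \<mu>"
    "\<And>y. -2 \<le> y \<Longrightarrow> y \<le> 2 \<Longrightarrow> \<bar>l y\<bar> \<le> M"
  shows "appr f l"
  unfolding appr_def using assms by (intro conjI exI[of _ K] exI[of _ M]) auto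

lemma apprE:
  assumes "appr f l"
  obtains K M where "0 \<le> K" "0 \<le> M"
    "\<And>\<mu> y. 0 < \<mu> \<Longrightarrow> \<mu> \<le> 1 \<Longrightarrow> -2 \<le> y \<Longrightarrow> y \<le> 2 \<Longrightarrow> \<bar>f \<mu> y - l y\<bar> \<le> K * \<mu>"
    "\<And>y. -2 \<le> y \<Longrightarrow> y \<le> 2 \<Longrightarrow> \<bar>l y\<bar> \<le> M"
    "\<And>\<mu> y. 0 < \<mu> \<Longrightarrow> \<mu> \<le> 1 \<Longrightarrow> -2 \<le> y \<Longrightarrow> y \<le> 2 \<Longrightarrow> \<bar>f \<mu> y\<bar> \<le> K + M"
proof -
  obtain K M where K: "0 \<le> K" "0 \<le> M"
    "\<And>\<mu> y. 0 < \<mu> \<Longrightarrow> \<mu> \<le> 1 \<Longrightarrow> -2 \<le> y \<Longrightarrow> y \<le> 2 \<Longrightarrow> \<bar>f \<mu> y - l y\<bar> \<le> K * \<mu>"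
    "\<And>y. -2 \<le> y \<Longrightarrow> y \<le> 2 \<Longrightarrow> \<bar>l y\<bar> \<le> M"
    using assms unfolding appr_def by (metis atLeastAtMost_iff greaterThanAtMost_iff)
  have "\<bar>f \<mu> y\<bar> \<le> K + M" if "0 < \<mu>" "\<mu> \<le> 1" "-2 \<le> y" "y \<le> 2" for \<mu> y
  proof -
    have "K * \<mu> \<le> K" using K(1) that by (simp add: mult_left_le)
    then show ?thesis using K(3,4)[of y] K(3)[OF that] that by linarith
  qed
  with K that show thesis by blast
qed

lemma appr_mult:
  assumes "appr f l" "appr g m"
  shows "appr (\<lambda>\<mu> y. f \<mu> y * g \<mu> y) (\<lambda>y. l y * m y)"
proof -
  obtain K M where f: "0 \<le> K" "0 \<le> M"
    "\<And>\<mu> y. 0 < \<mu> \<Longrightarrow> \<mu> \<le> 1 \<Longrightarrow> -2 \<le> y \<Longrightarrow> y \<le> 2 \<Longrightarrow> \<bar>f \<mu> y - l y\<bar> \<le> K * \<mu>"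
    "\<And>y. -2 \<le> y \<Longrightarrow> y \<le> 2 \<Longrightarrow> \<bar>l y\<bar> \<le> M"
    "\<And>\<mu> y. 0 < \<mu> \<Longrightarrow> \<mu> \<le> 1 \<Longrightarrow> -2 \<le> y \<Longrightarrow> y \<le> 2 \<Longrightarrow> \<bar>f \<mu> y\<bar> \<le> K + M"
    by (rule apprE[OF assms(1)]) (rule that; assumption)
  obtain K' M' where g: "0 \<le> K'" "0 \<le> M'"
    "\<And>\<mu> y. 0 < \<mu> \<Longrightarrow> \<mu> \<le> 1 \<Longrightarrow> -2 \<le> y \<Longrightarrow> y \<le> 2 \<Longrightarrow> \<bar>g \<mu> y - m y\<bar> \<le> K' * \<mu>"
    "\<And>y. -2 \<le> y \<Longrightarrow> y \<le> 2 \<Longrightarrow> \<bar>m y\<bar> \<le> M'"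
    "\<And>\<mu> y. 0 < \<mu> \<Longrightarrow> \<mu> \<le> 1 \<Longrightarrow> -2 \<le> y \<Longrightarrow> y \<le> 2 \<Longrightarrow> \<bar>g \<mu> y\<bar> \<le> K' + M'"
    by (rule apprE[OF assms(2)]) (rule that; assumption)
  show ?thesis
  proof (rule apprI[of "K * (K' + M') + M * K'" "M * M'"])
    fix \<mu> y :: real assume y: "0 < \<mu>" "\<mu> \<le> 1" "-2 \<le> y" "y \<le> 2"
    have "f \<mu> y * g \<mu> y - l y * m y = (f \<mu> y - l y) * g \<mu> y + l y * (g \<mu> y - m y)"
      by (simp add: algebra_simps)
    also have "\<bar>\<dots>\<bar> \<le> \<bar>f \<mu> y - l y\<bar> * \<bar>g \<mu> y\<bar> + \<bar>l y\<bar> * \<bar>g \<mu> y - m y\<bar>"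
      by (metis abs_mult abs_triangle_ineq)
    also have "\<dots> \<le> (K * \<mu>) * (K' + M') + M * (K' * \<mu>)"
      using f g y by (intro add_mono mult_mono) auto
    finally show "\<bar>f \<mu> y * g \<mu> y - l y * m y\<bar> \<le> (K * (K' + M') + M * K') * \<mu>"
      by (simp add: algebra_simps)
  next
    fix y :: real assume y: "-2 \<le> y" "y \<le> 2"
    then show "\<bar>l y * m y\<bar> \<le> M * M'"
      unfolding abs_mult using f g by (intro mult_mono) auto
  qed (use f g in auto)
qed

lemma appr_add:
  assumes "appr f l" "appr g m"
  shows "appr (\<lambda>\<mu> y. f \<mu> y + g \<mu> y) (\<lambda>y. l y + m y)"
proof -
  obtain K M where f: "0 \<le> K" "0 \<le> M"
    "\<And>\<mu> y. 0 < \<mu> \<Longrightarrow> \<mu> \<le> 1 \<Longrightarrow> -2 \<le> y \<Longrightarrow> y \<le> 2 \<Longrightarrow> \<bar>f \<mu> y - l y\<bar> \<le> K * \<mu>"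
    "\<And>y. -2 \<le> y \<Longrightarrow> y \<le> 2 \<Longrightarrow> \<bar>l y\<bar> \<le> M"
    by (rule apprE[OF assms(1)]) (rule that; assumption)
  obtain K' M' where g: "0 \<le> K'" "0 \<le> M'"
    "\<And>\<mu> y. 0 < \<mu> \<Longrightarrow> \<mu> \<le> 1 \<Longrightarrow> -2 \<le> y \<Longrightarrow> y \<le> 2 \<Longrightarrow> \<bar>g \<mu> y - m y\<bar> \<le> K' * \<mu>"
    "\<And>y. -2 \<le> y \<Longrightarrow> y \<le> 2 \<Longrightarrow> \<bar>m y\<bar> \<le> M'"
    by (rule apprE[OF assms(2)]) (rule that; assumption)
  show ?thesis
  proof (rule apprI[of "K + K'" "M + M'"])
    fix \<mu> y :: real assume y: "0 < \<mu>" "\<mu> \<le> 1" "-2 \<le> y" "y \<le> 2"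
    show "\<bar>f \<mu> y + g \<mu> y - (l y + m y)\<bar> \<le> (K + K') * \<mu>"
      using f(3)[OF y] g(3)[OF y] by (simp only: distrib_right)
  next
    fix y :: real assume y: "-2 \<le> y" "y \<le> 2"
    show "\<bar>l y + m y\<bar> \<le> M + M'" using f(4)[OF y] g(4)[OF y] by linarith
  qed (use f g in auto)
qed

lemma continuous_bounded_Icc:
  assumes "continuous_on {-2..2} l"
  obtains M where "0 \<le> M" "\<And>y. -2 \<le> y \<Longrightarrow> y \<le> (2::real) \<Longrightarrow> \<bar>l y :: real\<bar> \<le> M"
proof -
  have "compact (l ` {-2..2})" by (intro compact_continuous_image assms) auto
  then obtain M where "\<forall>x\<in>l ` {-2..2}. norm x \<le> M"
    using compact_imp_bounded bounded_iff by metis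
  then have "\<bar>l y\<bar> \<le> \<bar>M\<bar>" if "-2 \<le> y" "y \<le> 2" for y
    using that by (intro order_trans[OF _ abs_ge_self]) simp
  then show thesis by (rule that[rotated]) auto
qed

lemma appr_const:
  assumes "continuous_on {-2..2} l"
  shows "appr (\<lambda>_. l) l"
  by (rule continuous_bounded_Icc[OF assms]) (rule apprI[of 0], auto)

lemma appr_small:
  assumes "\<And>\<mu>. 0 < \<mu> \<Longrightarrow> \<mu> \<le> 1 \<Longrightarrow> \<bar>r \<mu>\<bar> \<le> \<mu>"
  shows "appr (\<lambda>\<mu> _. r \<mu>) (\<lambda>_. 0)"
  by (rule apprI[of 1 0]) (use assms in auto)

lemma appr_prod:
  assumes "finite A" "\<And>i. i \<in> A \<Longrightarrow> appr (f i) (l i)"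
  shows "appr (\<lambda>\<mu> y. \<Prod>i\<in>A. f i \<mu> y) (\<lambda>y. \<Prod>i\<in>A. l i y)"
  using assms by (induction A) (simp_all add: appr_const appr_mult)

lemma appr_integral:
  assumes "appr f l" "continuous_on {-2..2} l" "\<And>\<mu>. 0 < \<mu> \<Longrightarrow> continuous_on {-2..2} (f \<mu>)"
  shows "((\<lambda>\<mu>. integral {-2..2} (f \<mu>)) \<longlongrightarrow> integral {-2..2} l) (at_right 0)"
proof -
  obtain K where K: "0 \<le> K"
    "\<And>\<mu> y. 0 < \<mu> \<Longrightarrow> \<mu> \<le> 1 \<Longrightarrow> -2 \<le> y \<Longrightarrow> y \<le> 2 \<Longrightarrow> \<bar>f \<mu> y - l y\<bar> \<le> K * \<mu>"
    by (rule apprE[OF assms(1)]) (rule that; assumption)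
  have "norm (integral {-2..2} (f \<mu>) - integral {-2..2} l) \<le> 4 * K * \<mu>" if "0 < \<mu>" "\<mu> < 1" for \<mu>
  proof -
    have i: "f \<mu> integrable_on {-2..2}" "l integrable_on {-2..2}"
      by (intro integrable_continuous_real assms that)+
    have "norm (integral {-2..2} (\<lambda>y. f \<mu> y - l y)) \<le> integral {-2..2} (\<lambda>y::real. K * \<mu>)"
      using that by (intro integral_norm_bound_integral integrable_diff i integrable_const_ivl) (auto intro!: K)
    then show ?thesis using i by (simp add: Henstock_Kurzweil_Integration.integral_diff)
  qed
  then have "\<forall>\<^sub>F \<mu> in at_right 0. norm (integral {-2..2} (f \<mu>) - integral {-2..2} l) \<le> 4 * K * \<mu>"
    unfolding eventually_at_right_field by (intro exI[of _ 1]) auto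
  moreover have "((\<lambda>\<mu>. 4 * K * \<mu>) \<longlongrightarrow> 4 * K * 0) (at_right 0)"
    by (intro tendsto_intros)
  then have "((\<lambda>\<mu>. 4 * K * \<mu>) \<longlongrightarrow> 0) (at_right 0)" by simp
  ultimately have "((\<lambda>\<mu>. integral {-2..2} (f \<mu>) - integral {-2..2} l) \<longlongrightarrow> 0) (at_right 0)"
    by (rule Lim_null_comparison)
  then show ?thesis by (rule LIM_zero_cancel)
qed

text \<open>Measures the failure of evenness in \<open>y\<close> against \<open>\<mu>\<^sup>3\<close>, the reciprocal of the amplitude of the oscillation.\<close>

definition osc :: "(real \<Rightarrow> real \<Rightarrow> real) \<Rightarrow> bool" where
  "osc f \<longleftrightarrow> appr (\<lambda>\<mu> y. (f \<mu> y - f \<mu> (- y)) / \<mu> ^ 3) (\<lambda>_. 0)"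

lemma appr_uminus: "appr f l \<Longrightarrow> appr (\<lambda>\<mu> y. f \<mu> (- y)) (\<lambda>y. l (- y))"
  unfolding appr_def by (metis (no_types, lifting) atLeastAtMost_iff minus_le_iff neg_le_iff_le)

text \<open>Replacing \<open>y\<close> by \<open>-y\<close> in one factor at a time writes the
  asymmetry of the product as asymmetry of one factor times the other, bounded factor.\<close>

lemma osc_mult:
  assumes "osc f" "osc g" "appr f l" "appr g m"
  shows "osc (\<lambda>\<mu> y. f \<mu> y * g \<mu> y)"
proof -
  have "appr (\<lambda>\<mu> y. (f \<mu> y - f \<mu> (- y)) / \<mu> ^ 3 * g \<mu> y + f \<mu> (- y) * ((g \<mu> y - g \<mu> (- y)) / \<mu> ^ 3))
     (\<lambda>y. 0 * m y + l (- y) * 0)"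
    using assms unfolding osc_def by (intro appr_add appr_mult appr_uminus)
  moreover have "(\<lambda>\<mu> y. (f \<mu> y - f \<mu> (- y)) / \<mu> ^ 3 * g \<mu> y + f \<mu> (- y) * ((g \<mu> y - g \<mu> (- y)) / \<mu> ^ 3)) =
    (\<lambda>\<mu> y. (f \<mu> y * g \<mu> y - f \<mu> (- y) * g \<mu> (- y)) / \<mu> ^ 3)"
    by (simp add: fun_eq_iff algebra_simps diff_divide_distrib)
  ultimately show ?thesis by (simp add: osc_def)
qed

lemma osc_add:
  assumes "osc f" "osc g"
  shows "osc (\<lambda>\<mu> y. f \<mu> y + g \<mu> y)"
  using appr_add[OF assms[unfolded osc_def]]
  by (simp add: osc_def algebra_simps diff_divide_distrib add_divide_distrib)

lemma osc_prod:
  assumes "finite A" "\<And>i. i \<in> A \<Longrightarrow> appr (f i) (l i)" "\<And>i. i \<in> A \<Longrightarrow> osc (f i)"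
  shows "osc (\<lambda>\<mu> y. \<Prod>i\<in>A. f i \<mu> y)"
  using assms
proof (induction A)
  case empty
  then show ?case by (simp add: osc_def appr_const)
next
  case (insert i A)
  then show ?case
    by (simp add: osc_mult[where l = "l i" and m = "\<lambda>y. \<Prod>i\<in>A. l i y"] appr_prod)
qed

text \<open>Over a window of width proportional to \<mu>^4 a Lipschitz function varies by
  O(\<mu>^4), that is by \<mu>^3 times O(\<mu>). The asymmetry thus stays negligible after division
  by \<mu>^3.\<close>

lemma appr_smooth:
  assumes "smooth \<phi>"
  shows "appr (\<lambda>\<mu> y. \<phi> (s + \<mu> ^ 4 * y)) (\<lambda>_. \<phi> s)" "osc (\<lambda>\<mu> y. \<phi> (s + \<mu> ^ 4 * y))"
proof -
  obtain L where L: "\<And>x y. x \<in> {s-2..s+2} \<Longrightarrow> y \<in> {s-2..s+2} \<Longrightarrow> \<bar>\<phi> x - \<phi> y\<bar> \<le> L * \<bar>x - y\<bar>"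
    using smooth_lipschitz[OF assms] by metis
  have L': "\<bar>\<phi> x - \<phi> y\<bar> \<le> \<bar>L\<bar> * \<bar>x - y\<bar>" if "x \<in> {s-2..s+2}" "y \<in> {s-2..s+2}" for x y
    using L[OF that] by (rule order_trans) (intro mult_right_mono, auto)
  have small: "\<bar>\<mu> ^ 4 * y\<bar> \<le> 2 * \<mu> ^ 4" "\<mu> ^ 4 \<le> \<mu>" "\<mu> ^ 4 \<le> 1" "\<mu> ^ 4 = \<mu> ^ 3 * \<mu>" 
    if "0 < \<mu>" "\<mu> \<le> 1" "-2 \<le> y" "y \<le> 2" for \<mu> y :: real
  proof -
    show "\<bar>\<mu> ^ 4 * y\<bar> \<le> 2 * \<mu> ^ 4" using that by (simp add: abs_mult)
    show "\<mu> ^ 4 \<le> \<mu>" using power_decreasing[of 1 4 \<mu>] that by simp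
    then show "\<mu> ^ 4 \<le> 1" using that by simp
  qed (simp add: power_numeral_reduce)
  show "appr (\<lambda>\<mu> y. \<phi> (s + \<mu> ^ 4 * y)) (\<lambda>_. \<phi> s)"
  proof (rule apprI[of "2 * \<bar>L\<bar>" "\<bar>\<phi> s\<bar>"])
    fix \<mu> y :: real assume y: "0 < \<mu>" "\<mu> \<le> 1" "-2 \<le> y" "y \<le> 2"
    have "\<bar>\<phi> (s + \<mu> ^ 4 * y) - \<phi> s\<bar> \<le> \<bar>L\<bar> * \<bar>\<mu> ^ 4 * y\<bar>"
      using L'[of "s + \<mu> ^ 4 * y" s] small[OF y] by (simp add: abs_le_iff)
    also have "\<dots> \<le> \<bar>L\<bar> * (2 * \<mu>)" using small[OF y] by (intro mult_left_mono) auto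
    finally show "\<bar>\<phi> (s + \<mu> ^ 4 * y) - \<phi> s\<bar> \<le> 2 * \<bar>L\<bar> * \<mu>" by simp
  qed auto
  show "osc (\<lambda>\<mu> y. \<phi> (s + \<mu> ^ 4 * y))"
    unfolding osc_def
  proof (rule apprI[of "4 * \<bar>L\<bar>" 0])
    fix \<mu> y :: real assume y: "0 < \<mu>" "\<mu> \<le> 1" "-2 \<le> y" "y \<le> 2"
    have "\<bar>\<phi> (s + \<mu> ^ 4 * y) - \<phi> (s + \<mu> ^ 4 * - y)\<bar> \<le> \<bar>L\<bar> * (2 * \<bar>\<mu> ^ 4 * y\<bar>)"
    proof -
      have "\<bar>s + \<mu> ^ 4 * y - (s + \<mu> ^ 4 * - y)\<bar> = 2 * \<bar>\<mu> ^ 4 * y\<bar>" by (simp add: abs_mult)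
      moreover have "s + \<mu> ^ 4 * y \<in> {s-2..s+2}" "s + \<mu> ^ 4 * - y \<in> {s-2..s+2}"
        using small(1,3)[OF y] by (auto simp: abs_le_iff)
      ultimately show ?thesis using L' by metis
    qed
    also have "\<dots> \<le> \<bar>L\<bar> * (2 * (2 * (\<mu> ^ 3 * \<mu>)))" using small[OF y] by (intro mult_left_mono) auto
    finally have "\<bar>\<phi> (s + \<mu> ^ 4 * y) - \<phi> (s + \<mu> ^ 4 * - y)\<bar> / \<mu> ^ 3 \<le> 4 * \<bar>L\<bar> * \<mu>"
      using y by (simp add: divide_le_eq algebra_simps)
    then show "\<bar>(\<phi> (s + \<mu> ^ 4 * y) - \<phi> (s + \<mu> ^ 4 * - y)) / \<mu> ^ 3 - 0\<bar> \<le> 4 * \<bar>L\<bar> * \<mu>"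
      using y by (simp add: abs_divide)
  qed auto
qed

text \<open>The substitution of \<open>-y\<close> for \<open>y\<close> shows that the even part of
  \<open>g\<close> integrates to 0 against an odd function.\<close>

lemma integral_odd_part:
  fixes g b :: "real \<Rightarrow> real"
  assumes "continuous_on {-2..2} g" "continuous_on {-2..2} b" "\<And>y. b (- y) = - (b y :: real)"
  shows "integral {-2..2} (\<lambda>y. g y * b y) = integral {-2..2} (\<lambda>y. (g y - g (- y)) / 2 * b y)"
proof -
  have c: "continuous_on {-2..2} (\<lambda>y. g (- y))"
    by (rule continuous_on_compose2[OF assms(1)]) (auto intro!: continuous_intros)
  have i: "(\<lambda>y. g y * b y) integrable_on {-2..2}" "(\<lambda>y. g (- y) * b y) integrable_on {-2..2}"
    by (intro integrable_continuous_real continuous_intros assms c)+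
  have "integral {-2..2} (\<lambda>y. g (- y) * b y) = - integral {- 2..2} (\<lambda>y. g (- y) * b (- y))"
    by (simp add: assms(3))
  also have "integral {- 2..2} (\<lambda>y. g (- y) * b (- y)) = integral {-2..2} (\<lambda>y. g y * b y)"
    using Henstock_Kurzweil_Integration.integral_reflect_real[of "2" "-2" "\<lambda>y. g y * b y"] by simp
  finally have *: "integral {-2..2} (\<lambda>y. g (- y) * b y) = - integral {-2..2} (\<lambda>y. g y * b y)" .
  have "integral {-2..2} (\<lambda>y. (g y - g (- y)) / 2 * b y) =
    integral {-2..2} (\<lambda>y. 1 / 2 * (g y * b y - g (- y) * b y))"
    by (rule integral_cong) (simp add: field_simps)
  also have "\<dots> = 1 / 2 * (integral {-2..2} (\<lambda>y. g y * b y) - integral {-2..2} (\<lambda>y. g (- y) * b y))"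
    by (subst integral_mult_right, subst Henstock_Kurzweil_Integration.integral_diff) (use i in auto)
  finally show ?thesis using * by simp
qed

text \<open>The parity makes the \<open>c\<close>-th derivative odd and the preceding one even, which cancels the terms of third
  order in the bump that arise when \<open>c \<in> A\<close>.\<close>

definition osc_bump :: "nat \<Rightarrow> real \<Rightarrow> real" where
  "osc_bump c = (deriv ^^ (if even c then 1 else 0)) bump"

lemma osc_bump_Cc: "osc_bump c \<in> Cc (-2) 2"
  unfolding osc_bump_def by (rule Cc_deriv[OF bump_Cc])

lemma osc_bump_deriv: "(deriv ^^ i) (osc_bump c) = (deriv ^^ (i + (if even c then 1 else 0))) bump"
  unfolding osc_bump_def by (subst funpow_add) simp

lemma osc_bump_parity: "(deriv ^^ i) (osc_bump c) (- y) = (if even (i + c) then -1 else 1) * (deriv ^^ i) (osc_bump c) y"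
  unfolding osc_bump_deriv bump_deriv_even by (cases "even i"; cases "even c"; simp)

lemma osc_bump_cont: "continuous_on S ((deriv ^^ i) (osc_bump c))"
  by (intro smooth_continuous_on Cc_smooth_fun[OF osc_bump_Cc])

text \<open>The bump has width \<open>\<mu>\<^sup>4\<close> and \<open>c\<close>-th derivative of size \<open>\<mu>\<close> to the power \<open>-3\<close>: its derivatives of lower order tend
  to \<open>0\<close> with \<open>\<mu>\<close>, while the integral of the squared \<open>c\<close>-th derivative grows like \<open>\<mu>\<close> to the power \<open>-2\<close>.\<close>

definition pert :: "(real \<Rightarrow> real) \<Rightarrow> real \<Rightarrow> nat \<Rightarrow> real \<Rightarrow> real \<Rightarrow> real" where
  "pert \<theta> s c \<mu> = (\<lambda>x. \<theta> x + \<mu> ^ (4 * c) / \<mu> ^ 3 * osc_bump c ((x - s) / \<mu> ^ 4))"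

lemma pert_Cc:
  assumes "\<theta> \<in> Cc p q" "0 < \<mu>" "p \<le> s - 2 * \<mu> ^ 4" "s + 2 * \<mu> ^ 4 \<le> q"
  shows "pert \<theta> s c \<mu> \<in> Cc p q"
  unfolding pert_def
  by (intro Cc_add Cc_cmult assms Cc_mono[OF Cc_scale[OF osc_bump_Cc]]) (use assms in auto)

lemma pert_deriv:
  assumes "smooth \<theta>" "0 < \<mu>"
  shows "(deriv ^^ i) (pert \<theta> s c \<mu>) =
    (\<lambda>x. (deriv ^^ i) \<theta> x + \<mu> ^ (4 * c) / \<mu> ^ 3 / \<mu> ^ (4 * i) * (deriv ^^ i) (osc_bump c) ((x - s) / \<mu> ^ 4))"
proof -
  have \<mu>: "0 < \<mu> ^ 4" using assms(2) by simp
  have b: "smooth (osc_bump c)" using osc_bump_Cc by (rule Cc_smooth_fun)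
  have b': "smooth (\<lambda>x. osc_bump c ((x - s) / \<mu> ^ 4))"
    using Cc_scale[OF osc_bump_Cc \<mu>] by (rule Cc_smooth_fun)
  show ?thesis
    unfolding pert_def smooth_add(2)[OF assms(1) smooth_cmult(1)[OF b']] smooth_cmult(2)[OF b']
      deriv_scale[OF b \<mu>]
    by (simp add: power_mult)
qed

lemma smooth_pert: "smooth \<theta> \<Longrightarrow> 0 < \<mu> \<Longrightarrow> smooth (pert \<theta> s c \<mu>)"
  unfolding pert_def
  by (intro smooth_add smooth_cmult Cc_smooth_fun[OF Cc_scale[OF osc_bump_Cc]]) auto

lemma appr_deriv:
  assumes "smooth \<theta>"
  shows "appr (\<lambda>\<mu> y. (deriv ^^ i) \<theta> (s + \<mu> ^ 4 * y)) (\<lambda>_. (deriv ^^ i) \<theta> s)"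
    "osc (\<lambda>\<mu> y. (deriv ^^ i) \<theta> (s + \<mu> ^ 4 * y))"
  using appr_smooth[OF smooth_deriv_funpow[OF assms]] by auto

lemma appr_cong_pos:
  assumes "appr f l" "\<And>\<mu> y. 0 < \<mu> \<Longrightarrow> f \<mu> y = g \<mu> y" "\<And>y. l y = m y"
  shows "appr g m"
  using assms(1) unfolding appr_def assms(3)
  by (metis assms(2) greaterThanAtMost_iff)

text \<open>The bump enters the \<open>i\<close>-th derivative with the factor \<mu>^(4(c - i) - 3),
  a positive power of \<mu> for \<open>i < c\<close>; only the slow function survives in the
  limit.\<close>

lemma pert_below:
  assumes "smooth \<theta>" "i < c"
  shows "appr (\<lambda>\<mu> y. (deriv ^^ i) (pert \<theta> s c \<mu>) (s + \<mu> ^ 4 * y)) (\<lambda>_. (deriv ^^ i) \<theta> s)"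
    "osc (\<lambda>\<mu> y. (deriv ^^ i) (pert \<theta> s c \<mu>) (s + \<mu> ^ 4 * y))"
proof -
  obtain k where k: "c = Suc (i + k)" using assms(2) less_imp_Suc_add by blast
  let ?b = "(deriv ^^ i) (osc_bump c)"
  have eq: "(deriv ^^ i) (pert \<theta> s c \<mu>) (s + \<mu> ^ 4 * y) =
    (deriv ^^ i) \<theta> (s + \<mu> ^ 4 * y) + \<mu> ^ (4 * k + 1) * ?b y" if "0 < \<mu>" for \<mu> y
  proof -
    have "\<mu> ^ (4 * c) = \<mu> ^ (4 * k + 1) * \<mu> ^ 3 * \<mu> ^ (4 * i)"
      unfolding power_add[symmetric] by (rule arg_cong[where f = "\<lambda>n. \<mu> ^ n"]) (simp add: k)
    then show ?thesis using that by (simp add: pert_deriv[OF assms(1) that])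
  qed
  have 1: "appr (\<lambda>\<mu> y. \<mu> ^ (4 * k + 1)) (\<lambda>_. 0)"
    by (rule appr_small) (simp add: mult_left_le power_le_one)
  have "appr (\<lambda>\<mu> y. (deriv ^^ i) \<theta> (s + \<mu> ^ 4 * y) + \<mu> ^ (4 * k + 1) * ?b y) (\<lambda>y. (deriv ^^ i) \<theta> s + 0 * ?b y)"
    by (intro appr_add appr_deriv assms appr_mult 1 appr_const osc_bump_cont)
  then show "appr (\<lambda>\<mu> y. (deriv ^^ i) (pert \<theta> s c \<mu>) (s + \<mu> ^ 4 * y)) (\<lambda>_. (deriv ^^ i) \<theta> s)"
    by (rule appr_cong_pos) (simp_all add: eq)
  have "osc (\<lambda>\<mu> y. \<mu> ^ (4 * k + 1) * ?b y)"
  \<comment> \<open>For \<open>i = c - 1\<close> the factor is \<mu>, too large to be divided by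
    \<mu>^3, but this derivative of the bump is even and has no asymmetry. For smaller
    \<open>i\<close> the exponent is at least 5 and size alone suffices.\<close>
  proof (cases k)
    case 0
    then have "?b (- y) = ?b y" for y by (simp add: osc_bump_parity k)
    then show ?thesis by (simp add: osc_def appr_const)
  next
    case (Suc m)
    have 2: "appr (\<lambda>\<mu> y. \<mu> ^ (4 * m + 2)) (\<lambda>_. 0)"
      by (rule appr_small) (simp add: power2_eq_square mult_le_one mult_left_le power_le_one)
    have "appr (\<lambda>\<mu> y. \<mu> ^ (4 * m + 2) * (?b y - ?b (- y))) (\<lambda>y. 0 * (?b y - ?b (- y)))"
      by (intro appr_mult 2 appr_const continuous_on_diff osc_bump_cont
          continuous_on_compose2[OF osc_bump_cont[of UNIV]]) (auto intro!: continuous_intros)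
    then show ?thesis
      unfolding osc_def
    proof (rule appr_cong_pos)
      fix \<mu> y :: real assume "0 < \<mu>"
      moreover have "\<mu> ^ (4 * k + 1) = \<mu> ^ (4 * m + 2) * \<mu> ^ 3"
        unfolding Suc power_add[symmetric] by (rule arg_cong[where f = "\<lambda>n. \<mu> ^ n"]) simp
      ultimately show "\<mu> ^ (4 * m + 2) * (?b y - ?b (- y)) = (\<mu> ^ (4 * k + 1) * ?b y - \<mu> ^ (4 * k + 1) * ?b (- y)) / \<mu> ^ 3"
        by (simp add: field_simps)
    qed simp
  qed
  then have "osc (\<lambda>\<mu> y. (deriv ^^ i) \<theta> (s + \<mu> ^ 4 * y) + \<mu> ^ (4 * k + 1) * ?b y)"
    by (intro osc_add appr_deriv assms)
  then show "osc (\<lambda>\<mu> y. (deriv ^^ i) (pert \<theta> s c \<mu>) (s + \<mu> ^ 4 * y))"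
    unfolding osc_def
  proof (rule appr_cong_pos)
    fix \<mu> y :: real assume "0 < \<mu>"
    from eq[OF this, of y] eq[OF this, of "- y"]
    show "((deriv ^^ i) \<theta> (s + \<mu> ^ 4 * y) + \<mu> ^ (4 * k + 1) * ?b y -
        ((deriv ^^ i) \<theta> (s + \<mu> ^ 4 * - y) + \<mu> ^ (4 * k + 1) * ?b (- y))) / \<mu> ^ 3 =
      ((deriv ^^ i) (pert \<theta> s c \<mu>) (s + \<mu> ^ 4 * y) - (deriv ^^ i) (pert \<theta> s c \<mu>) (s + \<mu> ^ 4 * - y)) / \<mu> ^ 3"
      by simp
  qed simp
qed

lemma pert_top:
  assumes "smooth \<theta>" "0 < \<mu>"
  shows "(deriv ^^ c) (pert \<theta> s c \<mu>) (s + \<mu> ^ 4 * y) =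
    (deriv ^^ c) \<theta> (s + \<mu> ^ 4 * y) + (deriv ^^ c) (osc_bump c) y / \<mu> ^ 3"
  using assms by (simp add: pert_deriv)

text \<open>The factor 3 is the coefficient of \<open>t b\<^sup>2\<close> in \<open>(t + b)\<^sup>3\<close>.\<close>

definition mon_limit :: "nat \<Rightarrow> (real \<Rightarrow> real) \<Rightarrow> nat set \<Rightarrow> nat \<Rightarrow> (real \<Rightarrow> real) \<Rightarrow> real \<Rightarrow> real" where
  "mon_limit c w A' c' \<theta> s = (if c' < c then 0 else
     w s * (\<Prod>i\<in>A'. (deriv ^^ i) \<theta> s) * (if c \<in> A' then 3 else 1) *
       integral {-2..2} (\<lambda>y. ((deriv ^^ c) (osc_bump c) y)\<^sup>2))"

lemma cont_rescaled: "continuous_on UNIV f \<Longrightarrow> continuous_on S (\<lambda>y::real. f (s + \<mu> * y))"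
  by (rule continuous_on_compose2[of UNIV f]) (auto intro!: continuous_intros)

text \<open>\<mu>^6 compensates the square of the amplitude \<mu>^(-3). It kills an integrand built
  from orders below \<open>c\<close> only, and otherwise leaves the terms that are quadratic in the
  bump.\<close>

lemma pert_main_term:
  assumes \<theta>: "smooth \<theta>" and w: "smooth w" and A': "A' \<subseteq> {..c'}" "c' \<le> c"
  shows "((\<lambda>\<mu>. integral {-2..2} (\<lambda>y. \<mu> ^ 6 * (w (s + \<mu> ^ 4 * y) * mon A' c' (pert \<theta> s c \<mu>) (s + \<mu> ^ 4 * y))))
    \<longlongrightarrow> mon_limit c w A' c' \<theta> s) (at_right 0)"
proof -
  let ?\<Psi> = "\<lambda>i \<mu> y. (deriv ^^ i) (pert \<theta> s c \<mu>) (s + \<mu> ^ 4 * y)"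
  let ?w = "\<lambda>\<mu> y. w (s + \<mu> ^ 4 * y)"
  let ?b = "(deriv ^^ c) (osc_bump c)"
  have fin: "finite A'" using A' finite_subset by blast
  have contP: "continuous_on S (?\<Psi> i \<mu>)" if "0 < \<mu>" for \<mu> i S
    by (intro cont_rescaled smooth_continuous_on smooth_pert \<theta> that)
  have contT: "continuous_on S (\<lambda>y. (deriv ^^ i) \<theta> (s + \<mu> ^ 4 * y))" for \<mu> i S
    by (intro cont_rescaled smooth_continuous_on \<theta>)
  have contw: "continuous_on S (?w \<mu>)" for \<mu> S
    by (intro cont_rescaled smooth_continuous_on0 w)
  have small: "appr (\<lambda>\<mu> y. \<mu> ^ Suc n) (\<lambda>_. 0)" for n
    by (rule appr_small) (simp add: mult_left_le power_le_one)
  have full: "appr (\<lambda>\<mu> y. ?w \<mu> y * (\<Prod>i\<in>B. ?\<Psi> i \<mu> y)) (\<lambda>_. w s * (\<Prod>i\<in>B. (deriv ^^ i) \<theta> s))"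
    "osc (\<lambda>\<mu> y. ?w \<mu> y * (\<Prod>i\<in>B. ?\<Psi> i \<mu> y))" if "B \<subseteq> {..<c}" for B
  proof -
    have B: "finite B" "\<And>i. i \<in> B \<Longrightarrow> i < c" using that finite_subset by blast+
    note P = appr_prod[where l = "\<lambda>i _. (deriv ^^ i) \<theta> s", OF B(1) pert_below(1)[OF \<theta> B(2)]]
      osc_prod[where l = "\<lambda>i _. (deriv ^^ i) \<theta> s", OF B(1) pert_below[OF \<theta> B(2)]]
    show "appr (\<lambda>\<mu> y. ?w \<mu> y * (\<Prod>i\<in>B. ?\<Psi> i \<mu> y)) (\<lambda>_. w s * (\<Prod>i\<in>B. (deriv ^^ i) \<theta> s))"
      by (intro appr_mult appr_smooth w P)
    show "osc (\<lambda>\<mu> y. ?w \<mu> y * (\<Prod>i\<in>B. ?\<Psi> i \<mu> y))"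
      by (rule osc_mult[OF appr_smooth(2)[OF w] P(2) appr_smooth(1)[OF w] P(1)])
  qed
  have cont: "continuous_on {-2..2} (\<lambda>y. \<mu> ^ 6 * (?w \<mu> y * mon A' c' (pert \<theta> s c \<mu>) (s + \<mu> ^ 4 * y)))" if "0 < \<mu>" for \<mu>
    unfolding mon_def by (intro continuous_intros contP contw that)
  consider "c' < c" | "c' = c" "c \<notin> A'" | "c' = c" "c \<in> A'" using A' by linarith
  then show ?thesis
  proof cases
    case 1
    then have sub: "A' \<subseteq> {..<c}" using A' by auto
    have "appr (\<lambda>\<mu> y. \<mu> ^ Suc 5 * (?w \<mu> y * (\<Prod>i\<in>A'. ?\<Psi> i \<mu> y) * (?\<Psi> c' \<mu> y * ?\<Psi> c' \<mu> y)))
      (\<lambda>_. 0 * (w s * (\<Prod>i\<in>A'. (deriv ^^ i) \<theta> s) * ((deriv ^^ c') \<theta> s * (deriv ^^ c') \<theta> s)))"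
      by (intro appr_mult small full[OF sub] pert_below 1 \<theta>)
    then have "appr (\<lambda>\<mu> y. \<mu> ^ 6 * (?w \<mu> y * mon A' c' (pert \<theta> s c \<mu>) (s + \<mu> ^ 4 * y))) (\<lambda>_. 0)"
      by (rule appr_cong_pos) (simp_all add: mon_def power2_eq_square)
    from appr_integral[OF this _ cont] 1 show ?thesis by (simp add: mon_limit_def)
  next
    case 2
    then have sub: "A' \<subseteq> {..<c}" using A' by (auto simp: le_less)
    let ?t = "\<lambda>\<mu> y. \<mu> ^ Suc 2 * (deriv ^^ c) \<theta> (s + \<mu> ^ 4 * y) + ?b y"
    have "appr (\<lambda>\<mu> y. ?w \<mu> y * (\<Prod>i\<in>A'. ?\<Psi> i \<mu> y) * (?t \<mu> y * ?t \<mu> y))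
      (\<lambda>y. w s * (\<Prod>i\<in>A'. (deriv ^^ i) \<theta> s) * ((0 * (deriv ^^ c) \<theta> s + ?b y) * (0 * (deriv ^^ c) \<theta> s + ?b y)))"
      by (intro appr_mult appr_add small full[OF sub] appr_deriv appr_const osc_bump_cont \<theta>)
    then have "appr (\<lambda>\<mu> y. \<mu> ^ 6 * (?w \<mu> y * mon A' c' (pert \<theta> s c \<mu>) (s + \<mu> ^ 4 * y)))
      (\<lambda>y. w s * (\<Prod>i\<in>A'. (deriv ^^ i) \<theta> s) * (?b y)\<^sup>2)"
    proof (rule appr_cong_pos)
      fix \<mu> y :: real assume \<mu>: "0 < \<mu>"
      have "?t \<mu> y = \<mu> ^ 3 * ?\<Psi> c \<mu> y"
        using \<mu> by (simp add: pert_top[OF \<theta> \<mu>] distrib_left numeral_3_eq_3)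
      then show "?w \<mu> y * (\<Prod>i\<in>A'. ?\<Psi> i \<mu> y) * (?t \<mu> y * ?t \<mu> y) = 
        \<mu> ^ 6 * (?w \<mu> y * mon A' c' (pert \<theta> s c \<mu>) (s + \<mu> ^ 4 * y))"
        by (simp add: mon_def 2 power2_eq_square power_add[of \<mu> 3 3, simplified])
    qed (simp add: power2_eq_square)
    from appr_integral[OF this _ cont] 2 show ?thesis
      by (simp add: mon_limit_def continuous_intros osc_bump_cont)
  next
    case 3
    define B where "B = A' - {c}"
    have sub: "B \<subseteq> {..<c}" using A' 3 by (auto simp: B_def le_less)
    have A'B: "A' = insert c B" "c \<notin> B" "finite B" using 3 fin by (auto simp: B_def)
    let ?g = "\<lambda>\<mu> y. ?w \<mu> y * (\<Prod>i\<in>B. ?\<Psi> i \<mu> y)"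
    let ?t = "\<lambda>\<mu> y. (deriv ^^ c) \<theta> (s + \<mu> ^ 4 * y)"
    \<comment> \<open>With m = \<mu>^3, expand m^2 (t + b/m)^3 = m^2 t^3 + 3 m t^2 b + 3 t b^2 +
      b^3/m. \<open>?R\<close> collects the three regular terms. The singular one is odd in
      \<open>b\<close>, hence in \<open>y\<close>, so only the odd part of \<open>?g\<close> meets
      it: this is \<open>?O\<close>, which tends to 0 because \<open>?g\<close> satisfies
      \<open>osc\<close>.\<close>
    let ?R = "\<lambda>\<mu> y. ?g \<mu> y * (\<mu> ^ Suc 5 * (?t \<mu> y * (?t \<mu> y * ?t \<mu> y)) +
      (\<mu> ^ Suc 2 * (3 * (?t \<mu> y * (?t \<mu> y * ?b y))) + 3 * (?t \<mu> y * (?b y * ?b y))))"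
    let ?O = "\<lambda>\<mu> y. (?g \<mu> y - ?g \<mu> (- y)) / \<mu> ^ 3 * (1 / 2 * (?b y) ^ 3)"
    let ?T = "(deriv ^^ c) \<theta> s"
    let ?G = "w s * (\<Prod>i\<in>B. (deriv ^^ i) \<theta> s)"
    have odd: "?b (- y) = - ?b y" for y by (simp add: osc_bump_parity)
    have contg: "continuous_on {-2..2} (?g \<mu>)" if "0 < \<mu>" for \<mu>
      by (intro continuous_intros contP contw that)
    have contgm: "continuous_on {-2..2} (\<lambda>y. ?g \<mu> (- y))" if "0 < \<mu>" for \<mu>
      by (rule continuous_on_compose2[OF contg[OF that]]) (auto intro!: continuous_intros)
    have contR: "continuous_on {-2..2} (?R \<mu>)" if "0 < \<mu>" for \<mu>
      by (intro continuous_intros contg contT osc_bump_cont that)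
    have contO: "continuous_on {-2..2} (?O \<mu>)" if "0 < \<mu>" for \<mu>
      by (intro continuous_intros contg contgm osc_bump_cont that) (use that in auto)
    have "appr ?R (\<lambda>y. ?G * (0 * (?T * (?T * ?T)) + (0 * (3 * (?T * (?T * ?b y))) + 3 * (?T * (?b y * ?b y)))))"
      by (intro appr_mult appr_add small full[OF sub] appr_deriv appr_const osc_bump_cont \<theta> continuous_on_const)
    then have R: "appr ?R (\<lambda>y. ?G * (3 * (?T * (?b y * ?b y))))" by simp
    have "appr ?O (\<lambda>y. 0 * (1 / 2 * (?b y) ^ 3))"
      by (intro appr_mult full(2)[OF sub, unfolded osc_def] appr_const continuous_intros osc_bump_cont)
    then have O: "appr ?O (\<lambda>_. 0)" by simp
    have "((\<lambda>\<mu>. integral {-2..2} (?R \<mu>) + integral {-2..2} (?O \<mu>)) \<longlongrightarrow>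
      integral {-2..2} (\<lambda>y. ?G * (3 * (?T * (?b y * ?b y)))) + integral {-2..2} (\<lambda>_::real. 0::real)) (at_right 0)"
      by (intro tendsto_add appr_integral R O contR contO continuous_intros osc_bump_cont)
    also have "integral {-2..2} (\<lambda>y. ?G * (3 * (?T * (?b y * ?b y)))) + integral {-2..2} (\<lambda>_::real. 0::real) =
      mon_limit c w A' c' \<theta> s"
      using 3 A'B by (simp add: mon_limit_def power2_eq_square) 
    finally show ?thesis
    proof (rule Lim_transform_eventually)
      show "\<forall>\<^sub>F \<mu> in at_right 0. integral {-2..2} (?R \<mu>) + integral {-2..2} (?O \<mu>) =
        integral {-2..2} (\<lambda>y. \<mu> ^ 6 * (?w \<mu> y * mon A' c' (pert \<theta> s c \<mu>) (s + \<mu> ^ 4 * y)))"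
        unfolding eventually_at_right_field
      proof (intro exI[of _ 1] conjI allI impI)
        fix \<mu> :: real assume \<mu>: "0 < \<mu>"
        have cb: "continuous_on {-2..2} (\<lambda>y. (?b y) ^ 3 / \<mu> ^ 3)"
          by (intro continuous_intros osc_bump_cont) (use \<mu> in auto)
        have "integral {-2..2} (?O \<mu>) = integral {-2..2} (\<lambda>y. (?g \<mu> y - ?g \<mu> (- y)) / 2 * ((?b y) ^ 3 / \<mu> ^ 3))"
          by (rule integral_cong) simp
        also have "\<dots> = integral {-2..2} (\<lambda>y. ?g \<mu> y * ((?b y) ^ 3 / \<mu> ^ 3))"
          by (rule integral_odd_part[symmetric, OF contg[OF \<mu>] cb]) (simp add: odd)
        finally have "integral {-2..2} (?R \<mu>) + integral {-2..2} (?O \<mu>) =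
          integral {-2..2} (\<lambda>y. ?R \<mu> y + ?g \<mu> y * ((?b y) ^ 3 / \<mu> ^ 3))"
          using \<mu> by (simp only:) (intro Henstock_Kurzweil_Integration.integral_add[symmetric]
             integrable_continuous_real contR continuous_on_mult contg cb)
        also have "\<dots> = integral {-2..2} (\<lambda>y. \<mu> ^ 6 * (?w \<mu> y * mon A' c' (pert \<theta> s c \<mu>) (s + \<mu> ^ 4 * y)))"
        proof (rule integral_cong)
          fix y :: real
          define t where "t = ?t \<mu> y"
          define b where "b = ?b y"
          define m where "m = \<mu> ^ 3"
          have m: "m \<noteq> 0" "\<mu> ^ 6 = m * m" "\<mu> ^ Suc 5 = m * m" "\<mu> ^ Suc 2 = m"
            using \<mu> by (simp_all add: m_def flip: power_add)
          have top: "?\<Psi> c \<mu> y = t + b / m"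
            by (simp add: pert_top[OF \<theta> \<mu>] t_def b_def m_def)
          have "\<mu> ^ 6 * (?w \<mu> y * mon A' c' (pert \<theta> s c \<mu>) (s + \<mu> ^ 4 * y)) = 
            ?g \<mu> y * (m * m * (t + b / m) ^ 3)"
            using A'B 3 by (simp add: mon_def top m power2_eq_square power3_eq_cube)
          also have "m * m * (t + b / m) ^ 3 = (m * m * (t * (t * t)) + (m * (3 * (t * (t * b))) + 3 * (t * (b * b)))) + b ^ 3 / m"
            using m(1) by (simp add: field_simps power3_eq_cube)
          finally show "?R \<mu> y + ?g \<mu> y * ((?b y) ^ 3 / \<mu> ^ 3) =
            \<mu> ^ 6 * (?w \<mu> y * mon A' c' (pert \<theta> s c \<mu>) (s + \<mu> ^ 4 * y))"
            unfolding m t_def[symmetric] b_def[symmetric] m_def[symmetric] by (simp only: distrib_left)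
        qed
        finally show "integral {-2..2} (?R \<mu>) + integral {-2..2} (?O \<mu>) =
          integral {-2..2} (\<lambda>y. \<mu> ^ 6 * (?w \<mu> y * mon A' c' (pert \<theta> s c \<mu>) (s + \<mu> ^ 4 * y)))" .
      qed auto
    qed
  qed
qed

text \<open>Outside the window of the bump the integrands for \<open>pert \<theta> s c \<mu>\<close>
  and for \<theta> coincide; inside, the rescaling has Jacobian \<mu>^4.\<close>

lemma mon_int_pert:
  assumes \<theta>: "\<theta> \<in> Cc p q" and w: "smooth w" and \<mu>: "0 < \<mu>" "p \<le> s - 2 * \<mu> ^ 4" "s + 2 * \<mu> ^ 4 \<le> q"
  shows "mon_int w A' c' (pert \<theta> s c \<mu>) = mon_int w A' c' \<theta> +
    \<mu> ^ 4 * (integral {-2..2} (\<lambda>y. w (s + \<mu> ^ 4 * y) * mon A' c' (pert \<theta> s c \<mu>) (s + \<mu> ^ 4 * y)) -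
      integral {-2..2} (\<lambda>y. w (s + \<mu> ^ 4 * y) * mon A' c' \<theta> (s + \<mu> ^ 4 * y)))"
proof -
  let ?P = "\<lambda>x. w x * mon A' c' (pert \<theta> s c \<mu>) x" and ?Q = "\<lambda>x. w x * mon A' c' \<theta> x"
  have e: "0 < \<mu> ^ 4" using \<mu> by simp
  have \<theta>s: "smooth \<theta>" using \<theta> by (rule Cc_smooth_fun)
  have pert: "pert \<theta> s c \<mu> \<in> Cc p q" using \<theta> \<mu> by (intro pert_Cc)
  have cont: "continuous_on S ?P" "continuous_on S ?Q" for S
    by (intro continuous_on_weighted_mon w smooth_pert \<theta>s \<mu>)+
  have eq: "?P x - ?Q x = 0" if "x \<notin> {s + \<mu> ^ 4 * (-2)..s + \<mu> ^ 4 * 2}" for x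
  proof -
    have "(x - s) / \<mu> ^ 4 \<le> -2 \<or> 2 \<le> (x - s) / \<mu> ^ 4"
      using that e by (auto simp: divide_le_eq le_divide_eq)
    then have "(deriv ^^ i) (osc_bump c) ((x - s) / \<mu> ^ 4) = 0" for i
      using Cc_zero[OF osc_bump_Cc] by blast
    then show ?thesis by (simp add: mon_def pert_deriv[OF \<theta>s \<mu>(1)])
  qed
  have "mon_int w A' c' (pert \<theta> s c \<mu>) - mon_int w A' c' \<theta> = integral UNIV (\<lambda>x. ?P x - ?Q x)"
    unfolding mon_int_def
  proof (rule Henstock_Kurzweil_Integration.integral_diff[symmetric])
    show "?P integrable_on UNIV"
      by (rule has_integral_integrable, rule integral_UNIV_Icc(1)[where a = p and b = q, OF cont(1)])
        (use mon_zero[OF pert] in auto)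
    show "?Q integrable_on UNIV"
      by (rule has_integral_integrable, rule integral_UNIV_Icc(1)[where a = p and b = q, OF cont(2)])
        (use mon_zero[OF \<theta>] in auto)
  qed
  also have "\<dots> = integral {s + \<mu> ^ 4 * (-2)..s + \<mu> ^ 4 * 2} (\<lambda>x. ?P x - ?Q x)"
    by (rule integral_UNIV_Icc(2)[OF _ eq]) (intro continuous_on_diff cont)
  also have "\<dots> = integral {-2..2} (\<lambda>y. \<mu> ^ 4 *\<^sub>R (?P (s + \<mu> ^ 4 * y) - ?Q (s + \<mu> ^ 4 * y)))"
  proof (rule integral_unique[symmetric], rule has_integral_substitution)
    show "(\<lambda>y. s + \<mu> ^ 4 * y) ` {-2..2} \<subseteq> {s + \<mu> ^ 4 * (-2)..s + \<mu> ^ 4 * 2}"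
    proof (intro image_subsetI)
      fix y :: real assume "y \<in> {-2..2}"
      then have "\<mu> ^ 4 * (-2) \<le> \<mu> ^ 4 * y" "\<mu> ^ 4 * y \<le> \<mu> ^ 4 * 2"
        using e by (intro mult_left_mono; simp)+
      then show "s + \<mu> ^ 4 * y \<in> {s + \<mu> ^ 4 * (-2)..s + \<mu> ^ 4 * 2}" by simp
    qed
    show "((\<lambda>y. s + \<mu> ^ 4 * y) has_real_derivative \<mu> ^ 4) (at x within {-2..2})" for x
      by (auto intro!: derivative_eq_intros)
  qed (use e in \<open>auto intro: continuous_on_diff cont\<close>)
  also have "\<dots> = \<mu> ^ 4 * (integral {-2..2} (\<lambda>y. ?P (s + \<mu> ^ 4 * y)) - integral {-2..2} (\<lambda>y. ?Q (s + \<mu> ^ 4 * y)))"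
    unfolding real_scaleR_def integral_mult_right
    by (subst Henstock_Kurzweil_Integration.integral_diff)
      (auto intro!: integrable_continuous_real cont_rescaled[of ?P] cont_rescaled[of ?Q] cont)
  finally show ?thesis by simp
qed

text \<open>The Jacobian \<mu>^4 turns \<mu>^2 into the \<mu>^6 of \<open>pert_main_term\<close>;
  the integral of the slow function alone does not depend on \<mu> and disappears.\<close>

lemma mon_int_pert_limit:
  assumes \<theta>: "\<theta> \<in> Cc p q" and s: "p < s" "s < q" and w: "smooth w" and A': "A' \<subseteq> {..c'}" "c' \<le> c"
  shows "((\<lambda>\<mu>. \<mu> ^ 2 * mon_int w A' c' (pert \<theta> s c \<mu>)) \<longlongrightarrow> mon_limit c w A' c' \<theta> s) (at_right 0)"
proof -
  have \<theta>s: "smooth \<theta>" using \<theta> by (rule Cc_smooth_fun)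
  let ?I = "\<lambda>f \<mu>. integral {-2..2} (\<lambda>y. \<mu> ^ 6 * (w (s + \<mu> ^ 4 * y) * mon A' c' f (s + \<mu> ^ 4 * y)))"
  have fin: "finite A'" using A' finite_subset by blast
  have small: "appr (\<lambda>\<mu> y. \<mu> ^ 6) (\<lambda>_. 0)"
  proof (rule appr_small)
    fix \<mu> :: real assume "0 < \<mu>" "\<mu> \<le> 1"
    then show "\<bar>\<mu> ^ 6\<bar> \<le> \<mu>" using power_decreasing[of 1 6 \<mu>] by simp
  qed
  have "appr (\<lambda>\<mu> y. \<mu> ^ 6 * (w (s + \<mu> ^ 4 * y) * mon A' c' \<theta> (s + \<mu> ^ 4 * y)))
    (\<lambda>_. 0 * (w s * ((\<Prod>i\<in>A'. (deriv ^^ i) \<theta> s) * ((deriv ^^ c') \<theta> s * (deriv ^^ c') \<theta> s))))"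
    unfolding mon_def power2_eq_square
    by (intro appr_mult small appr_smooth w appr_prod fin appr_deriv \<theta>s)
  then have "appr (\<lambda>\<mu> y. \<mu> ^ 6 * (w (s + \<mu> ^ 4 * y) * mon A' c' \<theta> (s + \<mu> ^ 4 * y))) (\<lambda>_. 0)"
    by simp
  then have "((\<lambda>\<mu>. ?I \<theta> \<mu>) \<longlongrightarrow> integral {-2..2} (\<lambda>_::real. 0::real)) (at_right 0)"
    by (rule appr_integral)
      (auto intro!: continuous_on_mult continuous_on_const cont_rescaled continuous_on_mon smooth_continuous_on0[OF w] \<theta>s)
  moreover have "((\<lambda>\<mu>::real. \<mu> ^ 2 * mon_int w A' c' \<theta>) \<longlongrightarrow> 0 ^ 2 * mon_int w A' c' \<theta>) (at_right 0)"
    by (intro tendsto_intros)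
  ultimately have "((\<lambda>\<mu>. \<mu> ^ 2 * mon_int w A' c' \<theta> + ?I (pert \<theta> s c \<mu>) \<mu> - ?I \<theta> \<mu>) \<longlongrightarrow>
    0 ^ 2 * mon_int w A' c' \<theta> + mon_limit c w A' c' \<theta> s - integral {-2..2} (\<lambda>_::real. 0::real)) (at_right 0)"
    by (intro tendsto_diff tendsto_add pert_main_term \<theta>s w A')
  then have "((\<lambda>\<mu>. \<mu> ^ 2 * mon_int w A' c' \<theta> + ?I (pert \<theta> s c \<mu>) \<mu> - ?I \<theta> \<mu>) \<longlongrightarrow> mon_limit c w A' c' \<theta> s) (at_right 0)"
    by simp
  then show ?thesis
  proof (rule Lim_transform_eventually)
    \<comment> \<open>Below 1 one has \<open>\<mu> ^ 4 \<le> \<mu>\<close>, so half the distance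
      from \<open>s\<close> to the endpoints keeps the window of half-width
      \<open>2 * \<mu> ^ 4\<close> inside.\<close>
    define \<mu>0 where "\<mu>0 = min 1 (min (s - p) (q - s) / 2)"
    have \<mu>0: "0 < \<mu>0" using s by (auto simp: \<mu>0_def)
    show "\<forall>\<^sub>F \<mu> in at_right 0. \<mu> ^ 2 * mon_int w A' c' \<theta> + ?I (pert \<theta> s c \<mu>) \<mu> - ?I \<theta> \<mu> = \<mu> ^ 2 * mon_int w A' c' (pert \<theta> s c \<mu>)"
      unfolding eventually_at_right_field
    proof (intro exI[of _ \<mu>0] conjI allI impI \<mu>0)
      fix \<mu> assume \<mu>: "0 < \<mu>" "\<mu> < \<mu>0"
      then have "\<mu> ^ 4 \<le> \<mu>" using power_decreasing[of 1 4 \<mu>] by (simp add: \<mu>0_def)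
      then have "\<mu> ^ 4 \<le> \<mu>0" using \<mu> by simp
      then have "p \<le> s - 2 * \<mu> ^ 4" "s + 2 * \<mu> ^ 4 \<le> q" by (auto simp: \<mu>0_def)
      from mon_int_pert[OF \<theta> w \<mu>(1) this, where A' = A' and c' = c' and c = c] 
      show "\<mu> ^ 2 * mon_int w A' c' \<theta> + ?I (pert \<theta> s c \<mu>) \<mu> - ?I \<theta> \<mu> = \<mu> ^ 2 * mon_int w A' c' (pert \<theta> s c \<mu>)"
        by (simp only: integral_mult_right) (simp add: algebra_simps flip: power_add)
    qed
  qed
qed

text \<open>All claims are read off limits. A competitor is beaten because its order is lower and
  its limit is 0, because it has the same set and a smaller weight at \<open>s\<close>, or because
  its set contains an order at which the jet vanishes. The inequalities between the limits are
  strict and hence hold for small \<mu>.\<close>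

lemma dominant_mon_int:
  fixes E :: "'e set"
  assumes s: "p < s" "s < q" and A: "A \<noteq> {}" "A \<subseteq> {..c}" and \<sigma>: "\<sigma> \<in> {1, -1}" and w: "smooth w" "0 < w s"
    and E: "finite E" and \<eta>: "0 < \<eta>"
    and E': "\<And>e. e \<in> E \<Longrightarrow> smooth (W e)" "\<And>e. e \<in> E \<Longrightarrow> A' e \<subseteq> {..c' e}"
      "\<And>e. e \<in> E \<Longrightarrow> c' e < c \<or> c' e = c \<and> A' e = A \<and> \<bar>W e s\<bar> < \<eta> * w s \<or> c' e = c \<and> \<not> A' e \<subseteq> A"
  shows "\<exists>\<psi>\<in>Cc p q. \<sigma> * mon_int w A c \<psi> > 0 \<and> (\<forall>e\<in>E. \<bar>mon_int (W e) (A' e) (c' e) \<psi>\<bar> \<le> \<eta> * \<bar>mon_int w A c \<psi>\<bar>)"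
proof -
  obtain i0 where i0: "i0 \<in> A" using A by blast
  \<comment> \<open>The zeros outside \<open>A\<close> eliminate every set not contained in
    \<open>A\<close>; the single entry \<sigma> decides the sign of the product over
    \<open>A\<close>.\<close>
  obtain \<theta> where \<theta>: "\<theta> \<in> Cc p q" "\<And>i. i \<le> c \<Longrightarrow> (deriv ^^ i) \<theta> s = (if i = i0 then \<sigma> else if i \<in> A then 1 else 0)"
    using ex_jet[OF s, of c "\<lambda>i. if i = i0 then \<sigma> else if i \<in> A then 1 else 0"] by blast
  have finA: "finite A" using A finite_subset by blast
  have prodA: "(\<Prod>i\<in>A. (deriv ^^ i) \<theta> s) = \<sigma>"
  proof -
    have "(\<Prod>i\<in>A. (deriv ^^ i) \<theta> s) = (\<Prod>i\<in>A. if i = i0 then \<sigma> else 1)"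
      using A(2) by (intro prod.cong) (auto simp: \<theta>(2))
    then show ?thesis using i0 finA by (simp add: prod.delta)
  qed
  define J where "J = integral {-2..2} (\<lambda>y. ((deriv ^^ c) (osc_bump c) y)\<^sup>2)"
  have J: "0 < J" unfolding J_def osc_bump_deriv by (rule bump_deriv_square_pos)
  define \<kappa> :: real where "\<kappa> = (if c \<in> A then 3 else 1)"
  have \<kappa>: "0 < \<kappa>" by (simp add: \<kappa>_def)
  define l where "l = w s * \<kappa> * J"
  have l: "0 < l" using w J \<kappa> by (simp add: l_def)
  have lim: "mon_limit c w A c \<theta> s = \<sigma> * l"
    by (simp add: mon_limit_def prodA l_def \<kappa>_def J_def)
  have lim_e: "\<bar>mon_limit c (W e) (A' e) (c' e) \<theta> s\<bar> < \<eta> * l" "c' e \<le> c" if e: "e \<in> E" for e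
  proof -
    consider "c' e < c" | "c' e = c" "A' e = A" "\<bar>W e s\<bar> < \<eta> * w s" | "c' e = c" "\<not> A' e \<subseteq> A"
      using E'(3)[OF e] by blast
    then show "\<bar>mon_limit c (W e) (A' e) (c' e) \<theta> s\<bar> < \<eta> * l"
    proof cases
      case 1
      then show ?thesis using \<eta> l by (simp add: mon_limit_def)
    next
      case 2
      have "mon_limit c (W e) (A' e) (c' e) \<theta> s = W e s * \<sigma> * \<kappa> * J"
        using 2 by (simp add: mon_limit_def prodA \<kappa>_def J_def)
      moreover have "\<bar>W e s * \<sigma> * \<kappa> * J\<bar> = \<bar>W e s\<bar> * (\<kappa> * J)"
        using \<sigma> \<kappa> J by (auto simp: abs_mult)
      moreover have "\<bar>W e s\<bar> * (\<kappa> * J) < \<eta> * w s * (\<kappa> * J)"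
        using 2 \<kappa> J by (intro mult_strict_right_mono) auto
      ultimately show ?thesis by (simp add: l_def algebra_simps)
    next
      case 3
      then obtain i where "i \<in> A' e" "i \<notin> A" by blast
      then have "(\<Prod>i\<in>A' e. (deriv ^^ i) \<theta> s) = 0"
        using E'(2)[OF e] 3 i0 finite_subset[OF E'(2)[OF e]] 
        by (intro prod_zero bexI[of _ i]) (auto simp: \<theta>(2) subset_iff)
      then show ?thesis using 3 \<eta> l by (simp add: mon_limit_def)
    qed
    show "c' e \<le> c" using E'(3)[OF e] by auto
  qed
  let ?F = "\<lambda>\<mu>. \<sigma> * (\<mu> ^ 2 * mon_int w A c (pert \<theta> s c \<mu>))"
  let ?Fe = "\<lambda>e \<mu>. \<mu> ^ 2 * mon_int (W e) (A' e) (c' e) (pert \<theta> s c \<mu>)"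
  have F: "(?F \<longlongrightarrow> l) (at_right 0)"
  proof -
    have "(?F \<longlongrightarrow> \<sigma> * mon_limit c w A c \<theta> s) (at_right 0)"
      by (intro tendsto_mult_left mon_int_pert_limit[OF \<theta>(1) s] w A order_refl)
    then show ?thesis using \<sigma> by (auto simp: lim)
  qed
  have "\<forall>\<^sub>F \<mu> in at_right 0. 0 < ?F \<mu>"
    by (rule order_tendstoD(1)[OF F l])
  moreover have "\<forall>\<^sub>F \<mu> in at_right 0. \<forall>e\<in>E. 0 < \<eta> * ?F \<mu> - \<bar>?Fe e \<mu>\<bar>"
  proof (rule eventually_ball_finite[OF E], rule ballI)
    fix e assume e: "e \<in> E"
    have "((\<lambda>\<mu>. \<eta> * ?F \<mu> - \<bar>?Fe e \<mu>\<bar>) \<longlongrightarrow> \<eta> * l - \<bar>mon_limit c (W e) (A' e) (c' e) \<theta> s\<bar>) (at_right 0)"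
      by (intro tendsto_diff tendsto_rabs tendsto_mult_left[OF F] mon_int_pert_limit[OF \<theta>(1) s] E' e lim_e)
    then show "\<forall>\<^sub>F \<mu> in at_right 0. 0 < \<eta> * ?F \<mu> - \<bar>?Fe e \<mu>\<bar>"
      by (rule order_tendstoD(1)) (use lim_e[OF e] in simp)
  qed
  moreover define \<mu>0 where "\<mu>0 = min 1 (min (s - p) (q - s) / 2)"
  have \<mu>0: "0 < \<mu>0" using s by (auto simp: \<mu>0_def)
  then have "\<forall>\<^sub>F \<mu> in at_right 0. 0 < \<mu> \<and> \<mu> < \<mu>0"
    unfolding eventually_at_right_field by (intro exI[of _ \<mu>0]) auto
  ultimately have "\<forall>\<^sub>F \<mu> in at_right 0. 0 < ?F \<mu> \<and> (\<forall>e\<in>E. 0 < \<eta> * ?F \<mu> - \<bar>?Fe e \<mu>\<bar>) \<and> (0 < \<mu> \<and> \<mu> < \<mu>0)"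
    by eventually_elim blast
  then obtain \<mu> where \<mu>: "0 < ?F \<mu>" "\<And>e. e \<in> E \<Longrightarrow> \<bar>?Fe e \<mu>\<bar> < \<eta> * ?F \<mu>" "0 < \<mu>" "\<mu> < \<mu>0"
    using eventually_happens'[OF trivial_limit_at_right_real] by force
  have "\<mu> ^ 4 \<le> \<mu>" using \<mu> power_decreasing[of 1 4 \<mu>] by (simp add: \<mu>0_def)
  then have "\<mu> ^ 4 \<le> \<mu>0" using \<mu> by simp
  then have "pert \<theta> s c \<mu> \<in> Cc p q"
    by (intro pert_Cc \<theta> \<mu>) (auto simp: \<mu>0_def)
  moreover have pos: "\<sigma> * mon_int w A c (pert \<theta> s c \<mu>) > 0"
  proof -
    have "?F \<mu> = \<mu> ^ 2 * (\<sigma> * mon_int w A c (pert \<theta> s c \<mu>))" by simp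
    with \<mu>(1) have "0 < \<mu> ^ 2 * (\<sigma> * mon_int w A c (pert \<theta> s c \<mu>))" by (simp only:)
    then show ?thesis by (rule zero_less_mult_pos) (use \<mu>(3) in simp)
  qed
  moreover have "\<bar>mon_int (W e) (A' e) (c' e) (pert \<theta> s c \<mu>)\<bar> \<le> \<eta> * \<bar>mon_int w A c (pert \<theta> s c \<mu>)\<bar>" if "e \<in> E" for e
  proof -
    have "\<mu> ^ 2 * \<bar>mon_int (W e) (A' e) (c' e) (pert \<theta> s c \<mu>)\<bar> < \<mu> ^ 2 * (\<eta> * (\<sigma> * mon_int w A c (pert \<theta> s c \<mu>)))"
      using \<mu>(2)[OF that] by (simp add: abs_mult mult.left_commute)
    moreover have "\<sigma> * mon_int w A c (pert \<theta> s c \<mu>) = \<bar>mon_int w A c (pert \<theta> s c \<mu>)\<bar>"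
      using \<sigma> pos by auto
    ultimately show ?thesis using \<mu>(3) by simp
  qed
  ultimately show ?thesis by blast
qed

section \<open>Sums of bumps with disjoint supports\<close>

text \<open>At most one of the disjoint open intervals contains \<open>s\<close>, and off its own
  interval a function has vanishing derivatives of every order. Products of derivatives therefore
  never mix two pieces.\<close>

lemma disjoint_active:
  fixes p q :: "'n \<Rightarrow> real"
  assumes "\<And>n. n \<in> D \<Longrightarrow> f n \<in> Cc (p n) (q n)"
    and disj: "\<And>n m. n \<in> D \<Longrightarrow> m \<in> D \<Longrightarrow> n \<noteq> m \<Longrightarrow> q n \<le> p m \<or> q m \<le> p n"
  shows "(\<forall>i. \<forall>n\<in>D. (deriv ^^ i) (f n) s = 0) \<or>
    (\<exists>n0\<in>D. \<forall>i. \<forall>n\<in>D. n \<noteq> n0 \<longrightarrow> (deriv ^^ i) (f n) s = 0)"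
proof (cases "\<exists>n0\<in>D. p n0 < s \<and> s < q n0")
  case True
  then obtain n0 where n0: "n0 \<in> D" "p n0 < s" "s < q n0" by blast
  have "(deriv ^^ i) (f n) s = 0" if n: "n \<in> D" "n \<noteq> n0" for i n
  proof -
    have "s \<le> p n \<or> q n \<le> s" using disj[of n n0] n n0 by auto
    then show ?thesis using Cc_zero assms(1) n(1) by blast
  qed
  then show ?thesis using n0(1) by blast
next
  case False
  have "(deriv ^^ i) (f n) s = 0" if n: "n \<in> D" for i n
  proof -
    have "s \<le> p n \<or> q n \<le> s" using False n by force
    then show ?thesis using Cc_zero assms(1) n by blast
  qed
  then show ?thesis by blast
qed

lemma mon_disjoint_sum:
  fixes p q :: "'n \<Rightarrow> real"
  assumes "finite D" "\<And>n. n \<in> D \<Longrightarrow> f n \<in> Cc (p n) (q n)"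
    and "\<And>n m. n \<in> D \<Longrightarrow> m \<in> D \<Longrightarrow> n \<noteq> m \<Longrightarrow> q n \<le> p m \<or> q m \<le> p n"
  shows "mon A c (\<lambda>x. \<Sum>n\<in>D. k n * f n x) s = (\<Sum>n\<in>D. k n ^ (card A + 2) * mon A c (f n) s)"
proof -
  have sm: "\<And>n. n \<in> D \<Longrightarrow> smooth (f n)" using assms(2) Cc_smooth_fun by blast
  have d: "(deriv ^^ i) (\<lambda>x. \<Sum>n\<in>D. k n * f n x) s = (\<Sum>n\<in>D. k n * (deriv ^^ i) (f n) s)" for i
    by (subst smooth_sum(2)[OF sm]) auto
  have "(\<forall>i. \<forall>n\<in>D. (deriv ^^ i) (f n) s = 0) \<or>
    (\<exists>n0\<in>D. \<forall>i. \<forall>n\<in>D. n \<noteq> n0 \<longrightarrow> (deriv ^^ i) (f n) s = 0)"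
    by (rule disjoint_active) (use assms in blast)+
  then show ?thesis
  proof (elim disjE bexE)
    assume "\<forall>i. \<forall>n\<in>D. (deriv ^^ i) (f n) s = 0"
    then show ?thesis by (simp add: mon_def d)
  next
    fix n0 assume active: "n0 \<in> D" "\<forall>i. \<forall>n\<in>D. n \<noteq> n0 \<longrightarrow> (deriv ^^ i) (f n) s = 0"
    have "(\<Sum>n\<in>D. k n * (deriv ^^ i) (f n) s) = k n0 * (deriv ^^ i) (f n0) s" for i
      using active assms(1) by (subst sum.remove[of _ n0]) auto
    moreover have "(\<Sum>n\<in>D. k n ^ (card A + 2) * mon A c (f n) s) = k n0 ^ (card A + 2) * mon A c (f n0) s"
      using active assms(1) by (subst sum.remove[of _ n0]) (auto simp: mon_def)
    ultimately show ?thesis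
      by (simp add: mon_def d prod.distrib power_mult_distrib power_add power2_eq_square)
  qed
qed

lemma weighted_mon_integrable:
  assumes "smooth w" "f \<in> Cc p q"
  shows "(\<lambda>s. w s * mon A c f s) integrable_on UNIV"
  by (rule has_integral_integrable, rule integral_UNIV_Icc(1)[where a = p and b = q])
    (use assms in \<open>auto intro!: continuous_on_weighted_mon Cc_smooth_fun mon_zero\<close>)

lemma mon_int_disjoint_sum:
  fixes p q :: "'n \<Rightarrow> real"
  assumes "finite D" "\<And>n. n \<in> D \<Longrightarrow> f n \<in> Cc (p n) (q n)"
    and "\<And>n m. n \<in> D \<Longrightarrow> m \<in> D \<Longrightarrow> n \<noteq> m \<Longrightarrow> q n \<le> p m \<or> q m \<le> p n"
    and w: "smooth w"
  shows "mon_int w A c (\<lambda>x. \<Sum>n\<in>D. k n * f n x) = (\<Sum>n\<in>D. k n ^ (card A + 2) * mon_int w A c (f n))"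
proof -
  have "mon_int w A c (\<lambda>x. \<Sum>n\<in>D. k n * f n x) =
    integral UNIV (\<lambda>s. \<Sum>n\<in>D. k n ^ (card A + 2) * (w s * mon A c (f n) s))"
    unfolding mon_int_def
    by (rule integral_cong) (simp add: mon_disjoint_sum[OF assms(1-3)] sum_distrib_left mult.left_commute)
  also have "\<dots> = (\<Sum>n\<in>D. integral UNIV (\<lambda>s. k n ^ (card A + 2) * (w s * mon A c (f n) s)))"
    by (rule Henstock_Kurzweil_Integration.integral_sum[OF assms(1)])
      (auto intro!: integrable_on_mult_right weighted_mon_integrable[OF w assms(2)])
  finally show ?thesis by (simp add: mon_int_def)
qed

lemma mon_int_shift:
  assumes "f \<in> Cc p q" "smooth w"
  shows "mon_int w A c (\<lambda>x. f (x - d)) = mon_int (\<lambda>s. w (s + d)) A c f"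
proof -
  have "mon A c (\<lambda>x. f (x - d)) (s + d) = mon A c f s" for s
    by (simp add: mon_def smooth_shift(2)[OF Cc_smooth_fun[OF assms(1)]])
  then have "mon_int (\<lambda>s. w (s + d)) A c f = integral UNIV (\<lambda>s. w (s + d) * mon A c (\<lambda>x. f (x - d)) (s + d))"
    by (simp add: mon_int_def)
  also have "\<dots> = integral {p..q} (\<lambda>s. w (s + d) * mon A c (\<lambda>x. f (x - d)) (s + d))"
  proof (rule integral_UNIV_Icc(2))
    have "continuous_on S (\<lambda>s. w s * mon A c (\<lambda>x. f (x - d)) s)" for S
      by (intro continuous_on_weighted_mon assms Cc_smooth_fun[OF Cc_shift[OF assms(1)]])
    note cont = this
    show "continuous_on {p..q} (\<lambda>s. w (s + d) * mon A c (\<lambda>x. f (x - d)) (s + d))"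
      by (rule continuous_on_compose2[where f = "\<lambda>s. s + d", OF cont[of UNIV]])
        (auto intro!: continuous_intros)
  qed (use mon_zero[OF Cc_shift[OF assms(1)]] in auto)
  also have "\<dots> = integral {p + d..q + d} (\<lambda>s. w s * mon A c (\<lambda>x. f (x - d)) s)"
    using integral_shift_Icc_real[of p q "\<lambda>s. w s * mon A c (\<lambda>x. f (x - d)) s" d]
    by (simp add: o_def add.commute)
  also have "\<dots> = mon_int w A c (\<lambda>x. f (x - d))"
    by (rule mon_int_Icc[symmetric, OF assms(2) Cc_shift[OF assms(1)]]) auto
  finally show ?thesis ..
qed

lemma mon_int_weight_sum:
  assumes "finite D" "f \<in> Cc p q" "\<And>d. d \<in> D \<Longrightarrow> smooth (w d)"
  shows "(\<Sum>d\<in>D. k d * mon_int (w d) A c f) = mon_int (\<lambda>s. \<Sum>d\<in>D. k d * w d s) A c f"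
proof -
  have "mon_int (\<lambda>s. \<Sum>d\<in>D. k d * w d s) A c f = integral UNIV (\<lambda>s. \<Sum>d\<in>D. k d * (w d s * mon A c f s))"
    by (simp add: mon_int_def sum_distrib_right mult.assoc)
  also have "\<dots> = (\<Sum>d\<in>D. integral UNIV (\<lambda>s. k d * (w d s * mon A c f s)))"
    by (rule Henstock_Kurzweil_Integration.integral_sum[OF assms(1)])
      (auto intro!: integrable_on_mult_right weighted_mon_integrable[OF assms(3) assms(2)])
  finally show ?thesis by (simp add: mon_int_def)
qed

text \<open>Prouhet--Thue--Morse signs: alternating copies of a bump annihilate all low-degree moments, hence
  every functional of odd degree, while all copies contribute with the same sign in even degree.\<close>

lemma ex_signs_vanishing_moments:
  "\<exists>H e. 0 < H \<and> (\<forall>d::nat. e d = 1 \<or> e d = - 1) \<and> (\<forall>k<m. (\<Sum>d<H. e d * real d ^ k) = 0)"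
proof (induction m)
  case 0
  show ?case by (intro exI[of _ 1] exI[of _ "\<lambda>_. 1"]) auto
next
  case (Suc m)
  then obtain H and e :: "nat \<Rightarrow> real" where H: "0 < H" "\<And>d. e d = 1 \<or> e d = - 1"
    "\<And>k. k < m \<Longrightarrow> (\<Sum>d<H. e d * real d ^ k) = 0" by blast
  define e' where "e' d = (if d < H then e d else - e (d - H))" for d
  have split: "(\<Sum>d<H + K. f d) = (\<Sum>d<H. f d) + (\<Sum>d<K. f (H + d))" for K and f :: "nat \<Rightarrow> real"
    by (induction K) (simp_all add: add.assoc)
  have "(\<Sum>d<H + H. e' d * real d ^ k) = 0" if "k < Suc m" for k
  proof -
    have "(\<Sum>d<H. e d * real (d + H) ^ k) = (\<Sum>d<H. \<Sum>i\<le>k. e d * (real (k choose i) * real d ^ i * real H ^ (k - i)))"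
      by (simp add: binomial_ring sum_distrib_left)
    also have "\<dots> = (\<Sum>i\<le>k. real (k choose i) * real H ^ (k - i) * (\<Sum>d<H. e d * real d ^ i))"
      by (subst sum.swap) (simp add: sum_distrib_left mult_ac)
    \<comment> \<open>Moments of order below \<open>m\<close> vanish by induction, so at most
      \<open>i = k\<close> contributes: shifting the first block by \<open>H\<close> does not change
      its \<open>k\<close>-th moment, and the negated block cancels it.\<close>
    also have "\<dots> = (\<Sum>i\<in>{k}. real (k choose i) * real H ^ (k - i) * (\<Sum>d<H. e d * real d ^ i))"
      using that by (intro sum.mono_neutral_right) (auto simp: H(3))
    finally have "(\<Sum>d<H. e d * real (d + H) ^ k) = (\<Sum>d<H. e d * real d ^ k)" by simp
    moreover have "(\<Sum>d<H + H. e' d * real d ^ k) = (\<Sum>d<H. e d * real d ^ k) - (\<Sum>d<H. e d * real (d + H) ^ k)"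
      unfolding split by (simp add: e'_def add.commute flip: sum_negf)
    ultimately show ?thesis by simp
  qed
  moreover have "e' d = 1 \<or> e' d = - 1" for d
    using H(2)[of d] H(2)[of "d - H"] by (auto simp: e'_def)
  ultimately show ?case using H(1) by (intro exI[of _ "H + H"] exI[of _ e']) auto
qed

section \<open>Moments of pieces and time slots accumulating at the final time\<close>

definition moment :: "real \<Rightarrow> (real \<Rightarrow> real) \<Rightarrow> nat set \<times> nat \<times> nat \<Rightarrow> real" where
  "moment T f = (\<lambda>(A, c, \<nu>). mon_int (\<lambda>s. (T - s) ^ \<nu>) A c f)"

text \<open>Bracket indices \<open>j\<close>, \<open>k\<close>, \<open>l\<close> become derivative
  orders \<open>N - j\<close>, \<open>N - k\<close>, \<open>N - l\<close>; the condition
  \<open>j \<le> k\<close> turns into \<open>A \<subseteq> {..c}\<close>.\<close>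

definition Idx :: "nat \<Rightarrow> nat \<Rightarrow> (nat set \<times> nat \<times> nat) set" where
  "Idx N r = {(A, c, \<nu>). A \<subseteq> {..c} \<and> card A = r \<and> c \<le> N \<and> \<nu> \<le> N}"

text \<open>Dominance order: small \<open>c\<close> first, then large \<open>\<nu>\<close>; indices that differ only in \<open>A\<close> are tied.\<close>

definition idx_rank :: "nat \<Rightarrow> nat set \<times> nat \<times> nat \<Rightarrow> nat" where
  "idx_rank N = (\<lambda>(A, c, \<nu>). c * Suc N + (N - \<nu>))"

lemma finite_Idx: "finite (Idx N r)"
proof (rule finite_subset)
  show "Idx N r \<subseteq> Pow {..N} \<times> {..N} \<times> {..N}" by (auto simp: Idx_def subset_iff)
qed auto

text \<open>Endpoints of infinitely many disjoint slots accumulating at \<open>T\<close>: far enough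
  in the sequence \<open>T - s\<close> is as small as desired, and higher powers of it are
  negligible against lower ones.\<close>

definition tn :: "real \<Rightarrow> nat \<Rightarrow> real" where
  "tn T n = T - T / real (Suc n)"

lemma tn_props:
  assumes "0 < T"
  shows "tn T 0 = 0" "tn T n < tn T (Suc n)" "tn T n < T" "0 \<le> tn T n"
  using assms by (auto simp: tn_def field_simps)

lemma tn_mono: "0 < T \<Longrightarrow> n \<le> m \<Longrightarrow> tn T n \<le> tn T m"
  by (rule lift_Suc_mono_le) (simp_all add: less_imp_le tn_props)

lemma tn_close:
  assumes "0 < T" "0 < e"
  shows "\<exists>n\<ge>m. T - tn T n < e"
proof -
  obtain k where k: "T / e < real k" using reals_Archimedean2 by blast
  then have "T < e * real (Suc (max k m))"
    using assms by (simp add: field_simps) (smt (verit) max.cobounded1 mult_left_mono of_nat_mono)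
  then show ?thesis using assms
    by (intro exI[of _ "max k m"]) (simp add: tn_def divide_less_eq mult.commute)
qed

lemma smooth_weight: "smooth (\<lambda>s. (T - (s + d)) ^ \<nu>)"
  using smooth_affine(1)[OF smooth_power_diff, where a = 1 and b = d] by simp

lemma smooth_weight_sum: "smooth (\<lambda>s. \<Sum>d\<in>D. k d * (T - (s + \<rho> d)) ^ \<nu>)"
  by (rule smooth_sum) (rule smooth_weight)

text \<open>Translations are transferred to the weight, so the whole packet acts as a single piece
  \<psi> tested against a combined weight. The coefficient \<open>e d\<close> enters with the degree
  of homogeneity as exponent: a sign survives in odd degree and disappears in even degree.\<close>

lemma shifted_copies:
  fixes H :: nat
  assumes "0 < \<rho>" "\<psi> \<in> Cc p (p + \<rho>)" "0 < H"
  shows "(\<lambda>x. \<Sum>d<H. e d * \<psi> (x - \<rho> * real d)) \<in> Cc p (p + \<rho> * real H)"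
    and "moment T (\<lambda>x. \<Sum>d<H. e d * \<psi> (x - \<rho> * real d)) (A, c, \<nu>) =
      mon_int (\<lambda>s. \<Sum>d<H. e d ^ (card A + 2) * (T - (s + \<rho> * real d)) ^ \<nu>) A c \<psi>"
proof -
  note sh = Cc_shift[OF assms(2)]
  show "(\<lambda>x. \<Sum>d<H. e d * \<psi> (x - \<rho> * real d)) \<in> Cc p (p + \<rho> * real H)"
  proof (rule Cc_sum)
    fix d assume "d \<in> {..<H}"
    then have "real d + 1 \<le> real H" by simp
    then have "\<rho> * (real d + 1) \<le> \<rho> * real H" using assms(1) by (intro mult_left_mono) auto
    then show "(\<lambda>x. \<psi> (x - \<rho> * real d)) \<in> Cc p (p + \<rho> * real H)"
      using assms(1) by (intro Cc_mono[OF sh]) (auto simp: distrib_left)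
  qed (use assms in auto)
  have "moment T (\<lambda>x. \<Sum>d<H. e d * \<psi> (x - \<rho> * real d)) (A, c, \<nu>) =
    (\<Sum>d<H. e d ^ (card A + 2) * mon_int (\<lambda>s. (T - s) ^ \<nu>) A c (\<lambda>x. \<psi> (x - \<rho> * real d)))"
    unfolding moment_def prod.case
  proof (rule mon_int_disjoint_sum[OF _ sh])
    fix n m :: nat assume "n \<noteq> m"
    then have "real n + 1 \<le> real m \<or> real m + 1 \<le> real n" by linarith
    then have "\<rho> * (real n + 1) \<le> \<rho> * real m \<or> \<rho> * (real m + 1) \<le> \<rho> * real n"
      using assms(1) by (auto intro: mult_left_mono)
    then show "p + \<rho> + \<rho> * real n \<le> p + \<rho> * real m \<or> p + \<rho> + \<rho> * real m \<le> p + \<rho> * real n"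
      by (simp add: distrib_left) argo
  qed (auto intro: smooth_power_diff)
  also have "\<dots> = (\<Sum>d<H. e d ^ (card A + 2) * mon_int (\<lambda>s. (T - (s + \<rho> * real d)) ^ \<nu>) A c \<psi>)"
    by (simp add: mon_int_shift[OF assms(2) smooth_power_diff])
  also have "\<dots> = mon_int (\<lambda>s. \<Sum>d<H. e d ^ (card A + 2) * (T - (s + \<rho> * real d)) ^ \<nu>) A c \<psi>"
    by (rule mon_int_weight_sum[OF _ assms(2) smooth_weight]) simp
  finally show "moment T (\<lambda>x. \<Sum>d<H. e d * \<psi> (x - \<rho> * real d)) (A, c, \<nu>) =
      mon_int (\<lambda>s. \<Sum>d<H. e d ^ (card A + 2) * (T - (s + \<rho> * real d)) ^ \<nu>) A c \<psi>" .
qed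

text \<open>\<open>N - \<nu>\<close> is smaller than \<open>Suc N\<close>, so the rank compares
  lexicographically. Sets of equal size are equal as soon as one contains the other, which leaves
  the last case for tied sets.\<close>

lemma rank_cases:
  assumes "i \<in> Idx N r" "i' \<in> Idx N r" "i' \<noteq> i" "idx_rank N i' \<le> idx_rank N i"
    and i: "i = (A, c, \<nu>)" "i' = (A', c', \<nu>')"
  shows "c' < c \<or> c' = c \<and> A' = A \<and> \<nu> < \<nu>' \<or> c' = c \<and> \<not> A' \<subseteq> A"
proof -
  have b: "\<nu> \<le> N" "\<nu>' \<le> N" "card A = card A'" "A \<subseteq> {..c}" using assms by (auto simp: Idx_def)
  have le: "c' * Suc N + (N - \<nu>') \<le> c * Suc N + (N - \<nu>)" using assms by (simp add: idx_rank_def)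
  have "c' \<le> c"
  proof (rule ccontr)
    assume "\<not> c' \<le> c"
    then have "Suc c * Suc N \<le> c' * Suc N" by (intro mult_le_mono1) simp
    then show False using le by simp
  qed
  moreover have "\<nu> \<le> \<nu>'" if "c' = c" using le that b by simp
  moreover have "A' = A" if "A' \<subseteq> A"
    using that b card_subset_eq[of A A'] finite_subset[OF b(4)] by simp
  ultimately show ?thesis using assms(3) i by (auto simp: le_less)
qed

text \<open>As the coefficients disappear in degree \<open>r + 2\<close>, the packet is tested
  against a sum of positive weights and \<open>dominant_mon_int\<close> applies to its single
  profile \<psi>. Allowing several copies lets one statement serve both the plain cubic pieces and
  the signed quartic packets.\<close>

lemma dominant_moment:
  fixes e :: "nat \<Rightarrow> real"
  assumes T: "0 < T" and H: "0 < H" "\<And>d. d < H \<Longrightarrow> e d ^ (r + 2) = 1" and r: "1 \<le> r"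
    and i: "i \<in> Idx N r" and \<sigma>: "\<sigma> \<in> {1, -1}" and \<eta>: "0 < \<eta>"
  shows "\<exists>n\<ge>m. \<exists>\<rho>>0. \<exists>\<psi>\<in>Cc (tn T n) (tn T n + \<rho>). tn T n + \<rho> * real H = tn T (Suc n) \<and>
    \<sigma> * moment T (\<lambda>x. \<Sum>d<H. e d * \<psi> (x - \<rho> * real d)) i > 0 \<and>
    (\<forall>i'\<in>Idx N r. i' \<noteq> i \<and> idx_rank N i' \<le> idx_rank N i \<longrightarrow>
      \<bar>moment T (\<lambda>x. \<Sum>d<H. e d * \<psi> (x - \<rho> * real d)) i'\<bar> \<le> \<eta> * \<bar>moment T (\<lambda>x. \<Sum>d<H. e d * \<psi> (x - \<rho> * real d)) i\<bar>)"
proof -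
  obtain A c \<nu> where ieq: "i = (A, c, \<nu>)" by (cases i)
  \<comment> \<open>Each additional power of \<open>T - s\<close> then costs at least a factor
    \<delta>, provided \<open>T - s < \<delta> \<le> 1\<close>; this has to lie strictly below
    \<eta>.\<close>
  define \<delta> where "\<delta> = min 1 (\<eta> / 2)"
  have \<delta>: "0 < \<delta>" "\<delta> \<le> 1" "\<delta> < \<eta>" using \<eta> by (auto simp: \<delta>_def)
  obtain n where n: "n \<ge> m" "T - tn T n < \<delta>" using tn_close[OF T \<delta>(1)] by blast
  define \<rho> where "\<rho> = (tn T (Suc n) - tn T n) / real H"
  have \<rho>: "0 < \<rho>" "tn T n + \<rho> * real H = tn T (Suc n)"
    using H(1) tn_props(2)[OF T, of n] by (simp_all add: \<rho>_def)
  define s where "s = tn T n + \<rho> / 2"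
  define W where "W k x = (\<Sum>d<H. 1 * (T - (x + \<rho> * real d)) ^ k)" for k x
  have x: "0 < T - (s + \<rho> * real d)" "T - (s + \<rho> * real d) < \<delta>" if "d < H" for d
  proof -
    have "real d + 1 \<le> real H" using that by simp
    then have "\<rho> * (real d + 1) \<le> \<rho> * real H" using \<rho> by (intro mult_left_mono) auto
    then have "tn T n + \<rho> * real d + \<rho> \<le> tn T (Suc n)" using \<rho>(2) by (simp add: distrib_left)
    then show "0 < T - (s + \<rho> * real d)"
      using tn_props(3)[OF T, of "Suc n"] \<rho>(1) by (simp add: s_def)
    have "0 \<le> \<rho> * real d" using \<rho>(1) by simp
    then show "T - (s + \<rho> * real d) < \<delta>" using n(2) \<rho>(1) unfolding s_def by linarith
  qed
  have Wpos: "0 < W k s" for k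
    unfolding W_def using x H(1) by (intro sum_pos) auto
  have Wsmall: "W k' s \<le> \<delta> * W k s" if "k < k'" for k k'
    unfolding W_def sum_distrib_left
  proof (rule sum_mono)
    fix d assume "d \<in> {..<H}"
    then have y: "0 < T - (s + \<rho> * real d)" "T - (s + \<rho> * real d) < \<delta>" using x by auto
    define y where "y = T - (s + \<rho> * real d)"
    obtain j where j: "k' = Suc (k + j)" using \<open>k < k'\<close> less_imp_Suc_add by blast
    have "y ^ j \<le> 1" using y \<delta> by (intro power_le_one) (auto simp: y_def)
    then have "y ^ k * (y * y ^ j) \<le> y ^ k * (\<delta> * 1)"
      using y by (intro mult_left_mono mult_mono) (auto simp: y_def)
    then show "1 * (T - (s + \<rho> * real d)) ^ k' \<le> \<delta> * (1 * (T - (s + \<rho> * real d)) ^ k)"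
      unfolding y_def[symmetric] j by (simp add: power_add mult_ac)
  qed
  have sW: "smooth (W k)" for k unfolding W_def by (rule smooth_weight_sum)
  define E where "E = {i' \<in> Idx N r. i' \<noteq> i \<and> idx_rank N i' \<le> idx_rank N i}"
  have "\<exists>\<psi>\<in>Cc (tn T n) (tn T n + \<rho>). \<sigma> * mon_int (W \<nu>) A c \<psi> > 0 \<and>
    (\<forall>e\<in>E. \<bar>mon_int (W (snd (snd e))) (fst e) (fst (snd e)) \<psi>\<bar> \<le> \<eta> * \<bar>mon_int (W \<nu>) A c \<psi>\<bar>)"
  proof (rule dominant_mon_int[where s = s])
    show "A \<noteq> {}" "A \<subseteq> {..c}" using i r by (auto simp: ieq Idx_def)
    show "finite E" unfolding E_def using finite_Idx by simp
    fix i' assume i': "i' \<in> E"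
    obtain A' c' \<nu>' where i'eq: "i' = (A', c', \<nu>')" by (cases i')
    show "fst i' \<subseteq> {..fst (snd i')}" using i' by (auto simp: E_def Idx_def)
    have "c' < c \<or> c' = c \<and> A' = A \<and> \<nu> < \<nu>' \<or> c' = c \<and> \<not> A' \<subseteq> A"
      using i' by (intro rank_cases[OF i _ _ _ ieq i'eq]) (auto simp: E_def)
    moreover have "\<bar>W \<nu>' s\<bar> < \<eta> * W \<nu> s" if "\<nu> < \<nu>'"
    proof -
      have "W \<nu>' s \<le> \<delta> * W \<nu> s" by (rule Wsmall[OF that])
      also have "\<dots> < \<eta> * W \<nu> s" using \<delta> Wpos by (intro mult_strict_right_mono)
      finally show ?thesis using Wpos[of \<nu>'] by simp
    qed
    ultimately show "fst (snd i') < c \<or> fst (snd i') = c \<and> fst i' = A \<and> \<bar>W (snd (snd i')) s\<bar> < \<eta> * W \<nu> s \<or>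
       fst (snd i') = c \<and> \<not> fst i' \<subseteq> A"
      by (auto simp: i'eq)
  qed (use \<rho> Wpos sW \<sigma> \<eta> in \<open>auto simp: s_def\<close>)
  then obtain \<psi> where \<psi>: "\<psi> \<in> Cc (tn T n) (tn T n + \<rho>)" "\<sigma> * mon_int (W \<nu>) A c \<psi> > 0"
    "\<And>e. e \<in> E \<Longrightarrow> \<bar>mon_int (W (snd (snd e))) (fst e) (fst (snd e)) \<psi>\<bar> \<le> \<eta> * \<bar>mon_int (W \<nu>) A c \<psi>\<bar>"
    by blast
  have mom: "moment T (\<lambda>x. \<Sum>d<H. e d * \<psi> (x - \<rho> * real d)) (A', c', \<nu>') = mon_int (W \<nu>') A' c' \<psi>"
    if "(A', c', \<nu>') \<in> Idx N r" for A' c' \<nu>'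
  proof -
    have cA: "card A' = r" using that by (simp add: Idx_def)
    have "(\<Sum>d<H. e d ^ (card A' + 2) * (T - (s + \<rho> * real d)) ^ \<nu>') = W \<nu>' s" for s
      unfolding W_def by (intro sum.cong) (simp_all only: cA H(2) lessThan_iff)
    then show ?thesis
      unfolding shifted_copies(2)[OF \<rho>(1) \<psi>(1) H(1)] by simp
  qed
  have "\<sigma> * moment T (\<lambda>x. \<Sum>d<H. e d * \<psi> (x - \<rho> * real d)) i > 0"
    using \<psi>(2) mom i by (simp add: ieq)
  moreover have "\<bar>moment T (\<lambda>x. \<Sum>d<H. e d * \<psi> (x - \<rho> * real d)) i'\<bar> \<le> \<eta> * \<bar>moment T (\<lambda>x. \<Sum>d<H. e d * \<psi> (x - \<rho> * real d)) i\<bar>"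
    if "i' \<in> Idx N r" "i' \<noteq> i" "idx_rank N i' \<le> idx_rank N i" for i'
  proof -
    obtain A' c' \<nu>' where i'eq: "i' = (A', c', \<nu>')" by (cases i')
    show ?thesis using \<psi>(3)[of i'] that mom[of A' c' \<nu>'] mom[of A c \<nu>] i by (simp add: E_def ieq i'eq)
  qed
  ultimately show ?thesis using n(1) \<rho> \<psi>(1) by blast
qed

definition vanishing :: "real \<Rightarrow> nat \<Rightarrow> (real \<Rightarrow> real) set" where
  "vanishing T N = {\<psi>. \<forall>i\<in>Idx N 1. moment T \<psi> i = 0}"

lemma dominant_cubic_moment:
  assumes T: "0 < T" and i: "i \<in> Idx N 1" "\<sigma> \<in> {1, -1}" "0 < \<eta>"
  shows "\<exists>n\<ge>m. \<exists>\<psi>\<in>Cc (tn T n) (tn T (Suc n)). \<sigma> * moment T \<psi> i > 0 \<and>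
    (\<forall>i'\<in>Idx N 1. i' \<noteq> i \<and> idx_rank N i' \<le> idx_rank N i \<longrightarrow> \<bar>moment T \<psi> i'\<bar> \<le> \<eta> * \<bar>moment T \<psi> i\<bar>)"
proof -
  obtain n \<rho> \<psi> where *: "n \<ge> m" "0 < \<rho>" "\<psi> \<in> Cc (tn T n) (tn T n + \<rho>)" "tn T n + \<rho> * real 1 = tn T (Suc n)"
    "\<sigma> * moment T (\<lambda>x. \<Sum>d<1. 1 * \<psi> (x - \<rho> * real d)) i > 0"
    "\<forall>i'\<in>Idx N 1. i' \<noteq> i \<and> idx_rank N i' \<le> idx_rank N i \<longrightarrow>
      \<bar>moment T (\<lambda>x. \<Sum>d<1. 1 * \<psi> (x - \<rho> * real d)) i'\<bar> \<le> \<eta> * \<bar>moment T (\<lambda>x. \<Sum>d<1. 1 * \<psi> (x - \<rho> * real d)) i\<bar>"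
    using dominant_moment[OF T zero_less_one power_one order_refl i, of m]
    by (elim exE bexE conjE) (rule that; assumption)
  have eq: "(\<lambda>x. \<Sum>d<1. 1 * \<psi> (x - \<rho> * real d)) = \<psi>" by simp
  show ?thesis
    using *(1,3,4) *(5,6)[unfolded eq] by (intro exI[of _ n] conjI bexI[of _ \<psi>]) simp_all
qed

text \<open>In the number \<open>d\<close> of a copy,
  \<open>(T - (s + \<rho> * real d)) ^ \<nu>\<close> is a polynomial of degree at most
  \<open>N\<close>. The signs, unchanged by cubing, therefore make the combined cubic weight vanish
  for every \<open>s\<close>, whatever \<psi> is; their fourth powers are 1, so dominance in degree
  four is unaffected.\<close>

lemma dominant_quartic_moment:
  assumes T: "0 < T" and i: "i \<in> Idx N 2" "\<sigma> \<in> {1, -1}" "0 < \<eta>"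
  shows "\<exists>n\<ge>m. \<exists>\<psi>\<in>Cc (tn T n) (tn T (Suc n)) \<inter> vanishing T N. \<sigma> * moment T \<psi> i > 0 \<and>
    (\<forall>i'\<in>Idx N 2. i' \<noteq> i \<and> idx_rank N i' \<le> idx_rank N i \<longrightarrow> \<bar>moment T \<psi> i'\<bar> \<le> \<eta> * \<bar>moment T \<psi> i\<bar>)"
proof -
  obtain H and e :: "nat \<Rightarrow> real" where H: "0 < H" "\<forall>d. e d = 1 \<or> e d = - 1"
    "\<forall>k<Suc N. (\<Sum>d<H. e d * real d ^ k) = 0"
    using ex_signs_vanishing_moments[of "Suc N"] by (elim exE conjE) (rule that)
  have e4: "e d ^ (2 + 2) = 1" for d using spec[OF H(2), of d] by auto
  have e3: "e d ^ (1 + 2) = e d" for d using spec[OF H(2), of d] by auto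
  obtain n \<rho> \<psi> where *: "n \<ge> m" "0 < \<rho>" "\<psi> \<in> Cc (tn T n) (tn T n + \<rho>)" "tn T n + \<rho> * real H = tn T (Suc n)"
    "\<sigma> * moment T (\<lambda>x. \<Sum>d<H. e d * \<psi> (x - \<rho> * real d)) i > 0"
    "\<forall>i'\<in>Idx N 2. i' \<noteq> i \<and> idx_rank N i' \<le> idx_rank N i \<longrightarrow>
      \<bar>moment T (\<lambda>x. \<Sum>d<H. e d * \<psi> (x - \<rho> * real d)) i'\<bar> \<le> \<eta> * \<bar>moment T (\<lambda>x. \<Sum>d<H. e d * \<psi> (x - \<rho> * real d)) i\<bar>"
    using dominant_moment[where e = e, OF T H(1) e4 one_le_numeral i, of m]
    by (elim exE bexE conjE) (rule that; assumption)
  have "moment T (\<lambda>x. \<Sum>d<H. e d * \<psi> (x - \<rho> * real d)) (A, c, \<nu>) = 0" if "(A, c, \<nu>) \<in> Idx N 1" for A c \<nu>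
  proof -
    have A: "card A = 1" "\<nu> \<le> N" using that by (auto simp: Idx_def)
    have "(\<Sum>d<H. e d * (T - (s + \<rho> * real d)) ^ \<nu>) = 0" for s
    proof -
      have "(\<Sum>d<H. e d * (T - (s + \<rho> * real d)) ^ \<nu>) = (\<Sum>d<H. e d * ((- \<rho>) * real d + (T - s)) ^ \<nu>)"
        by (simp add: algebra_simps)
      also have "\<dots> = (\<Sum>d<H. \<Sum>k\<le>\<nu>. e d * (real (\<nu> choose k) * ((- \<rho>) * real d) ^ k * (T - s) ^ (\<nu> - k)))"
        unfolding binomial_ring sum_distrib_left ..
      also have "\<dots> = (\<Sum>k\<le>\<nu>. real (\<nu> choose k) * (- \<rho>) ^ k * (T - s) ^ (\<nu> - k) * (\<Sum>d<H. e d * real d ^ k))"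
        by (subst sum.swap) (simp only: sum_distrib_left power_mult_distrib mult_ac)
      also have "\<dots> = 0" using A(2) by (intro sum.neutral) (auto simp: H(3))
      finally show ?thesis .
    qed
    then show ?thesis
      unfolding shifted_copies(2)[OF *(2,3) H(1)] A(1) e3 by (simp add: mon_int_def)
  qed
  then have "(\<lambda>x. \<Sum>d<H. e d * \<psi> (x - \<rho> * real d)) \<in> vanishing T N"
    by (auto simp: vanishing_def)
  moreover have "(\<lambda>x. \<Sum>d<H. e d * \<psi> (x - \<rho> * real d)) \<in> Cc (tn T n) (tn T (Suc n))"
    using shifted_copies(1)[OF *(2,3) H(1)] *(4) by simp
  ultimately show ?thesis using *(1,5,6) by blast
qed

section \<open>Iterated primitives\<close>

text \<open>The support lies after time 0, so integrating a derivative from 0 produces no boundary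
  term.\<close>

lemma iter_prim_deriv:
  assumes "f \<in> Cc p q" "0 \<le> p" "j \<le> n" "0 \<le> t"
  shows "iter_prim j ((deriv ^^ n) f) t = (deriv ^^ (n - j)) f t"
  using assms(3,4)
proof (induction j arbitrary: t)
  case (Suc j)
  have "iter_prim (Suc j) ((deriv ^^ n) f) t = integral {0..t} ((deriv ^^ (n - j)) f)"
    using Suc by (auto intro: integral_cong)
  also have "n - j = Suc (n - Suc j)" using Suc.prems by simp
  also have "integral {0..t} ((deriv ^^ Suc (n - Suc j)) f) = (deriv ^^ (n - Suc j)) f t - (deriv ^^ (n - Suc j)) f 0"
  proof (intro integral_unique fundamental_theorem_of_calculus Suc.prems)
    fix x
    show "((deriv ^^ (n - Suc j)) f has_vector_derivative (deriv ^^ Suc (n - Suc j)) f x) (at x within {0..t})"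
      unfolding has_real_derivative_iff_has_vector_derivative[symmetric]
      by (rule has_field_derivative_at_within) (rule smooth_has_deriv[OF Cc_smooth_fun[OF assms(1)]])
  qed
  also have "(deriv ^^ (n - Suc j)) f 0 = 0" using assms by (intro Cc_zero) auto
  finally show ?case by simp
qed simp

lemma iter_prim_continuous:
  "continuous_on {0..T} u \<Longrightarrow> continuous_on {0..T} (iter_prim j u)"
  by (induction j) (simp_all add: indefinite_integral_continuous_1 integrable_continuous_real)

lemma iter_prim_sum:
  assumes "finite D" "\<And>n. n \<in> D \<Longrightarrow> continuous_on {0..T} (u n)" "t \<in> {0..T}"
  shows "iter_prim j (\<lambda>x. \<Sum>n\<in>D. k n * u n x) t = (\<Sum>n\<in>D. k n * iter_prim j (u n) t)"
  using assms(3)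
proof (induction j arbitrary: t)
  case (Suc j)
  have "iter_prim (Suc j) (\<lambda>x. \<Sum>n\<in>D. k n * u n x) t = integral {0..t} (\<lambda>x. \<Sum>n\<in>D. k n * iter_prim j (u n) x)"
    using Suc by (auto intro: integral_cong)
  also have "\<dots> = (\<Sum>n\<in>D. integral {0..t} (\<lambda>x. k n * iter_prim j (u n) x))"
    using Suc.prems assms
    by (intro Henstock_Kurzweil_Integration.integral_sum integrable_on_mult_right integrable_continuous_real
        continuous_on_subset[OF iter_prim_continuous]) auto
  finally show ?case by simp
qed simp

lemma iter_prim_add:
  assumes "continuous_on {0..T} u" "continuous_on {0..T} v" "t \<in> {0..T}"
  shows "iter_prim j (\<lambda>x. u x + v x) t = iter_prim j u t + iter_prim j v t"
  using iter_prim_sum[of "{False, True}" T "\<lambda>b. if b then u else v" t j "\<lambda>_. 1"] assms by (simp add: add.commute)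

lemma iter_prim_zero_before:
  assumes "\<And>s. s \<le> q \<Longrightarrow> u s = 0" "t \<le> q"
  shows "iter_prim j u t = 0"
  using assms(2)
proof (induction j arbitrary: t)
  case (Suc j)
  have "iter_prim (Suc j) u t = integral {0..t} (\<lambda>_. 0)"
    unfolding iter_prim.simps by (rule integral_cong) (use Suc in auto)
  then show ?case by simp
qed (use assms in auto)

section \<open>The three families of pieces\<close>

text \<open>The \<open>i\<close>-th derivative of a bump has primitives of orders 1 to
  \<open>i\<close> that vanish at \<open>T\<close>, while the one of order \<open>i + 1\<close> is
  the integral of the bump: a triangular system, ranked by \<open>id\<close>. The functionals are
  linear, so these pieces may overlap and share one interval.\<close>

lemma linear_family:
  assumes "0 \<le> q" "q < T"
  shows "\<exists>D x d L. finite D \<and> (\<forall>n\<in>D. x n \<in> Cc q T) \<and> (\<forall>n. d n (\<lambda>_. 0) = (0::real)) \<and>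
    (\<forall>y. \<forall>\<nu><N. (\<Sum>n\<in>D. d n y * iter_prim (Suc \<nu>) (x n) T) = y \<nu>) \<and>
    (\<forall>n::nat. \<forall>y y'. \<bar>d n y - d n y'\<bar> \<le> L * (\<Sum>\<nu><N. \<bar>y \<nu> - y' \<nu>\<bar>))"
proof -
  define e where "e = (T - q) / 4"
  define s where "s = (q + T) / 2"
  define b where "b x = bump ((x - s) / e)" for x
  have e: "0 < e" using assms by (simp add: e_def)
  have b: "b \<in> Cc q T"
    unfolding b_def by (rule Cc_mono[OF Cc_scale[OF bump_Cc e]]) (simp_all add: e_def s_def field_simps)
  have bs: "smooth b" using b by (rule Cc_smooth_fun)
  define J where "J = integral {0..T} b"
  have J: "0 < J"
  proof -
    have "J \<noteq> 0"
    proof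
      assume "J = 0"
      then have "\<forall>x\<in>{0..T}. b x = 0"
        unfolding J_def using assms
        by (subst (asm) integral_eq_0_iff) (auto simp: b_def bump_nonneg intro!: smooth_continuous_on0[OF bs, unfolded b_def])
      then have "b s = 0" using assms by (auto simp: s_def)
      then show False using bump_pos[of 0] by (simp add: b_def)
    qed
    moreover have "0 \<le> J" unfolding J_def
      by (intro integral_nonneg integrable_continuous_real smooth_continuous_on0 bs) (simp add: b_def bump_nonneg)
    ultimately show ?thesis by simp
  qed
  have "\<exists>D x d L. finite D \<and> D \<subseteq> {0::nat..} \<and> (\<forall>n\<in>D. x n \<in> Cc q T) \<and> (\<forall>n y. (d n y :: real) \<ge> 0) \<and>
    (\<forall>n. d n (\<lambda>_. 0) = 0) \<and> (\<forall>y. \<forall>i\<in>{..<N}. (\<Sum>n\<in>D. d n y * iter_prim (Suc i) (x n) T) = y i) \<and>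
    (\<forall>n y y'. \<bar>d n y - d n y'\<bar> \<le> L * (\<Sum>i\<in>{..<N}. \<bar>y i - y' i\<bar>))"
  proof (rule positively_spanning_family[where rk = id and V = "\<lambda>x i. iter_prim (Suc i) x T" and X = "\<lambda>_. Cc q T"])
    fix i :: nat and \<sigma> \<eta> :: real and m :: nat
    assume i: "i \<in> {..<N}" "\<sigma> \<in> {1, -1}" "0 < \<eta>"
    define f where "f x = \<sigma> * b x" for x
    have f: "f \<in> Cc q T" unfolding f_def by (rule Cc_cmult[OF b])
    have "iter_prim (Suc i) ((deriv ^^ i) f) T = integral {0..T} (\<lambda>x. \<sigma> * b x)"
      unfolding iter_prim.simps by (rule integral_cong) (use iter_prim_deriv[OF f assms(1), of i i] in \<open>simp add: f_def\<close>)
    then have "iter_prim (Suc i) ((deriv ^^ i) f) T = \<sigma> * J" by (simp add: J_def)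
    then have "\<sigma> * iter_prim (Suc i) ((deriv ^^ i) f) T > 0"
      using i(2) J by auto
    moreover have "iter_prim (Suc i') ((deriv ^^ i) f) T = 0" if "i' < i" for i'
      using iter_prim_deriv[OF f assms(1), of "Suc i'" i T] that assms Cc_zero[OF f] by simp
    ultimately show "\<exists>n\<ge>m. \<exists>x\<in>Cc q T. \<sigma> * iter_prim (Suc i) x T > 0 \<and>
        (\<forall>i'\<in>{..<N}. i' \<noteq> i \<and> id i' \<le> id i \<longrightarrow> \<bar>iter_prim (Suc i') x T\<bar> \<le> \<eta> * \<bar>iter_prim (Suc i) x T\<bar>)"
      using i(3) by (intro exI[of _ m] conjI bexI[of _ "(deriv ^^ i) f"] Cc_deriv f)
        (auto simp: le_less simp del: iter_prim.simps)
  qed simp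
  then obtain D x d L where *: "finite D" "\<forall>n\<in>D. x n \<in> Cc q T" "\<forall>n. d n (\<lambda>_. 0) = (0::real)"
    "\<forall>y. \<forall>i\<in>{..<N}. (\<Sum>n\<in>D. d n y * iter_prim (Suc i) (x n) T) = y i"
    "\<forall>n::nat. \<forall>y y'. \<bar>d n y - d n y'\<bar> \<le> L * (\<Sum>i\<in>{..<N}. \<bar>y i - y' i\<bar>)"
    by (elim exE conjE) (rule that; assumption)
  show ?thesis
    by (rule exI[of _ D], rule exI[of _ x], rule exI[of _ d], rule exI[of _ L])
      (use * in \<open>simp del: iter_prim.simps\<close>)
qed

lemma cubic_family:
  assumes "0 < T"
  shows "\<exists>D x d L. finite D \<and> D \<subseteq> {m..} \<and> (\<forall>n\<in>D. x n \<in> Cc (tn T n) (tn T (Suc n))) \<and> (\<forall>n y. (d n y :: real) \<ge> 0) \<and>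
    (\<forall>n. d n (\<lambda>_. 0) = 0) \<and> (\<forall>y. \<forall>i\<in>Idx N 1. (\<Sum>n\<in>D. d n y * moment T (x n) i) = y i) \<and>
    (\<forall>n y y'. \<bar>d n y - d n y'\<bar> \<le> L * (\<Sum>i\<in>Idx N 1. \<bar>y i - y' i\<bar>))"
  by (rule positively_spanning_family[where rk = "idx_rank N", OF finite_Idx])
    (rule dominant_cubic_moment[OF assms])

lemma quartic_family:
  assumes "0 < T"
  shows "\<exists>D x d L. finite D \<and> D \<subseteq> {m..} \<and> (\<forall>n\<in>D. x n \<in> Cc (tn T n) (tn T (Suc n)) \<inter> vanishing T N) \<and> (\<forall>n y. (d n y :: real) \<ge> 0) \<and>
    (\<forall>n. d n (\<lambda>_. 0) = 0) \<and> (\<forall>y. \<forall>i\<in>Idx N 2. (\<Sum>n\<in>D. d n y * moment T (x n) i) = y i) \<and>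
    (\<forall>n y y'. \<bar>d n y - d n y'\<bar> \<le> L * (\<Sum>i\<in>Idx N 2. \<bar>y i - y' i\<bar>))"
  by (rule positively_spanning_family[where rk = "idx_rank N", OF finite_Idx])
    (rule dominant_quartic_moment[OF assms])

section \<open>Sobolev norms of smooth perturbations\<close>

lemma deriv_funpow_Suc: "(deriv ^^ n) (deriv f) = (deriv ^^ Suc n) f"
  by (simp only: funpow_swap1 funpow.simps o_apply)

lemma Cc_parts:
  assumes "f \<in> Cc 0 T" "\<phi> \<in> Cc 0 T"
  shows "integral {0..T} (\<lambda>t. f t * (deriv ^^ i) \<phi> t) = (- 1) ^ i * integral {0..T} (\<lambda>t. (deriv ^^ i) f t * \<phi> t)"
  using assms
proof (induction i arbitrary: f)
  case (Suc i)
  let ?g = "(deriv ^^ i) \<phi>"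
  have sf: "smooth f" and sp: "smooth \<phi>" using Suc.prems by (auto intro: Cc_smooth_fun)
  note cont = smooth_continuous_on[OF sf] smooth_continuous_on[OF sp] smooth_continuous_on0[OF sf]
  have T: "0 \<le> T" using Suc.prems(1) by (elim CcE) auto
  have "((\<lambda>t. deriv f t * ?g t + f t * (deriv ^^ Suc i) \<phi> t) has_integral f T * ?g T - f 0 * ?g 0) {0..T}"
  proof (rule fundamental_theorem_of_calculus[OF T])
    fix x assume "x \<in> {0..T}"
    have "((\<lambda>t. f t * ?g t) has_real_derivative deriv f x * ?g x + f x * (deriv ^^ Suc i) \<phi> x) (at x)"
      using DERIV_mult[OF smooth_has_deriv[OF sf, of 0 x] smooth_has_deriv[OF sp, of i x]] by (simp add: add.commute mult.commute)
    then show "((\<lambda>t. f t * ?g t) has_vector_derivative deriv f x * ?g x + f x * (deriv ^^ Suc i) \<phi> x) (at x within {0..T})"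
      unfolding has_real_derivative_iff_has_vector_derivative[symmetric]
      by (rule has_field_derivative_at_within)
  qed
  moreover have "f T = 0" "f 0 = 0" using Cc_zero0[OF Suc.prems(1)] by auto
  ultimately have "0 = integral {0..T} (\<lambda>t. deriv f t * ?g t + f t * (deriv ^^ Suc i) \<phi> t)"
    by (simp add: integral_unique)
  also have "\<dots> = integral {0..T} (\<lambda>t. deriv f t * ?g t) + integral {0..T} (\<lambda>t. f t * (deriv ^^ Suc i) \<phi> t)"
    using cont(1)[of _ 1]
    by (intro Henstock_Kurzweil_Integration.integral_add integrable_continuous_real continuous_on_mult cont) simp
  also have "integral {0..T} (\<lambda>t. deriv f t * ?g t) = (- 1) ^ i * integral {0..T} (\<lambda>t. (deriv ^^ i) (deriv f) t * \<phi> t)"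
    using Cc_deriv[OF Suc.prems(1), of 1] Suc.prems(2) by (intro Suc.IH) simp_all
  finally show ?case unfolding deriv_funpow_Suc by simp
qed simp

lemma Cc_measurable: "f \<in> Cc p q \<Longrightarrow> (deriv ^^ i) f \<in> borel_measurable (lebesgue_on {0<..<T})"
  by (intro continuous_imp_measurable_on_sets_lebesgue smooth_continuous_on Cc_smooth_fun) auto

lemma Cc_absolutely_integrable:
  assumes "f \<in> Cc p q"
  shows "(deriv ^^ i) f absolutely_integrable_on {0<..<T}"
proof -
  have "(deriv ^^ i) f absolutely_integrable_on {0..T}"
    by (intro absolutely_integrable_continuous_real smooth_continuous_on Cc_smooth_fun[OF assms])
  then show ?thesis by (rule set_integrable_subset) auto
qed

lemma weak_deriv_Cc:
  assumes "f \<in> Cc 0 T" "0 < T"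
  shows "weak_deriv T i f ((deriv ^^ i) f)"
  unfolding weak_deriv_def
proof (intro conjI ballI)
  show "f absolutely_integrable_on {0<..<T}" "(deriv ^^ i) f absolutely_integrable_on {0<..<T}"
    using Cc_absolutely_integrable[OF assms(1), where i = 0 and T = T] Cc_absolutely_integrable[OF assms(1)] by simp_all
  fix \<phi> assume "\<phi> \<in> Cc_smooth T"
  then have "\<phi> \<in> Cc 0 T" using Cc_smooth_eq[OF assms(2)] by simp
  from Cc_parts[OF assms(1) this, of i]
  show "integral {0<..<T} (\<lambda>t. f t * (deriv ^^ i) \<phi> t) = (- 1) ^ i * integral {0<..<T} (\<lambda>t. (deriv ^^ i) f t * \<phi> t)"
    by (simp add: integral_open_interval_real)
qed

lemma weak_deriv_integrable:
  assumes "f absolutely_integrable_on {0<..<T}" "\<phi> \<in> Cc 0 T"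
  shows "(\<lambda>t. f t * (deriv ^^ i) \<phi> t) integrable_on {0<..<T}"
proof -
  have "compact ((deriv ^^ i) \<phi> ` {0..T})"
    by (intro compact_continuous_image smooth_continuous_on Cc_smooth_fun[OF assms(2)]) auto
  then have "bounded ((deriv ^^ i) \<phi> ` {0<..<T})"
    by (rule bounded_subset[OF compact_imp_bounded]) (intro image_mono, auto)
  then have "(\<lambda>t. (deriv ^^ i) \<phi> t * f t) absolutely_integrable_on {0<..<T}"
    by (intro absolutely_integrable_bounded_measurable_product_real Cc_measurable[OF assms(2)] assms(1)) auto
  then show ?thesis
    by (simp add: mult.commute set_lebesgue_integral_eq_integral(1))
qed

lemma weak_deriv_add:
  assumes "weak_deriv T i f g" "weak_deriv T i f' g'" "0 < T"
  shows "weak_deriv T i (\<lambda>t. f t + f' t) (\<lambda>t. g t + g' t)"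
  unfolding weak_deriv_def
proof (intro conjI ballI)
  have ai: "f absolutely_integrable_on {0<..<T}" "g absolutely_integrable_on {0<..<T}"
    "f' absolutely_integrable_on {0<..<T}" "g' absolutely_integrable_on {0<..<T}"
    using assms by (auto simp: weak_deriv_def)
  show "(\<lambda>t. f t + f' t) absolutely_integrable_on {0<..<T}" "(\<lambda>t. g t + g' t) absolutely_integrable_on {0<..<T}"
    using ai by (auto intro: set_integral_add(1))
  fix \<phi> assume \<phi>: "\<phi> \<in> Cc_smooth T"
  then have \<phi>': "\<phi> \<in> Cc 0 T" using Cc_smooth_eq[OF assms(3)] by simp
  note int = weak_deriv_integrable[OF _ \<phi>', of _ i] weak_deriv_integrable[OF _ \<phi>', of _ 0, simplified]
  have "integral {0<..<T} (\<lambda>t. (f t + f' t) * (deriv ^^ i) \<phi> t) =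
    integral {0<..<T} (\<lambda>t. f t * (deriv ^^ i) \<phi> t) + integral {0<..<T} (\<lambda>t. f' t * (deriv ^^ i) \<phi> t)"
    unfolding distrib_right by (intro Henstock_Kurzweil_Integration.integral_add int ai)
  also have "\<dots> = (- 1) ^ i * (integral {0<..<T} (\<lambda>t. g t * \<phi> t) + integral {0<..<T} (\<lambda>t. g' t * \<phi> t))"
    using assms \<phi> by (simp add: weak_deriv_def distrib_left)
  also have "integral {0<..<T} (\<lambda>t. g t * \<phi> t) + integral {0<..<T} (\<lambda>t. g' t * \<phi> t) =
    integral {0<..<T} (\<lambda>t. (g t + g' t) * \<phi> t)"
    unfolding distrib_right by (intro Henstock_Kurzweil_Integration.integral_add[symmetric] int ai)
  finally show "integral {0<..<T} (\<lambda>t. (f t + f' t) * (deriv ^^ i) \<phi> t) =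
    (- 1) ^ i * integral {0<..<T} (\<lambda>t. (g t + g' t) * \<phi> t)" .
qed

lemma Linf_norm_add_bounded:
  assumes "g \<in> borel_measurable (lebesgue_on {0<..<T})" "h \<in> borel_measurable (lebesgue_on {0<..<T})"
    "\<And>t. \<bar>h t\<bar> \<le> C"
  shows "Linf_norm T (\<lambda>t. g t + h t) \<le> Linf_norm T g + ereal C"
  unfolding Linf_norm_def
proof (rule esssup_I)
  show "(\<lambda>t. ereal \<bar>g t + h t\<bar>) \<in> borel_measurable (lebesgue_on {0<..<T})"
    using assms(1,2) by measurable
  show "AE t in lebesgue_on {0<..<T}. ereal \<bar>g t + h t\<bar> \<le> esssup (lebesgue_on {0<..<T}) (\<lambda>t. ereal \<bar>g t\<bar>) + ereal C"
    using esssup_AE[of "\<lambda>t. ereal \<bar>g t\<bar>" "lebesgue_on {0<..<T}"]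
  proof eventually_elim
    case (elim t)
    have "ereal \<bar>g t + h t\<bar> \<le> ereal \<bar>g t\<bar> + ereal C"
      using assms(3)[of t] abs_triangle_ineq[of "g t" "h t"] by simp
    also have "\<dots> \<le> esssup (lebesgue_on {0<..<T}) (\<lambda>t. ereal \<bar>g t\<bar>) + ereal C"
      using elim by (rule add_right_mono)
    finally show ?case .
  qed
qed

text \<open>For openness it suffices that a strict bound survives small smooth perturbations. Nearly
  optimal representatives \<open>g\<close> for \<open>f\<close> are kept and the classical
  derivatives of \<open>h\<close> are added; half of the gap to \<epsilon> is distributed over the
  \<open>Suc k\<close> norms.\<close>

lemma Wk_inf_norm_perturb:
  assumes "Wk_inf_norm T k f < ereal \<epsilon>" "0 < T"
  shows "\<exists>C>0. \<forall>h\<in>Cc 0 T. (\<forall>i\<le>k. \<forall>t. \<bar>(deriv ^^ i) h t\<bar> \<le> C) \<longrightarrow> Wk_inf_norm T k (\<lambda>t. f t + h t) < ereal \<epsilon>"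
proof -
  obtain g where g: "\<And>i. i \<le> k \<Longrightarrow> weak_deriv T i f (g i)" "(\<Sum>i\<le>k. Linf_norm T (g i)) < ereal \<epsilon>"
    using assms(1) unfolding Wk_inf_norm_def INF_less_iff by auto
  obtain \<delta> where \<delta>: "(\<Sum>i\<le>k. Linf_norm T (g i)) < ereal \<delta>" "\<delta> < \<epsilon>"
    using ereal_dense2[OF g(2)] by auto
  define C where "C = (\<epsilon> - \<delta>) / (2 * real (Suc k))"
  have C: "0 < C" using \<delta> by (simp add: C_def)
  have "Wk_inf_norm T k (\<lambda>t. f t + h t) < ereal \<epsilon>"
    if h: "h \<in> Cc 0 T" "\<And>i t. i \<le> k \<Longrightarrow> \<bar>(deriv ^^ i) h t\<bar> \<le> C" for h
  proof -
    have meas: "g i \<in> borel_measurable (lebesgue_on {0<..<T})" if "i \<le> k" for i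
      using g(1)[OF that] by (auto simp: weak_deriv_def absolutely_integrable_measurable)
    have "Wk_inf_norm T k (\<lambda>t. f t + h t) \<le> (\<Sum>i\<le>k. Linf_norm T (\<lambda>t. g i t + (deriv ^^ i) h t))"
      unfolding Wk_inf_norm_def
      by (rule INF_lower2[of "\<lambda>i t. g i t + (deriv ^^ i) h t"])
        (auto intro!: weak_deriv_add g weak_deriv_Cc[OF h(1)] assms(2))
    also have "\<dots> \<le> (\<Sum>i\<le>k. Linf_norm T (g i) + ereal C)"
      by (intro sum_mono Linf_norm_add_bounded meas Cc_measurable[OF h(1)] h(2)) auto
    also have "\<dots> = (\<Sum>i\<le>k. Linf_norm T (g i)) + ereal (real (Suc k) * C)"
      by (simp add: sum.distrib)
    also have "\<dots> \<le> ereal \<delta> + ereal (real (Suc k) * C)"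
      using \<delta>(1) by (intro add_right_mono) simp
    also have "real (Suc k) * C = (\<epsilon> - \<delta>) / 2" by (simp add: C_def del: of_nat_Suc)
    also have "ereal \<delta> + ereal ((\<epsilon> - \<delta>) / 2) < ereal \<epsilon>" using \<delta>(2) by (simp add: field_simps)
    finally show ?thesis .
  qed
  then show ?thesis using C by blast
qed

lemma Cc_bounded:
  assumes "f \<in> Cc 0 T"
  shows "\<exists>B. \<forall>t. \<bar>(deriv ^^ i) f t\<bar> \<le> B"
proof -
  have "compact ((deriv ^^ i) f ` {0..T})"
    by (intro compact_continuous_image smooth_continuous_on Cc_smooth_fun[OF assms]) auto
  then obtain B where B: "\<forall>x\<in>(deriv ^^ i) f ` {0..T}. norm x \<le> B"
    using compact_imp_bounded bounded_iff by metis
  have "\<bar>(deriv ^^ i) f t\<bar> \<le> \<bar>B\<bar>" for t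
  proof (cases "t \<in> {0..T}")
    case True
    then have "norm ((deriv ^^ i) f t) \<le> B" using B by blast
    then show ?thesis by simp
  next
    case False
    then have "(deriv ^^ i) f t = 0" by (intro Cc_zero[OF assms]) auto
    then show ?thesis by simp
  qed
  then show ?thesis by blast
qed

lemma Cc_in_Wk_inf_0:
  assumes "f \<in> Cc 0 T" "0 < T"
  shows "f \<in> Wk_inf_0 T k"
proof -
  have "\<exists>B. \<forall>t. \<bar>(deriv ^^ i) f t\<bar> \<le> B" for i
    using Cc_bounded[OF assms(1)] by blast
  then obtain B where B: "\<And>i t. \<bar>(deriv ^^ i) f t\<bar> \<le> B i" by metis
  have "Wk_inf_norm T k f \<le> (\<Sum>i\<le>k. Linf_norm T ((deriv ^^ i) f))"
    unfolding Wk_inf_norm_def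
    by (rule INF_lower2[of "\<lambda>i. (deriv ^^ i) f"]) (auto intro: weak_deriv_Cc assms)
  also have "\<dots> \<le> (\<Sum>i\<le>k. ereal (B i))"
  proof (rule sum_mono)
    fix i
    note [measurable] = Cc_measurable[OF assms(1), of i T]
    show "Linf_norm T ((deriv ^^ i) f) \<le> ereal (B i)"
      unfolding Linf_norm_def by (rule esssup_I) (measurable, simp add: B)
  qed
  also have "\<dots> < \<infinity>" by simp
  finally have "Wk_inf_norm T k f < \<infinity>" .
  moreover have "\<exists>g. weak_deriv T i f g \<and> continuous_on {0..T} g \<and> g 0 = 0 \<and> g T = 0" for i
    using weak_deriv_Cc[OF assms, of i] smooth_continuous_on[OF Cc_smooth_fun[OF assms(1)], of _ i]
      Cc_zero[OF assms(1), of _ i] by (intro exI[of _ "(deriv ^^ i) f"]) auto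
  ultimately show ?thesis by (simp add: Wk_inf_0_def)
qed

text \<open>All values are combinations of finitely many fixed smooth functions, so derivatives up
  to order \<open>k\<close> are controlled by the sum of the changes of the coefficients; the
  argument is the same for every \<open>k\<close>.\<close>

lemma continuous_map_Wk_inf_0:
  assumes T: "0 < T" and D: "finite D" "\<And>n. n \<in> D \<Longrightarrow> U n \<in> Cc 0 T"
    and c: "\<And>n. n \<in> D \<Longrightarrow> continuous_map X euclideanreal (\<lambda>a. c a n)"
  shows "continuous_map X (Wk_inf_0_topology T k) (\<lambda>a x. \<Sum>n\<in>D. c a n * U n x)"
proof -
  let ?R = "\<lambda>a x. \<Sum>n\<in>D. c a n * U n x"
  have R: "?R a \<in> Cc 0 T" for a
    by (rule Cc_sum[OF D(1) T D(2)])
  have W: "?R a \<in> Wk_inf_0 T k" for a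
    by (rule Cc_in_Wk_inf_0[OF R T])
  have "openin X (?R -` {g \<in> Wk_inf_0 T k. Wk_inf_norm T k (\<lambda>t. g t - f t) < ereal \<epsilon>} \<inter> topspace X)"
    if f: "f \<in> Wk_inf_0 T k" for f \<epsilon>
  proof (subst openin_subopen, intro ballI)
    fix a assume "a \<in> ?R -` {g \<in> Wk_inf_0 T k. Wk_inf_norm T k (\<lambda>t. g t - f t) < ereal \<epsilon>} \<inter> topspace X"
    then have a: "a \<in> topspace X" "Wk_inf_norm T k (\<lambda>t. ?R a t - f t) < ereal \<epsilon>" by auto
    obtain C where C: "0 < C" "\<And>h. h \<in> Cc 0 T \<Longrightarrow> \<forall>i\<le>k. \<forall>t. \<bar>(deriv ^^ i) h t\<bar> \<le> C \<Longrightarrow>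
      Wk_inf_norm T k (\<lambda>t. ?R a t - f t + h t) < ereal \<epsilon>"
      using Wk_inf_norm_perturb[OF a(2) T] by blast
    have "\<forall>n\<in>D. \<forall>i. \<exists>B. \<forall>t. \<bar>(deriv ^^ i) (U n) t\<bar> \<le> B" using Cc_bounded D(2) by blast
    then obtain B0 where B0: "\<And>n i t. n \<in> D \<Longrightarrow> \<bar>(deriv ^^ i) (U n) t\<bar> \<le> B0 n i" by metis
    define B where "B = 1 + (\<Sum>n\<in>D. \<Sum>i\<le>k. \<bar>B0 n i\<bar>)"
    have Bpos: "0 < B" unfolding B_def by (intro add_pos_nonneg sum_nonneg) auto
    have B: "\<bar>(deriv ^^ i) (U n) t\<bar> \<le> B" if "n \<in> D" "i \<le> k" for n i t
    proof -
      have "\<bar>B0 n i\<bar> \<le> (\<Sum>i\<le>k. \<bar>B0 n i\<bar>)" using that by (intro member_le_sum) auto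
      also have "\<dots> \<le> (\<Sum>n\<in>D. \<Sum>i\<le>k. \<bar>B0 n i\<bar>)"
        using that D by (intro member_le_sum[where f = "\<lambda>n. \<Sum>i\<le>k. \<bar>B0 n i\<bar>"] sum_nonneg) auto
      finally show ?thesis using B0[OF that(1), of i t] by (simp add: B_def)
    qed
    define r where "r b = (\<Sum>n\<in>D. \<bar>c b n - c a n\<bar>)" for b
    have r: "continuous_map X euclideanreal r"
      unfolding r_def by (intro continuous_intros D c) auto
    define N where "N = {b \<in> topspace X. r b \<in> {..<C / B}}"
    have "openin X N" unfolding N_def by (rule openin_continuous_map_preimage[OF r]) simp
    moreover have "a \<in> N" using a(1) C Bpos by (simp add: N_def r_def)
    moreover have "N \<subseteq> ?R -` {g \<in> Wk_inf_0 T k. Wk_inf_norm T k (\<lambda>t. g t - f t) < ereal \<epsilon>} \<inter> topspace X"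
    proof
      fix b assume b: "b \<in> N"
      let ?h = "\<lambda>x. \<Sum>n\<in>D. (c b n - c a n) * U n x"
      have h: "?h \<in> Cc 0 T" by (rule Cc_sum[OF D(1) T D(2)])
      have "\<bar>(deriv ^^ i) ?h t\<bar> \<le> C" if "i \<le> k" for i t
      proof -
        have "(deriv ^^ i) ?h t = (\<Sum>n\<in>D. (c b n - c a n) * (deriv ^^ i) (U n) t)"
          by (subst smooth_sum(2)) (auto intro: Cc_smooth_fun D)
        also have "\<bar>\<dots>\<bar> \<le> (\<Sum>n\<in>D. \<bar>c b n - c a n\<bar> * B)"
          by (rule order_trans[OF sum_abs]) (auto simp: abs_mult intro!: sum_mono mult_left_mono B that)
        also have "\<dots> = r b * B" by (simp add: r_def sum_distrib_right)
        also have "\<dots> \<le> C" using b Bpos by (simp add: N_def field_simps)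
        finally show ?thesis .
      qed
      then have "Wk_inf_norm T k (\<lambda>t. ?R a t - f t + ?h t) < ereal \<epsilon>" by (intro C(2)[OF h]) auto
      moreover have "(\<lambda>t. ?R a t - f t + ?h t) = (\<lambda>t. ?R b t - f t)"
        by (simp add: left_diff_distrib sum_subtractf)
      ultimately show "b \<in> ?R -` {g \<in> Wk_inf_0 T k. Wk_inf_norm T k (\<lambda>t. g t - f t) < ereal \<epsilon>} \<inter> topspace X"
        using b W by (simp add: N_def)
    qed
    ultimately show "\<exists>N. openin X N \<and> a \<in> N \<and> N \<subseteq> ?R -` {g \<in> Wk_inf_0 T k. Wk_inf_norm T k (\<lambda>t. g t - f t) < ereal \<epsilon>} \<inter> topspace X"
      by blast
  qed
  moreover have "?R ` topspace X \<subseteq> topspace (Wk_inf_0_topology T k)"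
    unfolding topspace_Wk_inf_0_topology using W by blast
  ultimately show ?thesis
    unfolding Wk_inf_0_topology_def continuous_on_generated_topo_iff topology_generated_by_topspace
    by auto
qed

section \<open>Continuity of the coefficients\<close>

lemma continuous_map_lipschitz:
  assumes "finite I" "\<And>i. i \<in> I \<Longrightarrow> continuous_map X euclideanreal (\<lambda>a. y a i)"
    and lip: "\<And>y y'. \<bar>d y - d y'\<bar> \<le> L * (\<Sum>i\<in>I. \<bar>y i - y' i\<bar>)"
  shows "continuous_map X euclideanreal (\<lambda>a. d (y a))"
  unfolding continuous_map_atin limitin_canonical_iff
proof
  fix x assume x: "x \<in> topspace X"
  have "((\<lambda>a. L * (\<Sum>i\<in>I. \<bar>y a i - y x i\<bar>)) \<longlongrightarrow> L * (\<Sum>i\<in>I. \<bar>y x i - y x i\<bar>)) (atin X x)"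
    using assms(2) x by (intro tendsto_intros) (simp add: continuous_map_atin)
  then have "((\<lambda>a. L * (\<Sum>i\<in>I. \<bar>y a i - y x i\<bar>)) \<longlongrightarrow> 0) (atin X x)" by simp
  then have "((\<lambda>a. d (y a) - d (y x)) \<longlongrightarrow> 0) (atin X x)"
    by (rule Lim_null_comparison[rotated]) (simp add: lip)
  then show "((\<lambda>a. d (y a)) \<longlongrightarrow> d (y x)) (atin X x)" by (rule LIM_zero_cancel)
qed

lemma continuous_map_root:
  "continuous_map X euclideanreal f \<Longrightarrow> continuous_map X euclideanreal (\<lambda>x. root n (f x))"
  by (simp add: continuous_map_atin tendsto_real_root)

text \<open>Expand one factor by linearity and absorb its fixed function \<open>f n\<close> into the
  weight; hence the induction on the number of factors with arbitrary \<open>w\<close>.\<close>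

lemma continuous_map_multilinear_integral:
  fixes fs :: "('n \<Rightarrow> real \<Rightarrow> real) list"
  assumes "finite D" "\<And>n. n \<in> D \<Longrightarrow> continuous_map X euclideanreal (\<lambda>a. c a n)"
    and "\<And>f n. f \<in> set fs \<Longrightarrow> n \<in> D \<Longrightarrow> continuous_on {0..T} (f n)" "continuous_on {0..T} w"
  shows "continuous_map X euclideanreal
    (\<lambda>a. integral {0..T} (\<lambda>s. w s * prod_list (map (\<lambda>f. \<Sum>n\<in>D. c a n * f n s) fs)))"
  using assms(3,4)
proof (induction fs arbitrary: w)
  case Nil
  then show ?case by simp
next
  case (Cons f fs)
  let ?P = "\<lambda>a s. prod_list (map (\<lambda>f. \<Sum>n\<in>D. c a n * f n s) fs)"
  have "continuous_on {0..T} (\<lambda>s. prod_list (map (\<lambda>f. \<Sum>n\<in>D. c a n * f n s) gs))"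
    if "\<forall>f\<in>set gs. \<forall>n\<in>D. continuous_on {0..T} (f n)" for a and gs :: "('n \<Rightarrow> real \<Rightarrow> real) list"
    using that by (induction gs) (auto intro!: continuous_on_mult continuous_on_sum)
  then have contP: "continuous_on {0..T} (?P a)" for a
    using Cons.prems(1) by simp
  have "integral {0..T} (\<lambda>s. w s * prod_list (map (\<lambda>f. \<Sum>n\<in>D. c a n * f n s) (f # fs))) =
    (\<Sum>n\<in>D. c a n * integral {0..T} (\<lambda>s. (w s * f n s) * ?P a s))" for a
  proof -
    have "integral {0..T} (\<lambda>s. w s * prod_list (map (\<lambda>f. \<Sum>n\<in>D. c a n * f n s) (f # fs))) =
      integral {0..T} (\<lambda>s. \<Sum>n\<in>D. c a n * ((w s * f n s) * ?P a s))"
      by (rule integral_cong) (simp add: sum_distrib_left sum_distrib_right mult_ac)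
    also have "\<dots> = (\<Sum>n\<in>D. integral {0..T} (\<lambda>s. c a n * ((w s * f n s) * ?P a s)))"
      using Cons.prems
      by (intro Henstock_Kurzweil_Integration.integral_sum assms(1) integrable_on_mult_right
          integrable_continuous_real continuous_on_mult contP) auto
    finally show ?thesis by simp
  qed
  moreover have "continuous_map X euclideanreal (\<lambda>a. \<Sum>n\<in>D. c a n * integral {0..T} (\<lambda>s. (w s * f n s) * ?P a s))"
    by (intro continuous_map_sum assms(1) continuous_map_real_mult assms(2) Cons.IH continuous_on_mult)
      (use Cons.prems in auto)
  ultimately show ?case by simp
qed

lemma weight_continuous: "continuous_on S (\<lambda>s::real. (T - s) ^ \<nu> / fact \<nu>)"
  by (intro continuous_intros) simp

lemma continuous_map_xi_P:
  assumes D: "finite D" "\<And>n. n \<in> D \<Longrightarrow> continuous_map X euclideanreal (\<lambda>a. c a n)"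
    and f: "\<And>n. n \<in> D \<Longrightarrow> continuous_on {0..T} (f n)"
  shows "continuous_map X euclideanreal (\<lambda>a. xi_P j k \<nu> T (\<lambda>x. \<Sum>n\<in>D. c a n * f n x))"
proof -
  let ?F = "\<lambda>j n. iter_prim j (f n)"
  have "xi_P j k \<nu> T (\<lambda>x. \<Sum>n\<in>D. c a n * f n x) = alpha j k * integral {0..T}
    (\<lambda>s. (T - s) ^ \<nu> / fact \<nu> * prod_list (map (\<lambda>f. \<Sum>n\<in>D. c a n * f n s) [?F k, ?F j, ?F j]))" for a
    unfolding xi_P_def
    by (rule arg_cong[where f = "(*) (alpha j k)"], rule integral_cong)
      (simp add: iter_prim_sum[OF D(1) f] power2_eq_square mult_ac)
  moreover have "continuous_map X euclideanreal (\<lambda>a. integral {0..T}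
    (\<lambda>s. (T - s) ^ \<nu> / fact \<nu> * prod_list (map (\<lambda>f. \<Sum>n\<in>D. c a n * f n s) [?F k, ?F j, ?F j])))"
    by (rule continuous_map_multilinear_integral[OF D]) (auto intro: iter_prim_continuous f weight_continuous)
  ultimately show ?thesis
    by (simp only:) (intro continuous_map_real_mult continuous_map_const[THEN iffD2], simp)
qed

lemma continuous_map_xi_Q:
  assumes D: "finite D" "\<And>n. n \<in> D \<Longrightarrow> continuous_map X euclideanreal (\<lambda>a. c a n)"
    and f: "\<And>n. n \<in> D \<Longrightarrow> continuous_on {0..T} (f n)"
  shows "continuous_map X euclideanreal (\<lambda>a. xi_Q j k l \<nu> T (\<lambda>x. \<Sum>n\<in>D. c a n * f n x))"
proof -
  let ?F = "\<lambda>j n. iter_prim j (f n)"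
  have "xi_Q j k l \<nu> T (\<lambda>x. \<Sum>n\<in>D. c a n * f n x) = alpha j k * integral {0..T}
    (\<lambda>s. (T - s) ^ \<nu> / fact \<nu> * prod_list (map (\<lambda>f. \<Sum>n\<in>D. c a n * f n s) [?F l, ?F k, ?F j, ?F j]))" for a
    unfolding xi_Q_def
    by (rule arg_cong[where f = "(*) (alpha j k)"], rule integral_cong)
      (simp add: iter_prim_sum[OF D(1) f] power2_eq_square mult_ac)
  moreover have "continuous_map X euclideanreal (\<lambda>a. integral {0..T}
    (\<lambda>s. (T - s) ^ \<nu> / fact \<nu> * prod_list (map (\<lambda>f. \<Sum>n\<in>D. c a n * f n s) [?F l, ?F k, ?F j, ?F j])))"
    by (rule continuous_map_multilinear_integral[OF D]) (auto intro: iter_prim_continuous f weight_continuous)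
  ultimately show ?thesis
    by (simp only:) (intro continuous_map_real_mult continuous_map_const[THEN iffD2], simp)
qed

section \<open>Coordinates of a concatenated control\<close>

lemma iter_prim_0: "iter_prim j (\<lambda>_. 0) = (\<lambda>_. 0)"
  by (induction j) auto

lemma xi_0: "xi_P j k \<nu> T (\<lambda>_. 0) = 0" "xi_Q j k l \<nu> T (\<lambda>_. 0) = 0"
  by (simp_all add: xi_P_def xi_Q_def iter_prim_0)

text \<open>At every time one of the two parts vanishes: the primitives of \<Theta> up to
  \<open>q\<close>, those of the \<open>N\<close>-th derivative of \<open>g\<close> from
  \<open>q\<close> on. Nonlinear coordinates therefore have no cross terms.\<close>

lemma concatenated_iter_prim:
  assumes \<Theta>: "\<Theta> \<in> Cc q T" and g: "g \<in> Cc 0 q" and q: "0 \<le> q" "q < T" and j: "j \<le> N" and t: "t \<in> {0..T}"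
  shows "iter_prim j (\<lambda>x. \<Theta> x + (deriv ^^ N) g x) t = iter_prim j \<Theta> t + (deriv ^^ (N - j)) g t"
    and "t \<le> q \<Longrightarrow> iter_prim j \<Theta> t = 0" "q \<le> t \<Longrightarrow> (deriv ^^ (N - j)) g t = 0"
proof -
  have "iter_prim j (\<lambda>x. \<Theta> x + (deriv ^^ N) g x) t = iter_prim j \<Theta> t + iter_prim j ((deriv ^^ N) g) t"
    by (rule iter_prim_add[OF _ _ t])
      (auto intro: smooth_continuous_on0 smooth_continuous_on Cc_smooth_fun[OF \<Theta>] Cc_smooth_fun[OF g])
  also have "iter_prim j ((deriv ^^ N) g) t = (deriv ^^ (N - j)) g t"
    using t by (intro iter_prim_deriv[OF g _ j]) auto
  finally show "iter_prim j (\<lambda>x. \<Theta> x + (deriv ^^ N) g x) t = iter_prim j \<Theta> t + (deriv ^^ (N - j)) g t" .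
  show "t \<le> q \<Longrightarrow> iter_prim j \<Theta> t = 0"
    by (rule iter_prim_zero_before[of q]) (use Cc_zero0[OF \<Theta>] in auto)
  show "q \<le> t \<Longrightarrow> (deriv ^^ (N - j)) g t = 0" by (rule Cc_zero[OF g]) auto
qed

lemma moment_Icc:
  assumes "g \<in> Cc 0 q" "q \<le> T"
  shows "moment T g (A, c, \<nu>) / fact \<nu> = integral {0..T} (\<lambda>s. (T - s) ^ \<nu> / fact \<nu> * mon A c g s)"
    "(\<lambda>s. (T - s) ^ \<nu> / fact \<nu> * mon A c g s) integrable_on {0..T}"
proof -
  have "moment T g (A, c, \<nu>) = integral {0..T} (\<lambda>s. (T - s) ^ \<nu> * mon A c g s)"
    unfolding moment_def prod.case by (rule mon_int_Icc[OF smooth_power_diff assms(1)]) (use assms in auto)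
  then show "moment T g (A, c, \<nu>) / fact \<nu> = integral {0..T} (\<lambda>s. (T - s) ^ \<nu> / fact \<nu> * mon A c g s)"
    by (simp add: divide_inverse mult.assoc mult.commute[of _ "inverse (fact \<nu>)"] flip: integral_mult_right)
  show "(\<lambda>s. (T - s) ^ \<nu> / fact \<nu> * mon A c g s) integrable_on {0..T}"
    by (intro integrable_continuous_real continuous_on_mult weight_continuous continuous_on_mon Cc_smooth_fun[OF assms(1)])
qed

text \<open>The primitive of order \<open>k\<close> of the \<open>N\<close>-th derivative of
  \<open>g\<close> is its derivative of order \<open>N - k\<close>, which turns coordinates into
  moments. In the quartic case \<open>k < l\<close> ensures that \<open>{N - l, N - k}\<close> has
  two elements, so that the product over it contains both factors.\<close>

lemma xi_concatenated:
  fixes N :: nat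
  assumes \<Theta>: "\<Theta> \<in> Cc q T" and g: "g \<in> Cc 0 q" and q: "0 \<le> q" "q < T"
  defines "u \<equiv> \<lambda>x. \<Theta> x + (deriv ^^ N) g x"
  shows "\<nu> < N \<Longrightarrow> xi_M \<nu> T u = xi_M \<nu> T \<Theta>"
    and "j \<le> k \<Longrightarrow> k \<le> N \<Longrightarrow> xi_P j k \<nu> T u = xi_P j k \<nu> T \<Theta> + alpha j k / fact \<nu> * moment T g ({N - k}, N - j, \<nu>)"
    and "j \<le> k \<Longrightarrow> k < l \<Longrightarrow> l \<le> N \<Longrightarrow>
      xi_Q j k l \<nu> T u = xi_Q j k l \<nu> T \<Theta> + alpha j k / fact \<nu> * moment T g ({N - l, N - k}, N - j, \<nu>)"
proof -
  note c = concatenated_iter_prim[OF \<Theta> g q]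
  have cont: "continuous_on {0..T} (iter_prim j \<Theta>)" for j
    by (intro iter_prim_continuous smooth_continuous_on0 Cc_smooth_fun[OF \<Theta>])
  show "xi_M \<nu> T u = xi_M \<nu> T \<Theta>" if "\<nu> < N"
    using c(1)[of "Suc \<nu>" N T] c(3)[of "Suc \<nu>" N T] that q unfolding xi_M_def u_def by simp
  show "xi_P j k \<nu> T u = xi_P j k \<nu> T \<Theta> + alpha j k / fact \<nu> * moment T g ({N - k}, N - j, \<nu>)" if jk: "j \<le> k" "k \<le> N"
  proof -
    let ?w = "\<lambda>s. (T - s) ^ \<nu> / fact \<nu>"
    have "integral {0..T} (\<lambda>s. ?w s * iter_prim k u s * (iter_prim j u s)\<^sup>2) =
      integral {0..T} (\<lambda>s. ?w s * iter_prim k \<Theta> s * (iter_prim j \<Theta> s)\<^sup>2 + ?w s * mon {N - k} (N - j) g s)"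
    proof (rule integral_cong)
      fix s assume s: "s \<in> {0..T}"
      show "?w s * iter_prim k u s * (iter_prim j u s)\<^sup>2 =
        ?w s * iter_prim k \<Theta> s * (iter_prim j \<Theta> s)\<^sup>2 + ?w s * mon {N - k} (N - j) g s"
        using c(1)[of j N s] c(1)[of k N s] c(2)[of j N s] c(2)[of k N s] c(3)[of j N s] c(3)[of k N s] s jk
        by (cases "s \<le> q") (auto simp: u_def mon_def)
    qed
    also have "\<dots> = integral {0..T} (\<lambda>s. ?w s * iter_prim k \<Theta> s * (iter_prim j \<Theta> s)\<^sup>2) + moment T g ({N - k}, N - j, \<nu>) / fact \<nu>"
      unfolding moment_Icc(1)[OF g less_imp_le[OF q(2)]]
      by (intro Henstock_Kurzweil_Integration.integral_add integrable_continuous_real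
          moment_Icc(2)[OF g less_imp_le[OF q(2)]] continuous_on_mult weight_continuous cont continuous_on_power)
    finally show ?thesis by (simp add: xi_P_def distrib_left)
  qed
  show "xi_Q j k l \<nu> T u = xi_Q j k l \<nu> T \<Theta> + alpha j k / fact \<nu> * moment T g ({N - l, N - k}, N - j, \<nu>)"
    if jk: "j \<le> k" "k < l" "l \<le> N"
  proof -
    let ?w = "\<lambda>s. (T - s) ^ \<nu> / fact \<nu>"
    have ne: "N - l \<noteq> N - k" using jk by simp
    have "integral {0..T} (\<lambda>s. ?w s * iter_prim l u s * iter_prim k u s * (iter_prim j u s)\<^sup>2) =
      integral {0..T} (\<lambda>s. ?w s * iter_prim l \<Theta> s * iter_prim k \<Theta> s * (iter_prim j \<Theta> s)\<^sup>2 + ?w s * mon {N - l, N - k} (N - j) g s)"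
    proof (rule integral_cong)
      fix s assume s: "s \<in> {0..T}"
      show "?w s * iter_prim l u s * iter_prim k u s * (iter_prim j u s)\<^sup>2 =
        ?w s * iter_prim l \<Theta> s * iter_prim k \<Theta> s * (iter_prim j \<Theta> s)\<^sup>2 + ?w s * mon {N - l, N - k} (N - j) g s"
        using c(1)[of j N s] c(1)[of k N s] c(2)[of j N s] c(2)[of k N s] c(3)[of j N s] c(3)[of k N s]
          c(1)[of l N s] c(2)[of l N s] c(3)[of l N s] s jk ne
        by (cases "s \<le> q") (auto simp: u_def mon_def)
    qed
    also have "\<dots> = integral {0..T} (\<lambda>s. ?w s * iter_prim l \<Theta> s * iter_prim k \<Theta> s * (iter_prim j \<Theta> s)\<^sup>2) +
        moment T g ({N - l, N - k}, N - j, \<nu>) / fact \<nu>"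
      unfolding moment_Icc(1)[OF g less_imp_le[OF q(2)]]
      by (intro Henstock_Kurzweil_Integration.integral_add integrable_continuous_real
          moment_Icc(2)[OF g less_imp_le[OF q(2)]] continuous_on_mult weight_continuous cont continuous_on_power)
    finally show ?thesis by (simp add: xi_Q_def distrib_left)
  qed
qed

text \<open>The bound for \<open>M_br \<nu>\<close> is strict because its coordinate is a primitive
  of order \<open>\<nu> + 1\<close>, which must not exceed \<open>N\<close>. The sum of the
  individual bounds serves as a common one.\<close>

lemma bracket_index_bound:
  assumes "finite G" "G \<subseteq> B1_star \<union> B3_star \<union> B4_good_star"
  shows "\<exists>N. \<forall>b\<in>G. (\<exists>\<nu><N. b = M_br \<nu>) \<or> (\<exists>j k \<nu>. 1 \<le> j \<and> j \<le> k \<and> k \<le> N \<and> \<nu> \<le> N \<and> b = P_br j k \<nu>) \<or>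
    (\<exists>j k l \<nu>. 1 \<le> j \<and> j \<le> k \<and> k < l \<and> l \<le> N \<and> \<nu> \<le> N \<and> b = Q_br j k l \<nu>)"
proof -
  define \<Phi> where "\<Phi> N b \<longleftrightarrow> (\<exists>\<nu><N. b = M_br \<nu>) \<or> (\<exists>j k \<nu>. 1 \<le> j \<and> j \<le> k \<and> k \<le> N \<and> \<nu> \<le> N \<and> b = P_br j k \<nu>) \<or>
    (\<exists>j k l \<nu>. 1 \<le> j \<and> j \<le> k \<and> k < l \<and> l \<le> N \<and> \<nu> \<le> N \<and> b = Q_br j k l \<nu>)" for N b
  have mono: "\<Phi> N' b" if "\<Phi> N b" "N \<le> N'" for N N' b
    using that(1)[unfolded \<Phi>_def]
  proof (elim disjE exE conjE)
    fix \<nu> assume *: "\<nu> < N" "b = M_br \<nu>"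
    then have "\<exists>\<nu><N'. b = M_br \<nu>" using that(2) by (intro exI[of _ \<nu>]) auto
    then show ?thesis unfolding \<Phi>_def by (rule disjI1)
  next
    fix j k \<nu> assume *: "1 \<le> j" "j \<le> k" "k \<le> N" "\<nu> \<le> N" "b = P_br j k \<nu>"
    then have "\<exists>j k \<nu>. 1 \<le> j \<and> j \<le> k \<and> k \<le> N' \<and> \<nu> \<le> N' \<and> b = P_br j k \<nu>"
      using that(2) by (intro exI[of _ j] exI[of _ k] exI[of _ \<nu>]) auto
    then show ?thesis unfolding \<Phi>_def by (rule disjI1[THEN disjI2])
  next
    fix j k l \<nu> assume *: "1 \<le> j" "j \<le> k" "k < l" "l \<le> N" "\<nu> \<le> N" "b = Q_br j k l \<nu>"
    then have "\<exists>j k l \<nu>. 1 \<le> j \<and> j \<le> k \<and> k < l \<and> l \<le> N' \<and> \<nu> \<le> N' \<and> b = Q_br j k l \<nu>"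
      using that(2) by (intro exI[of _ j] exI[of _ k] exI[of _ l] exI[of _ \<nu>]) auto
    then show ?thesis unfolding \<Phi>_def by (rule disjI2[THEN disjI2])
  qed
  have "\<exists>N. \<Phi> N b" if b: "b \<in> G" for b
  proof -
    consider \<nu> where "b = M_br \<nu>" | j k \<nu> where "1 \<le> j" "j \<le> k" "b = P_br j k \<nu>"
      | j k l \<nu> where "1 \<le> j" "j \<le> k" "k < l" "b = Q_br j k l \<nu>"
      using b assms(2) unfolding B1_star_def B3_star_def B4_good_star_def by blast
    then show ?thesis
    proof cases
      case (1 \<nu>)
      then have "\<Phi> (Suc \<nu>) b" unfolding \<Phi>_def by blast
      then show ?thesis ..
    next
      case (2 j k \<nu>)
      then have "\<exists>j' k' \<nu>'. 1 \<le> j' \<and> j' \<le> k' \<and> k' \<le> k + \<nu> \<and> \<nu>' \<le> k + \<nu> \<and> b = P_br j' k' \<nu>'"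
        by (intro exI[of _ j] exI[of _ k] exI[of _ \<nu>]) auto
      then have "\<Phi> (k + \<nu>) b" unfolding \<Phi>_def by (rule disjI1[THEN disjI2])
      then show ?thesis ..
    next
      case (3 j k l \<nu>)
      then have "\<exists>j' k' l' \<nu>'. 1 \<le> j' \<and> j' \<le> k' \<and> k' < l' \<and> l' \<le> l + \<nu> \<and> \<nu>' \<le> l + \<nu> \<and> b = Q_br j' k' l' \<nu>'"
        by (intro exI[of _ j] exI[of _ k] exI[of _ l] exI[of _ \<nu>]) auto
      then have "\<Phi> (l + \<nu>) b" unfolding \<Phi>_def by (rule disjI2[THEN disjI2])
      then show ?thesis ..
    qed
  qed
  then obtain f where f: "\<And>b. b \<in> G \<Longrightarrow> \<Phi> (f b) b" by metis
  have "\<Phi> (sum f G) b" if "b \<in> G" for b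
    using f[OF that] member_le_sum[OF that _ assms(1), of f] by (intro mono[OF f[OF that]]) simp
  then show ?thesis unfolding \<Phi>_def by blast
qed

theorem theorem1p12:
  fixes G :: "bracket set" and T :: real
  assumes "finite G"
    and "G \<subseteq> B1_star \<union> B3_star \<union> B4_good_star"
    and "0 < T"
  shows "(\<lambda>u. \<lambda>b\<in>G. xi b T u) ` Cc_smooth T = (G \<rightarrow>\<^sub>E (UNIV :: real set)) \<and>
    (\<exists>R :: (bracket \<Rightarrow> real) \<Rightarrow> real \<Rightarrow> real.
       R \<in> (G \<rightarrow>\<^sub>E UNIV) \<rightarrow> Cc_smooth T \<and>
       (\<forall>a \<in> G \<rightarrow>\<^sub>E UNIV. (\<lambda>b\<in>G. xi b T (R a)) = a) \<and>
       R (\<lambda>b\<in>G. 0) = (\<lambda>_. 0) \<and>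
       (\<forall>k. continuous_map (product_topology (\<lambda>_. euclideanreal) G) (Wk_inf_0_topology T k) R))"
proof -
  note T = assms(3)
  let ?X = "product_topology (\<lambda>_. euclideanreal) G"
  obtain N where N: "\<forall>b\<in>G. (\<exists>\<nu><N. b = M_br \<nu>) \<or> (\<exists>j k \<nu>. 1 \<le> j \<and> j \<le> k \<and> k \<le> N \<and> \<nu> \<le> N \<and> b = P_br j k \<nu>) \<or>
    (\<exists>j k l \<nu>. 1 \<le> j \<and> j \<le> k \<and> k < l \<and> l \<le> N \<and> \<nu> \<le> N \<and> b = Q_br j k l \<nu>)"
    using bracket_index_bound[OF assms(1,2)] by blast

  \<comment> \<open>Choice of the pieces and of their slots\<close>
  obtain D3 \<psi>3 d3 L3 where D3: "finite D3" "D3 \<subseteq> {0..}" "\<forall>n\<in>D3. \<psi>3 n \<in> Cc (tn T n) (tn T (Suc n))"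
    "\<forall>n y. (d3 n y :: real) \<ge> 0" "\<forall>n. d3 n (\<lambda>_. 0) = 0" "\<forall>y. \<forall>i\<in>Idx N 1. (\<Sum>n\<in>D3. d3 n y * moment T (\<psi>3 n) i) = y i"
    "\<forall>n y y'. \<bar>d3 n y - d3 n y'\<bar> \<le> L3 * (\<Sum>i\<in>Idx N 1. \<bar>y i - y' i\<bar>)"
    using cubic_family[OF T, where m = 0 and N = N] by (elim exE conjE) (rule that; assumption)
  \<comment> \<open>Starting above \<open>\<Sum>D3\<close> keeps the quartic slots apart from the
    cubic ones.\<close>
  obtain D4 \<psi>4 d4 L4 where D4: "finite D4" "D4 \<subseteq> {Suc (\<Sum>D3)..}" "\<forall>n\<in>D4. \<psi>4 n \<in> Cc (tn T n) (tn T (Suc n)) \<inter> vanishing T N"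
    "\<forall>n y. (d4 n y :: real) \<ge> 0" "\<forall>n. d4 n (\<lambda>_. 0) = 0" "\<forall>y. \<forall>i\<in>Idx N 2. (\<Sum>n\<in>D4. d4 n y * moment T (\<psi>4 n) i) = y i"
    "\<forall>n y y'. \<bar>d4 n y - d4 n y'\<bar> \<le> L4 * (\<Sum>i\<in>Idx N 2. \<bar>y i - y' i\<bar>)"
    using quartic_family[OF T, where m = "Suc (\<Sum>D3)" and N = N] by (elim exE conjE) (rule that; assumption)
  define D where "D = D3 \<union> D4"
  \<comment> \<open>A time after all slots in use and still before \<open>T\<close>; the linear
    pieces live in the remaining interval.\<close>
  define q where "q = tn T (Suc (\<Sum>D))"
  have le_sum: "n \<le> \<Sum>E" if "finite E" "n \<in> E" for n and E :: "nat set"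
    using member_le_sum[of n E "\<lambda>n. n"] that by auto
  have disj: "D3 \<inter> D4 = {}" using le_sum[OF D3(1)] D4(2) by fastforce
  have D: "finite D" using D3 D4 by (simp add: D_def)
  have q: "0 \<le> q" "q < T" using tn_props[OF T] by (auto simp: q_def)
  obtain D1 \<theta> d1 L1 where D1: "finite D1" "\<forall>n\<in>D1. \<theta> n \<in> Cc q T" "\<forall>n. d1 n (\<lambda>_. 0) = (0::real)"
    "\<forall>y. \<forall>\<nu><N. (\<Sum>n\<in>D1. d1 n y * iter_prim (Suc \<nu>) (\<theta> n) T) = y \<nu>"
    "\<forall>n::nat. \<forall>y y'. \<bar>d1 n y - d1 n y'\<bar> \<le> L1 * (\<Sum>\<nu><N. \<bar>y \<nu> - y' \<nu>\<bar>)"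
    using linear_family[OF q, where N = N] by (elim exE conjE) (rule that; assumption)
  define \<psi> where "\<psi> n = (if n \<in> D3 then \<psi>3 n else \<psi>4 n)" for n
  have \<psi>: "\<psi> n \<in> Cc (tn T n) (tn T (Suc n))" if "n \<in> D" for n
    using that D3 D4 by (auto simp: \<psi>_def D_def)
  have \<psi>q: "\<psi> n \<in> Cc 0 q" if "n \<in> D" for n
    using le_sum[OF D that] tn_props(4)[OF T, of n] tn_mono[OF T, of "Suc n" "Suc (\<Sum>D)"]
    by (intro Cc_mono[OF \<psi>[OF that]]) (auto simp: q_def)

  \<comment> \<open>Brackets outside \<open>G\<close> get the target 0, so that the three systems
    can be solved on their full index sets.\<close>
  define ext where "ext a b = (if b \<in> G then a b else 0)" for a :: "bracket \<Rightarrow> real" and b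
  define c1 where "c1 a n = d1 n (\<lambda>\<nu>. ext a (M_br \<nu>))" for a n
  define \<Theta> where "\<Theta> a x = (\<Sum>n\<in>D1. c1 a n * \<theta> n x)" for a x
  \<comment> \<open>Decodes an index: for \<open>({N - k}, N - j, \<nu>)\<close>,
    \<open>N - c\<close> is \<open>j\<close> and \<open>N - Max A\<close> is \<open>k\<close>; for
    two elements \<open>N - Min A\<close> is \<open>l\<close>, since \<open>N - l < N - k\<close>.
    The coordinate already produced by the linear pieces is subtracted and the normalizing factor
    inverted.\<close>
  define y where "y a = (\<lambda>(A, c, \<nu>). fact \<nu> / alpha (N - c) (N - Max A) *
    (ext a (P_br (N - c) (N - Max A) \<nu>) - xi_P (N - c) (N - Max A) \<nu> T (\<Theta> a)))" for a
  define c3 where "c3 a n = root 3 (d3 n (y a))" for a n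
  \<comment> \<open>The cubic pieces also have quartic moments, entering with the fourth power of
    their amplitudes, and these are subtracted here. There is no circularity: the quartic pieces lie
    in \<open>vanishing T N\<close> and leave the cubic coordinates untouched.\<close>
  define z where "z a i = (case i of (A, c, \<nu>) \<Rightarrow> fact \<nu> / alpha (N - c) (N - Max A) *
    (ext a (Q_br (N - c) (N - Max A) (N - Min A) \<nu>) - xi_Q (N - c) (N - Max A) (N - Min A) \<nu> T (\<Theta> a))) -
    (\<Sum>n\<in>D3. c3 a n ^ 4 * moment T (\<psi>3 n) i)" for a i
  \<comment> \<open>Its fourth power is \<open>d4 n (z a)\<close> precisely because the coefficients
    of the family are nonnegative.\<close>
  define c4 where "c4 a n = root 4 (d4 n (z a))" for a n
  define \<kappa> where "\<kappa> a n = (if n \<in> D3 then c3 a n else c4 a n)" for a n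
  define g where "g a x = (\<Sum>n\<in>D. \<kappa> a n * \<psi> n x)" for a x
  define R where "R a x = \<Theta> a x + (deriv ^^ N) (g a) x" for a x

  have \<Theta>: "\<Theta> a \<in> Cc q T" for a
    unfolding \<Theta>_def[abs_def] by (rule Cc_sum) (use D1 q in auto)
  have g: "g a \<in> Cc 0 q" for a
  proof -
    have "0 < q" using tn_props(1)[OF T] tn_props(2)[OF T, of 0] tn_mono[OF T, of 1 "Suc (\<Sum>D)"] by (simp add: q_def)
    then show ?thesis unfolding g_def[abs_def] by (intro Cc_sum D \<psi>q)
  qed
  have deriv_g: "(deriv ^^ N) (g a) = (\<lambda>x. \<Sum>n\<in>D. \<kappa> a n * (deriv ^^ N) (\<psi> n) x)" for a
    unfolding g_def[abs_def] by (rule smooth_sum(2)) (use \<psi> Cc_smooth_fun in blast)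
  have R_Cc: "R a \<in> Cc 0 T" for a
    unfolding R_def[abs_def]
    by (intro Cc_add Cc_mono[OF \<Theta>] Cc_mono[OF Cc_deriv[OF g]]) (use q in auto)

  \<comment> \<open>The control attains the prescribed coordinates\<close>
  have moment_g: "moment T (g a) (A, c, \<nu>) = (\<Sum>n\<in>D3. c3 a n ^ (card A + 2) * moment T (\<psi>3 n) (A, c, \<nu>)) +
    (\<Sum>n\<in>D4. c4 a n ^ (card A + 2) * moment T (\<psi>4 n) (A, c, \<nu>))" for a A c \<nu>
  proof -
    have "moment T (g a) (A, c, \<nu>) = (\<Sum>n\<in>D. \<kappa> a n ^ (card A + 2) * moment T (\<psi> n) (A, c, \<nu>))"
      unfolding moment_def prod.case g_def[abs_def]
    proof (rule mon_int_disjoint_sum[OF D \<psi> _ smooth_power_diff])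
      fix n m :: nat assume "n \<noteq> m"
      then show "tn T (Suc n) \<le> tn T m \<or> tn T (Suc m) \<le> tn T n"
        using tn_mono[OF T, of "Suc n" m] tn_mono[OF T, of "Suc m" n] by linarith
    qed
    also have "\<dots> = (\<Sum>n\<in>D3. \<kappa> a n ^ (card A + 2) * moment T (\<psi> n) (A, c, \<nu>)) +
      (\<Sum>n\<in>D4. \<kappa> a n ^ (card A + 2) * moment T (\<psi> n) (A, c, \<nu>))"
      unfolding D_def by (rule sum.union_disjoint[OF D3(1) D4(1) disj])
    also have "(\<Sum>n\<in>D4. \<kappa> a n ^ (card A + 2) * moment T (\<psi> n) (A, c, \<nu>)) =
      (\<Sum>n\<in>D4. c4 a n ^ (card A + 2) * moment T (\<psi>4 n) (A, c, \<nu>))"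
      using disj by (intro sum.cong refl) (auto simp: \<kappa>_def \<psi>_def)
    also have "(\<Sum>n\<in>D3. \<kappa> a n ^ (card A + 2) * moment T (\<psi> n) (A, c, \<nu>)) =
      (\<Sum>n\<in>D3. c3 a n ^ (card A + 2) * moment T (\<psi>3 n) (A, c, \<nu>))"
      by (intro sum.cong refl) (auto simp: \<kappa>_def \<psi>_def)
    finally show ?thesis .
  qed
  have c3_pow: "c3 a n ^ 3 = d3 n (y a)" and c4_pow: "c4 a n ^ 4 = d4 n (z a)" for a n
    using D3(4) D4(4) by (simp_all add: c3_def c4_def real_root_pow_pos2)
  have R_xi: "xi b T (R a) = a b" if b: "b \<in> G" for a b
  proof -
    have R_eq: "(\<lambda>x. \<Theta> a x + (deriv ^^ N) (g a) x) = R a" by (simp add: R_def[abs_def])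
    note conc = xi_concatenated[OF \<Theta>[of a] g[of a] q, where N = N, unfolded R_eq]
    have al: "alpha j k \<noteq> 0" for j k by (simp add: alpha_def)
    consider \<nu> where "\<nu> < N" "b = M_br \<nu>"
      | j k \<nu> where "1 \<le> j" "j \<le> k" "k \<le> N" "\<nu> \<le> N" "b = P_br j k \<nu>"
      | j k l \<nu> where "1 \<le> j" "j \<le> k" "k < l" "l \<le> N" "\<nu> \<le> N" "b = Q_br j k l \<nu>"
      using bspec[OF N b] by (elim disjE exE conjE) blast+
    then show ?thesis
    proof cases
      case (1 \<nu>)
      have "xi b T (R a) = iter_prim (Suc \<nu>) (\<Theta> a) T"
        using conc(1)[OF 1(1)] 1(2) by (simp add: xi_M_br xi_M_def del: iter_prim.simps)
      also have "\<dots> = (\<Sum>n\<in>D1. c1 a n * iter_prim (Suc \<nu>) (\<theta> n) T)"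
        unfolding \<Theta>_def[abs_def]
        by (rule iter_prim_sum[OF D1(1)])
          (use D1(2) T in \<open>auto intro: smooth_continuous_on0 Cc_smooth_fun\<close>)
      also have "\<dots> = ext a (M_br \<nu>)"
        using D1(4) 1(1) unfolding c1_def by blast
      finally show ?thesis using that 1 by (simp add: ext_def)
    next
      case (2 j k \<nu>)
      let ?i = "({N - k}, N - j, \<nu>)"
      have i: "?i \<in> Idx N 1" using 2 by (auto simp: Idx_def)
      have van: "moment T (\<psi>4 n) ?i = 0" if "n \<in> D4" for n
        using D4(3) that i by (auto simp: vanishing_def)
      have three: "card {N - k} + 2 = 3" by simp
      have "moment T (g a) ?i = (\<Sum>n\<in>D3. d3 n (y a) * moment T (\<psi>3 n) ?i)"
        unfolding moment_g three c3_pow by (simp add: van)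
      also have "\<dots> = y a ?i" using D3(6) i by blast
      also have "\<dots> = fact \<nu> / alpha j k * (a b - xi_P j k \<nu> T (\<Theta> a))"
        using 2 that by (simp add: y_def ext_def)
      finally show ?thesis
        using conc(2)[OF 2(2,3), where \<nu> = \<nu>] 2 al[of j k] by (simp add: xi_P_br)
    next
      case (3 j k l \<nu>)
      let ?A = "{N - l, N - k}"
      let ?i = "(?A, N - j, \<nu>)"
      have lt: "N - l < N - k" using 3 by simp
      have A: "card ?A = 2" "Max ?A = N - k" "Min ?A = N - l" using lt by auto
      have i: "?i \<in> Idx N 2" using 3 A by (auto simp: Idx_def)
      have "moment T (g a) ?i = (\<Sum>n\<in>D3. c3 a n ^ 4 * moment T (\<psi>3 n) ?i) + (\<Sum>n\<in>D4. d4 n (z a) * moment T (\<psi>4 n) ?i)"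
        unfolding moment_g A(1) using c4_pow by simp
      also have "(\<Sum>n\<in>D4. d4 n (z a) * moment T (\<psi>4 n) ?i) = z a ?i" using D4(6) i by blast
      also have "(\<Sum>n\<in>D3. c3 a n ^ 4 * moment T (\<psi>3 n) ?i) + z a ?i =
        fact \<nu> / alpha j k * (a b - xi_Q j k l \<nu> T (\<Theta> a))"
        using 3 that A by (simp add: z_def ext_def)
      finally show ?thesis
        using conc(3)[OF 3(2,3,4), where \<nu> = \<nu>] 3 al[of j k] by (simp add: xi_Q_br)
    qed
  qed

  \<comment> \<open>Continuity of the amplitudes and of the right inverse\<close>
  have cont_ext: "continuous_map ?X euclideanreal (\<lambda>a. ext a b)" for b
    unfolding ext_def by (cases "b \<in> G") (auto intro: continuous_map_product_projection)
  have cont_c1: "continuous_map ?X euclideanreal (\<lambda>a. c1 a n)" for n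
    unfolding c1_def
    by (rule continuous_map_lipschitz[where I = "{..<N}" and L = L1 and d = "d1 n"])
      (use D1(5) cont_ext in auto)
  have cont_\<theta>: "continuous_on {0..T} (\<theta> n)" if "n \<in> D1" for n
    using D1(2) that by (blast intro: smooth_continuous_on0 Cc_smooth_fun)
  have cont_P: "continuous_map ?X euclideanreal (\<lambda>a. xi_P j k \<nu> T (\<Theta> a))" for j k \<nu>
    unfolding \<Theta>_def[abs_def] by (rule continuous_map_xi_P[OF D1(1) cont_c1 cont_\<theta>])
  have cont_Q: "continuous_map ?X euclideanreal (\<lambda>a. xi_Q j k l \<nu> T (\<Theta> a))" for j k l \<nu>
    unfolding \<Theta>_def[abs_def] by (rule continuous_map_xi_Q[OF D1(1) cont_c1 cont_\<theta>])
  have const: "continuous_map ?X euclideanreal (\<lambda>_. r)" for r by simp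
  have cont_y: "continuous_map ?X euclideanreal (\<lambda>a. y a i)" for i
    unfolding y_def by (cases i) (simp only: prod.case, intro continuous_map_real_mult continuous_map_diff const cont_ext cont_P)
  \<comment> \<open>Roots are continuous but not Lipschitz at 0, so from here on only continuity is
    propagated.\<close>
  have cont_c3: "continuous_map ?X euclideanreal (\<lambda>a. c3 a n)" for n
    unfolding c3_def
    by (intro continuous_map_root continuous_map_lipschitz[where I = "Idx N 1" and L = L3 and d = "d3 n"])
      (use D3(7) cont_y finite_Idx in auto)
  have cont_z: "continuous_map ?X euclideanreal (\<lambda>a. z a i)" for i
    unfolding z_def
    by (cases i) (simp only: prod.case, intro continuous_map_real_mult continuous_map_diff continuous_map_sum
        continuous_map_real_pow const cont_ext cont_Q cont_c3 D3(1))
  have cont_c4: "continuous_map ?X euclideanreal (\<lambda>a. c4 a n)" for n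
    unfolding c4_def
    by (intro continuous_map_root continuous_map_lipschitz[where I = "Idx N 2" and L = L4 and d = "d4 n"])
      (use D4(7) cont_z finite_Idx in auto)
  have cont_\<kappa>: "continuous_map ?X euclideanreal (\<lambda>a. \<kappa> a n)" for n
    unfolding \<kappa>_def by (cases "n \<in> D3") (simp_all add: cont_c3 cont_c4)
  have cont_R: "continuous_map ?X (Wk_inf_0_topology T k) R" for k
  proof -
    \<comment> \<open>The control is a combination of fixed functions: the linear pieces and the
      \<open>N\<close>-th derivatives of the others. \<open>D1\<close> and \<open>D\<close> may
      share numbers, hence the disjoint sum of the index sets.\<close>
    define U where "U = case_sum \<theta> (\<lambda>n. (deriv ^^ N) (\<psi> n))"
    define c where "c a = case_sum (c1 a) (\<kappa> a)" for a
    have "R = (\<lambda>a x. \<Sum>n\<in>D1 <+> D. c a n * U n x)"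
      by (simp add: R_def[abs_def] deriv_g \<Theta>_def sum.Plus D1(1) D U_def c_def fun_eq_iff)
    moreover have "continuous_map ?X (Wk_inf_0_topology T k) (\<lambda>a x. \<Sum>n\<in>D1 <+> D. c a n * U n x)"
    proof (rule continuous_map_Wk_inf_0[OF T])
      show "finite (D1 <+> D)" using D1(1) D by simp
      show "U n \<in> Cc 0 T" if "n \<in> D1 <+> D" for n
        using that D1(2) \<psi>q q by (auto simp: U_def intro!: Cc_mono[OF Cc_deriv[of _ 0 q]] intro: Cc_mono[of _ q T])
      show "continuous_map ?X euclideanreal (\<lambda>a. c a n)" if "n \<in> D1 <+> D" for n
        using that by (auto simp: c_def cont_c1 cont_\<kappa>)
    qed
    ultimately show ?thesis by simp
  qed

  have R0: "R (\<lambda>b\<in>G. 0) = (\<lambda>_. 0)"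
  proof -
    let ?a = "\<lambda>b\<in>G. 0::real"
    have e: "ext ?a b = 0" for b by (simp add: ext_def)
    have \<Theta>0: "\<Theta> ?a = (\<lambda>_. 0)" using D1(3) by (simp add: \<Theta>_def[abs_def] c1_def e)
    have "y ?a = (\<lambda>_. 0)" by (simp add: y_def e \<Theta>0 xi_0 fun_eq_iff)
    then have c30: "c3 ?a n = 0" for n using D3(5) by (simp add: c3_def)
    have "z ?a = (\<lambda>_. 0)" by (simp add: z_def e \<Theta>0 xi_0 c30 fun_eq_iff split: prod.split)
    then have "c4 ?a n = 0" for n using D4(5) by (simp add: c4_def)
    then show ?thesis
      by (simp add: R_def[abs_def] deriv_g \<kappa>_def \<Theta>0 c30 if_distrib cong: if_cong)
  qed
  have R_right_inverse: "(\<lambda>b\<in>G. xi b T (R a)) = a" if "a \<in> G \<rightarrow>\<^sub>E UNIV" for a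
    using that R_xi by (auto simp: fun_eq_iff restrict_def PiE_def extensional_def)
  have R_smooth: "R a \<in> Cc_smooth T" for a using R_Cc Cc_smooth_eq[OF T] by simp
  have "(\<lambda>u. \<lambda>b\<in>G. xi b T u) ` Cc_smooth T = (G \<rightarrow>\<^sub>E (UNIV :: real set))"
  proof (intro equalityI subsetI)
    fix a :: "bracket \<Rightarrow> real" assume "a \<in> G \<rightarrow>\<^sub>E UNIV"
    then show "a \<in> (\<lambda>u. \<lambda>b\<in>G. xi b T u) ` Cc_smooth T"
      using R_right_inverse R_smooth by (intro image_eqI[of _ _ "R a"]) auto
  qed auto
  then show ?thesis
    using R_smooth R_right_inverse R0 cont_R by (intro conjI exI[of _ R]) auto
qed

end
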